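(* Let $r\ge2$ and let $M=M_{k(r)}\in\mathcal{F}$, with $j_i=k_i+k_i'$ for $1\le i\le r-1$. Then $$H_1(M,\mathbb{Z})\simeq\mathbb{Z}\oplus\mathbb{Z}_2^{\,j_{r-1}+\cdots+j_1},\qquad H^1(M,\mathbb{Z})\simeq\mathbb{Z},\qquad H^1(M,\mathbb{Z}_2)\simeq\mathbb{Z}_2^{\,j_{r-1}+\cdots+j_1+1}.$$
   Context: The family $\mathcal{F}$: for $i\ge1$ let $C_i\in\mathrm{SO}(2^i,\mathbb{Z})$ be the companion matrix of $x^{2^i}+1$, i.e. $C_ie_j=e_{j+1}$ for $1\le j\le 2^i-1$ and $C_ie_{2^i}=-e_1$. Let $J_0=(-1)$ and, for $i\ge1$, $J_i=\begin{pmatrix}0&J_{i-1}\\ I_{2^{i-1}}&0\end{pmatrix}\in\mathrm{SO}(2^i,\mathbb{Z})$ (blocks of size $2^{i-1}$); so $C_1=J_1$. For $r\ge2$ and nonnegative integers $k_{r-1},k'_{r-1},\dots,k_2,k_2',k_1$ put $k_1'=0$, $j_i=k_i+k_i'$, and assume $j_{r-1}>0$ and $j_1$ odd. Let $k(r)=(k_{r-1},k_{r-1}',\dots,k_2,k_2',k_1)$ and let $B=B_{k(r)}$ be the block-diagonal matrix with $k_i$ blocks $C_i$ and $k_i'$ blocks $J_i$ for $i=r-1,\dots,1$ (in this order, $C_i$'s before $J_i$'s), followed by a last block $1$. It lies in $\mathrm{SO}(n,\mathbb{Z})$ and has order $2^r$, with $n=2^{r-1}j_{r-1}+\cdots+4j_2+2j_1+1\equiv3\pmod4$.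 Let $\Gamma_{k(r)}$ be the group of isometries of $\mathbb{R}^n$ generated by $x\mapsto B(x+\frac1{2^r}e_n)$ and the translations by $\mathbb{Z}^n$; it is discrete, cocompact and torsion-free. Put $M_{k(r)}=\Gamma_{k(r)}\backslash\mathbb{R}^n$. $\mathcal{F}$ is the set of all these manifolds. *)

theory Defs
  imports
    "HOL-Homology.Homology"
    "HOL-Algebra.Group_Action"
    "HOL-Algebra.Product_Groups"
    "Jordan_Normal_Form.Matrix"
begin

section \<open>Quotient spaces\<close>

definition quotient_topology :: "'a topology \<Rightarrow> ('a \<Rightarrow> 'b) \<Rightarrow> 'b topology" where
  "quotient_topology X f =
     topology (\<lambda>U. U \<subseteq> f ` topspace X \<and> openin X {x \<in> topspace X. f x \<in> U})"

lemma openin_quotient_topology: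
  "openin (quotient_topology X f) U \<longleftrightarrow>
     U \<subseteq> f ` topspace X \<and> openin X {x \<in> topspace X. f x \<in> U}"
proof -
  let ?L = "\<lambda>U. U \<subseteq> f ` topspace X \<and> openin X {x \<in> topspace X. f x \<in> U}"
  have "?L (S \<inter> T)" if "?L S" "?L T" for S T
  proof -
    have "{x \<in> topspace X. f x \<in> S \<inter> T} = {x \<in> topspace X. f x \<in> S} \<inter> {x \<in> topspace X. f x \<in> T}"
      by auto
    with that show ?thesis by auto
  qed
  moreover have "?L (\<Union>\<K>)" if "\<forall>K\<in>\<K>. ?L K" for \<K>
  proof -
    have "{x \<in> topspace X. f x \<in> \<Union>\<K>} = (\<Union>K\<in>\<K>. {x \<in> topspace X. f x \<in> K})"
      by auto
    with that show ?thesis by auto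
  qed
  ultimately have "istopology ?L"
    unfolding istopology_def by blast
  then show ?thesis
    unfolding quotient_topology_def by (simp add: topology_inverse')
qed

lemma topspace_quotient_topology [simp]:
  "topspace (quotient_topology X f) = f ` topspace X"
proof
  show "topspace (quotient_topology X f) \<subseteq> f ` topspace X"
    by (metis openin_quotient_topology openin_topspace)
  have "{x \<in> topspace X. f x \<in> f ` topspace X} = topspace X"
    by auto
  then have "openin (quotient_topology X f) (f ` topspace X)"
    by (simp add: openin_quotient_topology)
  then show "f ` topspace X \<subseteq> topspace (quotient_topology X f)"
    by (rule openin_subset)
qed

lemma quotient_map_quotient_topology: "quotient_map X (quotient_topology X f) f"
  by (auto simp: quotient_map_def openin_quotient_topology)

text \<open>The orbit space of a group of self-bijections of \<open>topspace X\<close> (a subgroup of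
  \<open>BijGroup (topspace X)\<close>), which acts by evaluation.\<close>

definition orbit_space :: "('a \<Rightarrow> 'a) monoid \<Rightarrow> 'a topology \<Rightarrow> 'a set topology" where
  "orbit_space \<Gamma> X = quotient_topology X (Group_Action.orbit \<Gamma> (\<lambda>\<gamma>. \<gamma>))"


section \<open>Singular cohomology with coefficients\<close>

text \<open>\<open>Hom(C\<^sub>p(X), A)\<close>; cochains are extensional so that equal homomorphisms are equal functions.\<close>

definition cochain_group ::
    "nat \<Rightarrow> 'a topology \<Rightarrow> 'b monoid \<Rightarrow> ('a chain \<Rightarrow> 'b) monoid" where
  "cochain_group p X A =
     \<lparr>carrier = hom (chain_group p X) A \<inter> extensional (carrier (chain_group p X)),
      monoid.mult = (\<lambda>f g. \<lambda>c\<in>carrier (chain_group p X). f c \<otimes>\<^bsub>A\<^esub> g c),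
      one = (\<lambda>c\<in>carrier (chain_group p X). \<one>\<^bsub>A\<^esub>)\<rparr>"

definition coboundary_map ::
    "nat \<Rightarrow> 'a topology \<Rightarrow> ('a chain \<Rightarrow> 'b) \<Rightarrow> 'a chain \<Rightarrow> 'b" where
  "coboundary_map p X f = (\<lambda>c\<in>carrier (chain_group (Suc p) X). f (chain_boundary (Suc p) c))"

definition cocycle_group ::
    "nat \<Rightarrow> 'a topology \<Rightarrow> 'b monoid \<Rightarrow> ('a chain \<Rightarrow> 'b) monoid" where
  "cocycle_group p X A =
     subgroup_generated (cochain_group p X A)
       (kernel (cochain_group p X A) (cochain_group (Suc p) X A) (coboundary_map p X))"

definition coboundary_set ::
    "nat \<Rightarrow> 'a topology \<Rightarrow> 'b monoid \<Rightarrow> ('a chain \<Rightarrow> 'b) set" where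
  "coboundary_set p X A =
     (case p of 0 \<Rightarrow> {\<one>\<^bsub>cochain_group 0 X A\<^esub>}
              | Suc q \<Rightarrow> coboundary_map q X ` carrier (cochain_group q X A))"

definition cohomology_group ::
    "nat \<Rightarrow> 'a topology \<Rightarrow> 'b monoid \<Rightarrow> ('a chain \<Rightarrow> 'b) set monoid" where
  "cohomology_group p X A = cocycle_group p X A Mod coboundary_set p X A"


section \<open>The manifolds\<close>

text \<open>Matrix indices start at \<open>0\<close>, so the basis vector \<open>e\<^sub>j\<close> has index \<open>j - 1\<close>.\<close>

definition C_mat :: "nat \<Rightarrow> int mat" where
  "C_mat i = Matrix.mat (2 ^ i) (2 ^ i)
     (\<lambda>(a, b). if a = b + 1 then 1 else if a = 0 \<and> b + 1 = 2 ^ i then - 1 else 0)"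

primrec J_mat :: "nat \<Rightarrow> int mat" where
  "J_mat 0 = Matrix.mat 1 1 (\<lambda>_. - 1)"
| "J_mat (Suc i) = four_block_mat (0\<^sub>m (2 ^ i) (2 ^ i)) (J_mat i) (1\<^sub>m (2 ^ i)) (0\<^sub>m (2 ^ i) (2 ^ i))"

text \<open>Only the values \<open>k i\<close>, \<open>k' i\<close> for \<open>1 \<le> i < r\<close> matter below.\<close>

definition B_mat :: "nat \<Rightarrow> (nat \<Rightarrow> nat) \<Rightarrow> (nat \<Rightarrow> nat) \<Rightarrow> int mat" where
  "B_mat r k k' =
     diag_block_mat
       (concat (map (\<lambda>i. replicate (k i) (C_mat i) @ replicate (k' i) (J_mat i)) (rev [1..<r]))
        @ [1\<^sub>m 1])"

definition B_dim :: "nat \<Rightarrow> (nat \<Rightarrow> nat) \<Rightarrow> (nat \<Rightarrow> nat) \<Rightarrow> nat" where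
  "B_dim r k k' = (\<Sum>i = 1..<r. 2 ^ i * (k i + k' i)) + 1"

lemma J_mat_carrier: "J_mat i \<in> carrier_mat (2 ^ i) (2 ^ i)"
proof (induction i)
  case (Suc i)
  then show ?case
    using four_block_carrier_mat[of "0\<^sub>m (2 ^ i) (2 ^ i)" "2 ^ i" "2 ^ i" "0\<^sub>m (2 ^ i) (2 ^ i)" "2 ^ i" "2 ^ i"]
    by (simp add: mult_2)
qed simp

lemma B_mat_carrier: "B_mat r k k' \<in> carrier_mat (B_dim r k k') (B_dim r k k')"
proof -
  have C: "dim_row (C_mat i) = 2 ^ i" "dim_col (C_mat i) = 2 ^ i" for i
    by (simp_all add: C_mat_def)
  have J: "dim_row (J_mat i) = 2 ^ i" "dim_col (J_mat i) = 2 ^ i" for i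
    using J_mat_carrier[of i] by auto
  define Bs where "Bs = (\<lambda>i. replicate (k i) (C_mat i) @ replicate (k' i) (J_mat i))"
  have Bs: "sum_list (map dim_row (Bs i)) = 2 ^ i * (k i + k' i)"
    "sum_list (map dim_col (Bs i)) = 2 ^ i * (k i + k' i)" for i
    by (simp_all add: Bs_def C J sum_list_replicate algebra_simps)
  have "sum_list (map dim_row (concat (map Bs (rev is)))) = (\<Sum>i\<leftarrow>is. 2 ^ i * (k i + k' i))"
    "sum_list (map dim_col (concat (map Bs (rev is)))) = (\<Sum>i\<leftarrow>is. 2 ^ i * (k i + k' i))" for "is"
    by (induction "is") (simp_all add: Bs)
  then show ?thesis
    unfolding carrier_mat_def B_mat_def B_dim_def Bs_def
    by (simp add: dim_diag_block_mat sum_list_distinct_conv_sum_set interv_sum_list_conv_sum_set_nat)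
qed

text \<open>Euclidean \<open>n\<close>-space is \<open>Euclidean_space n\<close>: real sequences vanishing from index \<open>n\<close> on.\<close>

definition affine_gen :: "nat \<Rightarrow> (nat \<Rightarrow> nat) \<Rightarrow> (nat \<Rightarrow> nat) \<Rightarrow> (nat \<Rightarrow> real) \<Rightarrow> nat \<Rightarrow> real" where
  "affine_gen r k k' =
     (let n = B_dim r k k' in
      (\<lambda>x\<in>topspace (Euclidean_space n). \<lambda>i.
        if i < n
        then (map_mat real_of_int (B_mat r k k')
              *\<^sub>v (Matrix.vec n x + (1 / 2 ^ r) \<cdot>\<^sub>v unit_vec n (n - 1))) $ i
        else 0))"

definition translation :: "nat \<Rightarrow> (nat \<Rightarrow> int) \<Rightarrow> (nat \<Rightarrow> real) \<Rightarrow> nat \<Rightarrow> real" where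
  "translation n z =
     (\<lambda>x\<in>topspace (Euclidean_space n). \<lambda>i. if i < n then x i + real_of_int (z i) else 0)"

text \<open>\<open>subgroup_generated G S\<close> is generated by \<open>carrier G \<inter> S\<close>; here the generators are isometries,
  since \<open>B\<close> is a signed permutation matrix, so they all lie in \<open>carrier (BijGroup _)\<close>.\<close>

definition Gamma :: "nat \<Rightarrow> (nat \<Rightarrow> nat) \<Rightarrow> (nat \<Rightarrow> nat) \<Rightarrow> ((nat \<Rightarrow> real) \<Rightarrow> nat \<Rightarrow> real) monoid" where
  "Gamma r k k' =
     subgroup_generated (BijGroup (topspace (Euclidean_space (B_dim r k k'))))
       (insert (affine_gen r k k') (range (translation (B_dim r k k'))))"

definition M_space :: "nat \<Rightarrow> (nat \<Rightarrow> nat) \<Rightarrow> (nat \<Rightarrow> nat) \<Rightarrow> (nat \<Rightarrow> real) set topology" where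
  "M_space r k k' = orbit_space (Gamma r k k') (Euclidean_space (B_dim r k k'))"

end

theory Submission
  imports Defs "HOL-Analysis.Abstract_Metric_Spaces"
begin

text \<open>
  The group \<open>\<Gamma>\<close> acts isometrically (for the \<open>l\<^sub>1\<close> metric) on Euclidean space \<open>E\<close>, and every
  nontrivial element displaces every point by at least \<open>1 / 2\<^sup>r\<close>. Hence singular 1- and 2-simplices
  of the quotient \<open>M\<close> lift to \<open>E\<close>, uniquely up to \<open>\<Gamma>\<close>. A homomorphism from \<open>\<Gamma>\<close> onto an abelian
  group \<open>Q\<close> turns the endpoints of lifted 1-simplices into a \<open>Q\<close>-valued 1-cocycle on \<open>M\<close>; since \<open>E\<close> is
  acyclic, this cocycle induces an isomorphism from the first homology group of \<open>M\<close> to \<open>Q\<close> as soon as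
  every homomorphism from \<open>\<Gamma>\<close> to an abelian group kills the kernel. As 0-chains are free, evaluation
  on cycles identifies the first cohomology group with coefficients \<open>A\<close> with \<open>Hom(Q, A)\<close>.

  The abelianisation is computed from the translation part: \<open>B\<close> permutes the signed basis vectors
  of each block transitively, so in the abelianisation all of them become one element \<open>x\<close>
  with \<open>x = -x\<close>, while the last coordinate together with the generator of the cyclic holonomy
  group contributes an infinite cyclic factor.
\<close>

section \<open>Groups of homomorphisms\<close>

text \<open>The argument stays on chains; neither a fundamental group nor a Hurewicz map occurs. A
  lift of a cycle is in general not a cycle, so its class is compared in the group of all 1-chains
  modulo boundaries. That group is abelian, which is why homomorphisms from \<Gamma> to abelian
  groups are the ones to control. The condition on them ranges over groups of one type, that of the
  chain quotient, because types cannot be quantified inside a hypothesis.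

  The bound 1 / 2^r comes from the last coordinate, which B fixes: an element with linear part B^m
  shifts it by an amount congruent to m / 2^r modulo 1. A smaller shift is 0, which makes the linear
  part trivial and leaves an integral translation. The l1 metric suits this, being preserved by
  signed permutations and dominating every coordinate.

  The number of summands Z_2 is the number of blocks other than the last one; once transitivity and
  an order dividing 2^r are known, the blocks C and J are treated alike.\<close>

definition hom_group :: "('a, 'm) monoid_scheme \<Rightarrow> ('b, 'n) monoid_scheme \<Rightarrow> ('a \<Rightarrow> 'b) monoid" where
  "hom_group G A =
     \<lparr>carrier = hom G A \<inter> extensional (carrier G),
      monoid.mult = (\<lambda>f g. \<lambda>x\<in>carrier G. f x \<otimes>\<^bsub>A\<^esub> g x),
      one = (\<lambda>x\<in>carrier G. \<one>\<^bsub>A\<^esub>)\<rparr>"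

lemma hom_group_simps [simp]:
  "carrier (hom_group G A) = hom G A \<inter> extensional (carrier G)"
  "f \<otimes>\<^bsub>hom_group G A\<^esub> g = (\<lambda>x\<in>carrier G. f x \<otimes>\<^bsub>A\<^esub> g x)"
  "\<one>\<^bsub>hom_group G A\<^esub> = (\<lambda>x\<in>carrier G. \<one>\<^bsub>A\<^esub>)"
  by (simp_all add: hom_group_def)

lemma restrict_hom:
  assumes "group G" "f \<in> hom G A"
  shows "restrict f (carrier G) \<in> hom G A"
proof -
  interpret group G by (rule assms)
  show ?thesis
    using assms(2) by (auto simp: hom_def)
qed

lemma comm_group_hom_group:
  assumes G: "group G" and A: "comm_group A"
  shows "comm_group (hom_group G A)"
proof -
  interpret G: group G by (rule G)
  interpret A: comm_group A by (rule A)
  show ?thesis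
  proof (rule comm_groupI)
    fix f g assume fg: "f \<in> carrier (hom_group G A)" "g \<in> carrier (hom_group G A)"
    then have "(\<lambda>x. f x \<otimes>\<^bsub>A\<^esub> g x) \<in> hom G A"
      by (auto simp: hom_def A.m_ac Pi_iff)
    from restrict_hom[OF G this] show "f \<otimes>\<^bsub>hom_group G A\<^esub> g \<in> carrier (hom_group G A)"
      by simp
    show "f \<otimes>\<^bsub>hom_group G A\<^esub> g = g \<otimes>\<^bsub>hom_group G A\<^esub> f"
      using fg by (auto simp: hom_def Pi_iff A.m_comm intro!: restrict_ext)
  next
    have "(\<lambda>_. \<one>\<^bsub>A\<^esub>) \<in> hom G A"
      by (auto simp: hom_def)
    from restrict_hom[OF G this] show "\<one>\<^bsub>hom_group G A\<^esub> \<in> carrier (hom_group G A)"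
      by simp
  next
    fix f g h assume "f \<in> carrier (hom_group G A)" "g \<in> carrier (hom_group G A)" "h \<in> carrier (hom_group G A)"
    then show "f \<otimes>\<^bsub>hom_group G A\<^esub> g \<otimes>\<^bsub>hom_group G A\<^esub> h = f \<otimes>\<^bsub>hom_group G A\<^esub> (g \<otimes>\<^bsub>hom_group G A\<^esub> h)"
      by (auto simp: hom_def Pi_iff A.m_assoc intro!: restrict_ext)
  next
    fix f assume f: "f \<in> carrier (hom_group G A)"
    show "\<one>\<^bsub>hom_group G A\<^esub> \<otimes>\<^bsub>hom_group G A\<^esub> f = f"
      using f by (auto simp: hom_def Pi_iff extensional_def fun_eq_iff)
    have "(\<lambda>x. inv\<^bsub>A\<^esub> f x) \<in> hom G A"
      using f by (auto simp: hom_def Pi_iff A.inv_mult)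
    from restrict_hom[OF G this] have "(\<lambda>x\<in>carrier G. inv\<^bsub>A\<^esub> f x) \<in> carrier (hom_group G A)"
      by simp
    moreover have "(\<lambda>x\<in>carrier G. inv\<^bsub>A\<^esub> f x) \<otimes>\<^bsub>hom_group G A\<^esub> f = \<one>\<^bsub>hom_group G A\<^esub>"
      using f by (auto simp: hom_def Pi_iff intro!: restrict_ext)
    ultimately show "\<exists>g\<in>carrier (hom_group G A). g \<otimes>\<^bsub>hom_group G A\<^esub> f = \<one>\<^bsub>hom_group G A\<^esub>"
      by blast
  qed
qed

lemma additive_int:
  fixes f :: "int \<Rightarrow> int"
  assumes "\<And>x y. f (x + y) = f x + f y"
  shows "f n = n * f 1"
proof (induction n rule: int_induct[where k = 0])
  case base
  show ?case using assms[of 0 0] by simp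
next
  case (step1 i)
  then show ?case using assms[of i 1] by (simp add: algebra_simps)
next
  case (step2 i)
  then show ?case using assms[of "i - 1" 1] by (simp add: algebra_simps)
qed

section \<open>Homomorphisms from Z + Z_2^S to Z and to Z_2\<close>

abbreviation Z_Z2_pow :: "nat \<Rightarrow> (int \<times> (nat \<Rightarrow> int)) monoid" where
  "Z_Z2_pow S \<equiv> integer_group \<times>\<times> product_group {..<S} (\<lambda>_. integer_mod_group 2)"

lemma comm_group_Z_Z2_pow: "comm_group (Z_Z2_pow S)"
proof (rule group.group_comm_groupI)
  show "group (Z_Z2_pow S)"
    by (intro DirProd_group) auto
  show "x \<otimes>\<^bsub>Z_Z2_pow S\<^esub> y = y \<otimes>\<^bsub>Z_Z2_pow S\<^esub> x" for x y
    by (cases x; cases y) (simp add: add.commute)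
qed

lemma Z2_carrier: "carrier (integer_mod_group 2) = {0, 1}"
  by (auto simp: carrier_integer_mod_group)

text \<open>The target is torsion-free, so a homomorphism is determined by its value at the
  generator of the infinite factor, and that value is arbitrary.\<close>

lemma hom_group_Z_Z2_pow_Z: "hom_group (Z_Z2_pow S) integer_group \<cong> integer_group"
proof -
  let ?Q = "Z_Z2_pow S" and ?o = "\<lambda>i\<in>{..<S}. 0 :: int"
  interpret Q: comm_group ?Q by (rule comm_group_Z_Z2_pow)
  define ev where "ev = (\<lambda>\<psi> :: int \<times> (nat \<Rightarrow> int) \<Rightarrow> int. \<psi> (1, ?o))"
  have gH: "group (hom_group ?Q integer_group)"
    using comm_group_hom_group[OF Q.is_group abelian_integer_group] by (rule comm_group.axioms(2))
  have car: "(w, ?o) \<in> carrier ?Q" for w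
    by (auto simp: Z2_carrier)
  have "ev \<in> hom (hom_group ?Q integer_group) integer_group"
    using car by (intro homI) (auto simp: ev_def)
  then interpret ev: group_hom "hom_group ?Q integer_group" integer_group ev
    using gH by (simp add: group_hom_def group_hom_axioms_def)
  have inj: "\<psi> = \<one>\<^bsub>hom_group ?Q integer_group\<^esub>"
    if \<psi>: "\<psi> \<in> carrier (hom_group ?Q integer_group)" "ev \<psi> = 0" for \<psi>
  proof -
    have \<psi>h: "\<psi> \<in> hom ?Q integer_group" using \<psi>(1) by simp
    have add: "\<psi> (x \<otimes>\<^bsub>?Q\<^esub> y) = \<psi> x + \<psi> y" if "x \<in> carrier ?Q" "y \<in> carrier ?Q" for x y
      using hom_mult[OF \<psi>h that] by (simp only: mult_integer_group)
    have w: "\<psi> (w, ?o) = 0" for w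
    proof -
      have "\<psi> (x + y, ?o) = \<psi> (x, ?o) + \<psi> (y, ?o)" for x y
        using add[OF car car, of x y] by (simp add: restrict_def cong: if_cong)
      from additive_int[of "\<lambda>w. \<psi> (w, ?o)", OF this, of w] show ?thesis
        using \<psi>(2) by (simp add: ev_def)
    qed
    have "\<psi> x = 0" if x: "x \<in> carrier ?Q" for x
    proof -
      \<comment> \<open>Doubling kills the second component, so \<open>2 * \<psi> x\<close> is a
        value on the infinite factor, where \<open>\<psi>\<close> is already known to
        vanish.\<close>
      have "x \<otimes>\<^bsub>?Q\<^esub> x = (2 * fst x, ?o)"
        using x by (cases x) (auto simp: DirProd_def fun_eq_iff)
      then have "2 * \<psi> x = 0"
        using add[OF x x] w by simp
      then show ?thesis by simp
    qed
    then show ?thesis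
      using \<psi>(1) by (auto simp: extensional_def fun_eq_iff)
  qed
  have surj: "\<exists>\<psi>\<in>carrier (hom_group ?Q integer_group). ev \<psi> = a" for a
  proof -
    have "(\<lambda>x. fst x * a) \<in> hom ?Q integer_group"
    proof (rule homI)
      show "fst (x \<otimes>\<^bsub>?Q\<^esub> y) * a = (fst x * a) \<otimes>\<^bsub>integer_group\<^esub> (fst y * a)" for x y
        by (cases x; cases y) (simp add: distrib_right)
    qed simp
    from restrict_hom[OF Q.is_group this]
    have "restrict (\<lambda>x. fst x * a) (carrier ?Q) \<in> carrier (hom_group ?Q integer_group)"
      by simp
    moreover have "ev (restrict (\<lambda>x. fst x * a) (carrier ?Q)) = a"
      unfolding ev_def restrict_apply'[OF car] by simp
    ultimately show ?thesis by blast
  qed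
  have "carrier integer_group \<subseteq> ev ` carrier (hom_group ?Q integer_group)"
  proof
    fix a :: int assume "a \<in> carrier integer_group"
    then obtain \<psi> where "\<psi> \<in> carrier (hom_group ?Q integer_group)" "a = ev \<psi>"
      using surj by metis
    then show "a \<in> ev ` carrier (hom_group ?Q integer_group)"
      by (simp only: imageI)
  qed
  then have "ev \<in> iso (hom_group ?Q integer_group) integer_group"
    unfolding ev.iso_iff using inj by (simp only: one_integer_group) blast
  then show ?thesis by (rule is_isoI)
qed

text \<open>The target has exponent 2, so the values at the \<open>S + 1\<close> generators can be
  prescribed independently; position \<open>S\<close> holds the value at the infinite
  generator.\<close>

lemma hom_group_Z_Z2_pow_Z2:
  "hom_group (Z_Z2_pow S) (integer_mod_group 2) \<cong> product_group {..<S + 1} (\<lambda>_. integer_mod_group 2)"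
proof -
  let ?Q = "Z_Z2_pow S" and ?A = "integer_mod_group 2"
  let ?P = "product_group {..<S + 1} (\<lambda>_. integer_mod_group 2)"
  interpret Q: comm_group ?Q by (rule comm_group_Z_Z2_pow)
  \<comment> \<open>No \<open>j < S\<close> equals \<open>S\<close>, so \<open>\<delta> S\<close> is
    the zero tuple and one formula covers the unit vectors and zero.\<close>
  define \<delta> :: "nat \<Rightarrow> nat \<Rightarrow> int" where "\<delta> = (\<lambda>i. \<lambda>j\<in>{..<S}. if j = i then 1 else 0)"
  define ev where "ev = (\<lambda>\<psi> :: int \<times> (nat \<Rightarrow> int) \<Rightarrow> int.
    \<lambda>i\<in>{..<S + 1}. if i < S then \<psi> (0, \<delta> i) else \<psi> (1, \<delta> S))"
  have gH: "group (hom_group ?Q ?A)"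
    using comm_group_hom_group[OF Q.is_group abelian_integer_mod_group] by (rule comm_group.axioms(2))
  have gP: "group ?P" by simp
  have car: "(w, \<delta> i) \<in> carrier ?Q" for w i
    by (auto simp: Z2_carrier \<delta>_def)
  have "ev \<in> hom (hom_group ?Q ?A) ?P"
  proof (rule homI)
    show "ev \<psi> \<in> carrier ?P" if "\<psi> \<in> carrier (hom_group ?Q ?A)" for \<psi>
      using that car by (auto simp: ev_def hom_def Pi_iff)
    show "ev (\<psi> \<otimes>\<^bsub>hom_group ?Q ?A\<^esub> \<theta>) = ev \<psi> \<otimes>\<^bsub>?P\<^esub> ev \<theta>" for \<psi> \<theta>
      using car by (auto simp: ev_def fun_eq_iff)
  qed
  then interpret ev: group_hom "hom_group ?Q ?A" ?P ev
    using gH gP by (simp only: group_hom_def group_hom_axioms_def)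
  have inj: "\<psi> = \<one>\<^bsub>hom_group ?Q ?A\<^esub>"
    if \<psi>: "\<psi> \<in> carrier (hom_group ?Q ?A)" "ev \<psi> = \<one>\<^bsub>?P\<^esub>" for \<psi>
  proof -
    have \<psi>h: "\<psi> \<in> hom ?Q ?A" using \<psi>(1) by simp
    have add: "\<psi> (x \<otimes>\<^bsub>?Q\<^esub> y) = (\<psi> x + \<psi> y) mod 2" if "x \<in> carrier ?Q" "y \<in> carrier ?Q" for x y
      using hom_mult[OF \<psi>h that] by (simp only: mult_integer_mod_group of_nat_numeral)
    have c: "\<psi> x \<in> {0, 1}" if "x \<in> carrier ?Q" for x
      using hom_in_carrier[OF \<psi>h that] unfolding Z2_carrier .
    have ev0: "\<psi> (1, \<delta> S) = 0"
      using fun_cong[OF \<psi>(2), of S] by (simp add: ev_def)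
    have ev1: "\<psi> (0, \<delta> i) = 0" if "i < S" for i
      using fun_cong[OF \<psi>(2), of i] that by (simp add: ev_def)
    have \<delta>S: "\<delta> S = (\<lambda>i\<in>{..<S}. 0)"
      by (auto simp: \<delta>_def fun_eq_iff)
    have aw: "\<psi> (x + y, \<delta> S) = (\<psi> (x, \<delta> S) + \<psi> (y, \<delta> S)) mod 2" for x y
      using add[OF car car, of x S y S] by (simp add: \<delta>S cong: restrict_cong)
    have w: "\<psi> (w, \<delta> S) = 0" for w
    proof (induction w rule: int_induct[where k = 0])
      case base
      show ?case using aw[of 0 0] c[OF car[of 0 S]] by auto
    next
      case (step1 i)
      then show ?case using aw[of i 1] ev0 by simp
    next
      case (step2 i)
      then show ?case using aw[of "i - 1" 1] ev0 c[OF car[of "i - 1" S]] by auto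
    qed
    \<comment> \<open>Induction on the number \<open>k\<close> of leading entries that may be
      nonzero; in each step the last of them is split off as a unit vector.\<close>
    have b: "\<psi> (0, \<beta>) = 0" if "k \<le> S" "\<beta> \<in> (\<Pi>\<^sub>E i\<in>{..<S}. {0, 1})" "\<And>i. \<lbrakk>k \<le> i; i < S\<rbrakk> \<Longrightarrow> \<beta> i = 0" for k \<beta>
      using that
    proof (induction k arbitrary: \<beta>)
      case 0
      then have "\<beta> = \<delta> S"
        by (auto simp: \<delta>S fun_eq_iff PiE_iff extensional_def)
      then show ?case using w by simp
    next
      case (Suc k)
      show ?case
      proof (cases "\<beta> k = 0")
        case True
        then show ?thesis
          using Suc.prems by (intro Suc.IH) (auto, metis Suc_leI le_neq_implies_less)
      next
        case False
        then have bk: "\<beta> k = 1"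
          using Suc.prems by (auto simp: PiE_iff)
        let ?\<beta> = "\<beta>(k := 0)"
        have \<beta>': "?\<beta> \<in> (\<Pi>\<^sub>E i\<in>{..<S}. {0, 1})"
          using Suc.prems by (auto simp: PiE_iff extensional_def)
        have 0: "\<psi> (0, ?\<beta>) = 0"
          using Suc.prems \<beta>' by (intro Suc.IH) auto
        have bm: "\<beta> j mod 2 = \<beta> j" if "j < S" for j
          using PiE_mem[OF Suc.prems(2), of j] that by auto
        have "(0, \<beta>) = (0, ?\<beta>) \<otimes>\<^bsub>?Q\<^esub> (0, \<delta> k)"
          using Suc.prems bk by (auto simp: \<delta>_def fun_eq_iff PiE_iff extensional_def bm)
        then have "\<psi> (0, \<beta>) = (\<psi> (0, ?\<beta>) + \<psi> (0, \<delta> k)) mod 2"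
          using add[of "(0, ?\<beta>)" "(0, \<delta> k)"] \<beta>' car by (simp add: Z2_carrier)
        then show ?thesis using 0 ev1[of k] Suc.prems by simp
      qed
    qed
    have "\<psi> x = 0" if x: "x \<in> carrier ?Q" for x
    proof -
      obtain u \<beta> where x': "x = (u, \<beta>)" "\<beta> \<in> (\<Pi>\<^sub>E i\<in>{..<S}. {0, 1})"
        using x by (cases x) (auto simp: Z2_carrier)
      have "\<beta> j mod 2 = \<beta> j" if "j < S" for j
        using PiE_mem[OF x'(2), of j] that by auto
      then have "x = (u, \<delta> S) \<otimes>\<^bsub>?Q\<^esub> (0, \<beta>)"
        using x'(2) by (auto simp: x'(1) \<delta>S fun_eq_iff PiE_iff extensional_def)
      moreover have "(0, \<beta>) \<in> carrier ?Q"
        using x' by (simp add: Z2_carrier)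
      then have "\<psi> ((u, \<delta> S) \<otimes>\<^bsub>?Q\<^esub> (0, \<beta>)) = (\<psi> (u, \<delta> S) + \<psi> (0, \<beta>)) mod 2"
        by (rule add[OF car])
      ultimately have "\<psi> x = (\<psi> (u, \<delta> S) + \<psi> (0, \<beta>)) mod 2"
        by (simp only:)
      then show ?thesis
        using w b[of S \<beta>] x'(2) by simp
    qed
    then show ?thesis
      using \<psi>(1) by (auto simp: extensional_def fun_eq_iff)
  qed
  have surj: "\<exists>\<psi>\<in>carrier (hom_group ?Q ?A). ev \<psi> = a" if a: "a \<in> carrier ?P" for a
  proof -
    \<comment> \<open>The linear form with coefficients \<open>a\<close>. Addition in the source
      reduces entries modulo 2, so the form is additive only after its value is reduced as
      well.\<close>
    define f :: "int \<times> (nat \<Rightarrow> int) \<Rightarrow> int" where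
      "f = (\<lambda>x. (fst x * a S + (\<Sum>i<S. snd x i * a i)) mod 2)"
    have "f \<in> hom ?Q ?A"
    proof (rule homI)
      fix x y assume "x \<in> carrier ?Q" "y \<in> carrier ?Q"
      show "f x \<in> carrier ?A"
        by (simp add: f_def carrier_integer_mod_group)
      have "(\<Sum>i<S. ((snd x i + snd y i) mod 2) * a i) mod 2 =
            (\<Sum>i<S. (((snd x i + snd y i) mod 2) * a i) mod 2) mod 2"
        by (rule mod_sum_eq[symmetric])
      also have "\<dots> = (\<Sum>i<S. ((snd x i + snd y i) * a i) mod 2) mod 2"
        by (simp only: mod_mult_left_eq)
      also have "\<dots> = (\<Sum>i<S. (snd x i + snd y i) * a i) mod 2"
        by (rule mod_sum_eq)
      finally have s: "(\<Sum>i<S. ((snd x i + snd y i) mod 2) * a i) mod 2 = \<dots>" .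
      have "f (x \<otimes>\<^bsub>?Q\<^esub> y) =
            ((fst x + fst y) * a S + (\<Sum>i<S. ((snd x i + snd y i) mod 2) * a i)) mod 2"
        by (cases x; cases y) (simp add: f_def)
      also have "\<dots> = ((fst x + fst y) * a S + (\<Sum>i<S. (snd x i + snd y i) * a i)) mod 2"
        by (rule mod_add_cong[OF refl s])
      also have "\<dots> = ((fst x * a S + (\<Sum>i<S. snd x i * a i)) + (fst y * a S + (\<Sum>i<S. snd y i * a i))) mod 2"
        by (simp only: distrib_right sum.distrib add_ac)
      also have "\<dots> = f x \<otimes>\<^bsub>?A\<^esub> f y"
        by (simp only: f_def mult_integer_mod_group of_nat_numeral mod_add_eq)
      finally show "f (x \<otimes>\<^bsub>?Q\<^esub> y) = f x \<otimes>\<^bsub>?A\<^esub> f y" .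
    qed
    from restrict_hom[OF Q.is_group this] have "restrict f (carrier ?Q) \<in> carrier (hom_group ?Q ?A)"
      by simp
    moreover have "ev (restrict f (carrier ?Q)) = a"
    proof (rule extensionalityI[of _ "{..<S + 1}"])
      fix i assume i: "i \<in> {..<S + 1}"
      have ai: "a j mod 2 = a j" if "j < S + 1" for j
        using a that by (auto simp: carrier_integer_mod_group PiE_iff)
      have "(\<Sum>j<S. \<delta> i j * a j) = (if i < S then a i else 0)"
        by (simp add: \<delta>_def if_distrib[of "\<lambda>x. x * _"] cong: if_cong)
      then show "ev (restrict f (carrier ?Q)) i = a i"
        using i ai[of i] ai[of S] car[of 0 i] car[of 1 S]
        by (auto simp: ev_def f_def less_Suc_eq \<delta>_def)
    next
      show "ev (restrict f (carrier ?Q)) \<in> extensional {..<S + 1}"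
        by (simp add: ev_def)
      show "a \<in> extensional {..<S + 1}"
        using a by (simp add: PiE_def)
    qed
    ultimately show ?thesis by blast
  qed
  have "carrier ?P \<subseteq> ev ` carrier (hom_group ?Q ?A)"
  proof
    fix a assume "a \<in> carrier ?P"
    then obtain \<psi> where "\<psi> \<in> carrier (hom_group ?Q ?A)" "a = ev \<psi>"
      using surj by metis
    then show "a \<in> ev ` carrier (hom_group ?Q ?A)"
      by (simp only: imageI)
  qed
  then have "ev \<in> iso (hom_group ?Q ?A) ?P"
    unfolding ev.iso_iff using inj by blast
  then show ?thesis by (rule is_isoI)
qed

section \<open>Lifting singular simplices through a uniformly free action\<close>

definition l1_dist :: "nat \<Rightarrow> (nat \<Rightarrow> real) \<Rightarrow> (nat \<Rightarrow> real) \<Rightarrow> real" where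
  "l1_dist n x y = (\<Sum>i<n. \<bar>x i - y i\<bar>)"

interpretation l1: Metric_space "topspace (Euclidean_space n)" "l1_dist n" for n
proof
  fix x y z :: "nat \<Rightarrow> real"
  show "0 \<le> l1_dist n x y"
    by (simp add: l1_dist_def sum_nonneg)
  show "l1_dist n x y = l1_dist n y x"
    by (simp add: l1_dist_def abs_minus_commute)
  show "l1_dist n x y = 0 \<longleftrightarrow> x = y"
    if "x \<in> topspace (Euclidean_space n)" "y \<in> topspace (Euclidean_space n)"
  proof -
    have "l1_dist n x y = 0 \<longleftrightarrow> (\<forall>i<n. x i = y i)"
      by (auto simp: l1_dist_def sum_nonneg_eq_0_iff)
    then show ?thesis
      using that by (auto simp: topspace_Euclidean_space fun_eq_iff) (metis not_le)
  qed
  show "l1_dist n x z \<le> l1_dist n x y + l1_dist n y z"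
    unfolding l1_dist_def sum.distrib[symmetric] by (intro sum_mono) linarith
qed

lemma coordinate_le_l1_dist: "i < n \<Longrightarrow> \<bar>x i - y i\<bar> \<le> l1_dist n x y"
  unfolding l1_dist_def by (rule member_le_sum) auto

lemma continuous_map_coordinate:
  "continuous_map (Euclidean_space n) euclideanreal (\<lambda>x. x i)"
  unfolding Euclidean_space_def
  by (intro continuous_map_from_subtopology continuous_map_product_projection) auto

lemma continuous_map_into_Euclidean_space:
  "continuous_map X (Euclidean_space n) f \<longleftrightarrow>
     (\<forall>i. continuous_map X euclideanreal (\<lambda>x. f x i)) \<and> f \<in> topspace X \<rightarrow> topspace (Euclidean_space n)"
  unfolding topspace_Euclidean_space unfolding Euclidean_space_def continuous_map_in_subtopology
  by (simp add: continuous_map_componentwise_UNIV)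

text \<open>The distance is a finite sum of continuous functions, so balls are open in the product
  topology; conversely every coordinate is 1-Lipschitz, so the identity is continuous into the
  product.\<close>

lemma mtopology_l1: "l1.mtopology n = Euclidean_space n"
proof (rule topology_eq[THEN iffD2], intro allI iffI)
  fix U
  assume U: "openin (l1.mtopology n) U"
  show "openin (Euclidean_space n) U"
  proof (subst openin_subopen, intro ballI)
    fix x assume "x \<in> U"
    then obtain r where r: "r > 0" "l1.mball n x r \<subseteq> U"
      using U unfolding l1.openin_mtopology by blast
    have x: "x \<in> topspace (Euclidean_space n)"
      using U \<open>x \<in> U\<close> unfolding l1.openin_mtopology by blast
    have "continuous_map (Euclidean_space n) euclideanreal (\<lambda>y. l1_dist n x y)"
      unfolding l1_dist_def by (intro continuous_intros continuous_map_coordinate) auto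
    then have "openin (Euclidean_space n) {y \<in> topspace (Euclidean_space n). l1_dist n x y \<in> {..<r}}"
      by (rule openin_continuous_map_preimage) simp
    moreover have "{y \<in> topspace (Euclidean_space n). l1_dist n x y \<in> {..<r}} = l1.mball n x r"
      using x by (auto simp: l1.in_mball)
    ultimately show "\<exists>T. openin (Euclidean_space n) T \<and> x \<in> T \<and> T \<subseteq> U"
      using r x by (metis l1.centre_in_mball_iff)
  qed
next
  fix U
  assume U: "openin (Euclidean_space n) U"
  have "continuous_map (l1.mtopology n) euclideanreal (\<lambda>x. x i)" for i
  proof (cases "i < n")
    case True
    show ?thesis
      unfolding continuous_map_def
    proof (intro conjI allI impI)
      fix V :: "real set" assume V: "openin euclideanreal V"
      show "openin (l1.mtopology n) {x \<in> topspace (l1.mtopology n). x i \<in> V}"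
        unfolding l1.openin_mtopology
      proof (intro conjI allI impI)
        fix x assume x: "x \<in> {x \<in> topspace (l1.mtopology n). x i \<in> V}"
        then obtain e where e: "e > 0" "\<And>y. \<bar>y - x i\<bar> < e \<Longrightarrow> y \<in> V"
          using V unfolding open_openin[symmetric] open_dist dist_real_def by blast
        have "l1.mball n x e \<subseteq> {x \<in> topspace (l1.mtopology n). x i \<in> V}"
        proof
          fix y assume "y \<in> l1.mball n x e"
          then have y: "y \<in> topspace (Euclidean_space n)" "l1_dist n x y < e"
            by (auto simp only: l1.in_mball)
          have "\<bar>y i - x i\<bar> < e"
            using coordinate_le_l1_dist[OF True, of x y] y(2) by linarith
          then show "y \<in> {x \<in> topspace (l1.mtopology n). x i \<in> V}"
            using e(2) y(1) by (simp only: l1.topspace_mtopology mem_Collect_eq)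
        qed
        with e(1) show "\<exists>r>0. l1.mball n x r \<subseteq> {x \<in> topspace (l1.mtopology n). x i \<in> V}"
          by blast
      qed auto
    qed auto
  next
    case False
    have "continuous_map (l1.mtopology n) euclideanreal (\<lambda>x. 0)" by simp
    then show ?thesis
      by (rule continuous_map_eq) (use False in \<open>simp add: topspace_Euclidean_space[symmetric] l1.topspace_mtopology, simp add: topspace_Euclidean_space\<close>)
  qed
  then have "continuous_map (l1.mtopology n) (Euclidean_space n) (\<lambda>x. x)"
    unfolding continuous_map_into_Euclidean_space l1.topspace_mtopology by blast
  then have "openin (l1.mtopology n) {x \<in> topspace (l1.mtopology n). x \<in> U}"
    using U openin_continuous_map_preimage by blast
  moreover have "{x \<in> topspace (l1.mtopology n). x \<in> U} = U"
    using openin_subset[OF U] by auto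
  ultimately show "openin (l1.mtopology n) U"
    by simp
qed

text \<open>A metric form of a free and properly discontinuous action. One bound
  \<open>\<eta>\<close> serves all points and replaces evenly covered neighbourhoods: an orbit has
  no second point within distance less than \<open>\<eta>\<close>.\<close>

locale uniformly_free_action = Metric_space M d
  for M :: "'a set" and d +
  fixes G :: "('a \<Rightarrow> 'a) monoid" (structure) and \<eta> :: real
  assumes action: "group_action G M (\<lambda>\<gamma>. \<gamma>)"
    and isometric: "\<lbrakk>\<gamma> \<in> carrier G; x \<in> M; y \<in> M\<rbrakk> \<Longrightarrow> d (\<gamma> x) (\<gamma> y) = d x y"
    and eta_pos: "\<eta> > 0"
    and displacement: "\<lbrakk>\<gamma> \<in> carrier G; x \<in> M; d x (\<gamma> x) < \<eta>\<rbrakk> \<Longrightarrow> \<gamma> = \<one>"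
begin

sublocale group_action G M "\<lambda>\<gamma>. \<gamma>"
  by (rule action)

sublocale group G
  using group_hom group_hom.axioms(1) by auto

section \<open>Orbits and the projection onto the orbit space\<close>

abbreviation proj :: "'a \<Rightarrow> 'a set" where
  "proj \<equiv> orbit G (\<lambda>\<gamma>. \<gamma>)"

abbreviation quot :: "'a set topology" where
  "quot \<equiv> orbit_space G mtopology"

lemma act_closed: "\<lbrakk>\<gamma> \<in> carrier G; x \<in> M\<rbrakk> \<Longrightarrow> \<gamma> x \<in> M"
  using element_image by blast

lemma act_mult: "\<lbrakk>\<gamma> \<in> carrier G; \<delta> \<in> carrier G; x \<in> M\<rbrakk> \<Longrightarrow> (\<gamma> \<otimes> \<delta>) x = \<gamma> (\<delta> x)"
  using composition_rule by blast

lemma act_one: "x \<in> M \<Longrightarrow> \<one> x = x"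
  using id_eq_one by (metis restrict_apply')

lemma act_inv: "\<lbrakk>\<gamma> \<in> carrier G; x \<in> M\<rbrakk> \<Longrightarrow> (inv \<gamma>) (\<gamma> x) = x"
  using orbit_sym_aux by blast

lemma act_cancel:
  "\<lbrakk>\<gamma> \<in> carrier G; \<delta> \<in> carrier G; x \<in> M; \<gamma> x = \<delta> x\<rbrakk> \<Longrightarrow> \<gamma> = \<delta>"
proof -
  assume a: "\<gamma> \<in> carrier G" "\<delta> \<in> carrier G" "x \<in> M" "\<gamma> x = \<delta> x"
  then have "(inv \<delta> \<otimes> \<gamma>) x = x"
    by (simp add: act_mult act_inv)
  then have "inv \<delta> \<otimes> \<gamma> = \<one>"
    using a eta_pos by (intro displacement[of _ x]) auto
  then show "\<gamma> = \<delta>"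
    using a by (metis inv_closed inv_equality inv_inv)
qed

lemma proj_eq_iff: "\<lbrakk>x \<in> M; y \<in> M\<rbrakk> \<Longrightarrow> proj x = proj y \<longleftrightarrow> (\<exists>\<gamma>\<in>carrier G. y = \<gamma> x)"
proof
  assume a: "x \<in> M" "y \<in> M" "proj x = proj y"
  have "y \<in> proj y"
    unfolding orbit_def using act_one[OF a(2)] by (force intro: exI[of _ "\<one>"])
  then show "\<exists>\<gamma>\<in>carrier G. y = \<gamma> x"
    using a(3) unfolding orbit_def by blast
next
  assume a: "x \<in> M" "y \<in> M" "\<exists>\<gamma>\<in>carrier G. y = \<gamma> x"
  then obtain \<gamma> where g: "\<gamma> \<in> carrier G" "y = \<gamma> x" by blast
  have "\<delta> x \<in> proj y" if "\<delta> \<in> carrier G" for \<delta>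
  proof -
    have "\<delta> x = (\<delta> \<otimes> inv \<gamma>) y"
      using that g a by (simp add: act_mult act_inv act_closed)
    then show ?thesis
      unfolding orbit_def using that g(1) by blast
  qed
  moreover have "\<delta> y \<in> proj x" if "\<delta> \<in> carrier G" for \<delta>
    unfolding orbit_def using that g a
    by (auto intro!: exI[of _ "\<delta> \<otimes> \<gamma>"] simp: act_mult)
  ultimately show "proj x = proj y"
    unfolding orbit_def by auto
qed

lemma proj_act: "\<lbrakk>\<gamma> \<in> carrier G; x \<in> M\<rbrakk> \<Longrightarrow> proj (\<gamma> x) = proj x"
  using proj_eq_iff act_closed by metis

lemma topspace_quot: "topspace quot = proj ` M"
  by (simp add: orbit_space_def)

lemma continuous_map_proj: "continuous_map mtopology quot proj"
  unfolding orbit_space_def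
  by (rule quotient_imp_continuous_map[OF quotient_map_quotient_topology])

lemma continuous_map_act: "\<gamma> \<in> carrier G \<Longrightarrow> continuous_map mtopology mtopology \<gamma>"
  unfolding continuous_map_def
proof (intro conjI allI impI)
  assume g: "\<gamma> \<in> carrier G"
  show "\<gamma> \<in> topspace mtopology \<rightarrow> topspace mtopology"
    using g act_closed by auto
  fix U assume U: "openin mtopology U"
  show "openin mtopology {x \<in> topspace mtopology. \<gamma> x \<in> U}"
    unfolding openin_mtopology
  proof (intro conjI allI impI)
    fix x assume x: "x \<in> {x \<in> topspace mtopology. \<gamma> x \<in> U}"
    then obtain r where r: "r > 0" "mball (\<gamma> x) r \<subseteq> U"
      using U unfolding openin_mtopology by auto
    have "mball x r \<subseteq> {x \<in> topspace mtopology. \<gamma> x \<in> U}"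
      using r x g by (auto simp: isometric act_closed subset_iff)
    then show "\<exists>r>0. mball x r \<subseteq> {x \<in> topspace mtopology. \<gamma> x \<in> U}"
      using r by blast
  qed auto
qed

text \<open>The saturation of an open set is the union of its preimages under the group elements,
  which act continuously.\<close>

lemma open_map_proj: "openin mtopology U \<Longrightarrow> openin quot (proj ` U)"
proof -
  assume U: "openin mtopology U"
  have UM: "U \<subseteq> M" using openin_subset[OF U] by simp
  have "{x \<in> M. proj x \<in> proj ` U} = (\<Union>\<gamma>\<in>carrier G. {x \<in> topspace mtopology. \<gamma> x \<in> U})"
  proof (intro subset_antisym subsetI)
    fix x assume "x \<in> {x \<in> M. proj x \<in> proj ` U}"
    then obtain u where "x \<in> M" "u \<in> U" "proj x = proj u" by auto
    then show "x \<in> (\<Union>\<gamma>\<in>carrier G. {x \<in> topspace mtopology. \<gamma> x \<in> U})"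
      using proj_eq_iff[of x u] UM by auto
  next
    fix x assume "x \<in> (\<Union>\<gamma>\<in>carrier G. {x \<in> topspace mtopology. \<gamma> x \<in> U})"
    then obtain \<gamma> where "\<gamma> \<in> carrier G" "x \<in> M" "\<gamma> x \<in> U" by auto
    then show "x \<in> {x \<in> M. proj x \<in> proj ` U}"
      using proj_act[of \<gamma> x] by (metis (mono_tags, lifting) imageI mem_Collect_eq)
  qed
  moreover have "openin mtopology (\<Union>\<gamma>\<in>carrier G. {x \<in> topspace mtopology. \<gamma> x \<in> U})"
    using openin_continuous_map_preimage[OF continuous_map_act U] by (intro openin_Union) blast
  ultimately show ?thesis
    unfolding orbit_space_def openin_quotient_topology using UM by auto
qed

text \<open>Both the continuity and the uniqueness of lifts rest on this form of the displacement
  bound.\<close>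

lemma close_eq: "\<lbrakk>x \<in> M; y \<in> M; proj x = proj y; d x y < \<eta>\<rbrakk> \<Longrightarrow> x = y"
  using proj_eq_iff displacement act_one by metis

text \<open>Uniform continuity of a map into the orbit space, phrased upstairs.\<close>

lemma uniform_lift:
  assumes D: "Metric_space D e" "compact_space (Metric_space.mtopology D e)"
    and f: "continuous_map (Metric_space.mtopology D e) quot f" and \<epsilon>: "\<epsilon> > 0"
  obtains \<delta> where "\<delta> > 0"
    "\<And>s t x. \<lbrakk>s \<in> D; t \<in> D; e s t < \<delta>; x \<in> M; proj x = f s\<rbrakk>
       \<Longrightarrow> \<exists>y\<in>M. proj y = f t \<and> d x y < \<epsilon>"
proof -
  interpret D: Metric_space D e by (rule D)
  \<comment> \<open>Radius \<open>\<epsilon>/2\<close>, so that two points of one ball are less than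
    \<open>\<epsilon>\<close> apart.\<close>
  define \<C> where "\<C> = (\<lambda>m. {s \<in> D. f s \<in> proj ` mball m (\<epsilon>/2)}) ` M"
  have op: "openin D.mtopology U" if "U \<in> \<C>" for U
    using that openin_continuous_map_preimage[OF f open_map_proj] by (auto simp: \<C>_def)
  have cov: "D \<subseteq> \<Union>\<C>"
  proof
    fix s assume s: "s \<in> D"
    then have "f s \<in> topspace quot"
      using f by (auto simp: continuous_map_def)
    then obtain m where "m \<in> M" "f s = proj m"
      unfolding topspace_quot by blast
    then show "s \<in> \<Union>\<C>"
      using s \<epsilon> by (auto simp: \<C>_def intro!: bexI[of _ m])
  qed
  have "compactin D.mtopology D"
    using D(2) by (simp add: compact_space_def)
  from D.lebesgue_number[OF this cov op] obtain \<delta> where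
    d: "\<delta> > 0" "\<And>s. s \<in> D \<Longrightarrow> \<exists>U\<in>\<C>. D.mball s \<delta> \<subseteq> U"
    by blast
  show thesis
  proof (rule that[OF d(1)])
    fix s t x assume st: "s \<in> D" "t \<in> D" "e s t < \<delta>" "x \<in> M" "proj x = f s"
    obtain m where m: "m \<in> M" "D.mball s \<delta> \<subseteq> {s \<in> D. f s \<in> proj ` mball m (\<epsilon>/2)}"
      using d(2)[OF st(1)] by (auto simp: \<C>_def)
    have "s \<in> D.mball s \<delta>" "t \<in> D.mball s \<delta>"
      using st d(1) by auto
    then have "f s \<in> proj ` mball m (\<epsilon>/2)" "f t \<in> proj ` mball m (\<epsilon>/2)"
      using m(2) by blast+
    then obtain a b where ab: "a \<in> M" "d m a < \<epsilon>/2" "f s = proj a" "b \<in> M" "d m b < \<epsilon>/2" "f t = proj b"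
      by (auto simp only: image_iff in_mball)
    \<comment> \<open>The ball that contains \<open>a\<close> and \<open>b\<close> need not contain
      \<open>x\<close>; the isometry carrying \<open>a\<close> to \<open>x\<close> moves
      \<open>b\<close> along.\<close>
    obtain \<gamma> where g: "\<gamma> \<in> carrier G" "x = \<gamma> a"
      using proj_eq_iff[of a x] st ab by auto
    have "d x (\<gamma> b) = d a b"
      using g ab isometric by simp
    also have "\<dots> \<le> d a m + d m b"
      using ab m triangle by blast
    also have "\<dots> < \<epsilon>"
      using ab m commute[of a m] by simp
    finally show "\<exists>y\<in>M. proj y = f t \<and> d x y < \<epsilon>"
      using g ab proj_act act_closed by metis
  qed
qed

text \<open>The lift is built along the rays \<open>t \<mapsto> H t s\<close> in steps so short that the next value is the
  only lift within a quarter of the minimal displacement.\<close>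

lemma lift_exists:
  fixes H :: "real \<Rightarrow> 'b \<Rightarrow> 'b"
  assumes D: "Metric_space D e" "compact_space (Metric_space.mtopology D e)"
    and f: "continuous_map (Metric_space.mtopology D e) quot f"
    and H: "\<And>t s. \<lbrakk>0 \<le> t; t \<le> 1; s \<in> D\<rbrakk> \<Longrightarrow> H t s \<in> D"
    and H0: "\<And>s. s \<in> D \<Longrightarrow> H 0 s = s0" and H1: "\<And>s. s \<in> D \<Longrightarrow> H 1 s = s" and s0: "s0 \<in> D"
    and Hd: "\<And>t s s'. \<lbrakk>0 \<le> t; t \<le> 1; s \<in> D; s' \<in> D\<rbrakk> \<Longrightarrow> e (H t s) (H t s') \<le> e s s'"
    and Ht: "\<And>t t' s. \<lbrakk>0 \<le> t; t \<le> 1; 0 \<le> t'; t' \<le> 1; s \<in> D\<rbrakk> \<Longrightarrow> e (H t s) (H t' s) \<le> C * \<bar>t - t'\<bar>"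
  obtains g where "continuous_map (Metric_space.mtopology D e) mtopology g"
    "\<And>s. s \<in> D \<Longrightarrow> proj (g s) = f s"
proof -
  interpret D: Metric_space D e by (rule D)
  have "\<eta>/4 > 0" using eta_pos by simp
  from uniform_lift[OF D f this] obtain \<delta> where d: "\<delta> > 0"
    "\<And>s t x. \<lbrakk>s \<in> D; t \<in> D; e s t < \<delta>; x \<in> M; proj x = f s\<rbrakk>
       \<Longrightarrow> \<exists>y\<in>M. proj y = f t \<and> d x y < \<eta>/4" by blast
  \<comment> \<open>A step of time \<open>1 / N\<close> moves a point of \<open>D\<close> by at most
    \<open>C / N\<close>, hence by less than \<open>\<delta>\<close>.\<close>
  obtain N :: nat where N: "N > 0" "\<bar>C\<bar> / \<delta> < real N"
    using reals_Archimedean2[of "\<bar>C\<bar> / \<delta>"] d(1)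
    by (metis abs_ge_zero divide_nonneg_pos not_gr_zero not_less of_nat_0)
  have "\<exists>g. continuous_map D.mtopology mtopology g \<and> (\<forall>s\<in>D. proj (g s) = f (H (k / N) s))"
    if "k \<le> N" for k :: nat
    using that
  proof (induction k)
    case 0
    \<comment> \<open>At time 0 all of \<open>D\<close> sits at \<open>s0\<close>, so a constant map
      is a lift.\<close>
    have "f s0 \<in> topspace quot"
      using f s0 by (auto simp: continuous_map_def)
    then obtain m where "m \<in> M" "proj m = f s0"
      unfolding topspace_quot by blast
    then show ?case
      using H0 by (intro exI[of _ "\<lambda>_. m"]) auto
  next
    case (Suc k)
    then obtain g where g: "continuous_map D.mtopology mtopology g"
      "\<And>s. s \<in> D \<Longrightarrow> proj (g s) = f (H (k / N) s)"
      using Suc_leD by blast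
    have gM: "g s \<in> M" if "s \<in> D" for s
      using g(1) that by (auto simp: continuous_map_def)
    define u v where "u = real k / N" and "v = real (Suc k) / N"
    have uv: "0 \<le> u" "u \<le> 1" "0 \<le> v" "v \<le> 1" "\<bar>u - v\<bar> = 1 / N"
      using Suc.prems N by (auto simp: u_def v_def field_simps)
    have "e (H u s) (H v s) < \<delta>" if "s \<in> D" for s
    proof -
      have "e (H u s) (H v s) \<le> C * (1 / N)"
        using Ht[OF uv(1-4) that] uv(5) by simp
      also have "\<dots> \<le> \<bar>C\<bar> / N"
        using N by (simp add: divide_right_mono)
      also have "\<dots> < \<delta>"
        using N d(1) by (simp add: field_simps)
      finally show ?thesis .
    qed
    \<comment> \<open>The next lift is picked point by point; it turns out continuous because nearby
      there is no alternative value.\<close>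
    then have "\<forall>s\<in>D. \<exists>y\<in>M. proj y = f (H v s) \<and> d (g s) y < \<eta>/4"
      using d(2) H uv gM g(2) unfolding u_def by blast
    then obtain h where h: "\<And>s. s \<in> D \<Longrightarrow> h s \<in> M" "\<And>s. s \<in> D \<Longrightarrow> proj (h s) = f (H v s)"
      "\<And>s. s \<in> D \<Longrightarrow> d (g s) (h s) < \<eta>/4"
      by metis
    have "continuous_map D.mtopology mtopology h"
      unfolding continuous_map_def
    proof (intro conjI allI impI)
      show "h \<in> topspace D.mtopology \<rightarrow> topspace mtopology"
        using h by auto
      fix U assume U: "openin mtopology U"
      show "openin D.mtopology {s \<in> topspace D.mtopology. h s \<in> U}"
      proof (subst openin_subopen, intro ballI)
        fix s assume "s \<in> {s \<in> topspace D.mtopology. h s \<in> U}"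
        then have s: "s \<in> D" "h s \<in> U" by auto
        then obtain r0 where r0: "r0 > 0" "mball (h s) r0 \<subseteq> U"
          using U unfolding openin_mtopology by blast
        \<comment> \<open>\<open>r\<close> is capped at a quarter of \<open>\<eta>\<close>: the way
          from \<open>y\<close> to \<open>h t\<close> through \<open>h s\<close>, \<open>g s\<close>
          and \<open>g t\<close> has four legs, each shorter than that quarter.\<close>
        define r where "r = min r0 (\<eta>/4)"
        have r: "r > 0" "r \<le> \<eta>/4" "r \<le> r0" using r0 eta_pos by (auto simp: r_def)
        from uniform_lift[OF D f r(1)] obtain \<delta>' where d': "\<delta>' > 0"
          "\<And>s t x. \<lbrakk>s \<in> D; t \<in> D; e s t < \<delta>'; x \<in> M; proj x = f s\<rbrakk>
             \<Longrightarrow> \<exists>y\<in>M. proj y = f t \<and> d x y < r" by blast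
        define T where "T = D.mball s \<delta>' \<inter> {t \<in> topspace D.mtopology. g t \<in> mball (g s) (\<eta>/4)}"
        have "openin D.mtopology T"
          unfolding T_def by (intro openin_Int openin_continuous_map_preimage[OF g(1)]) auto
        moreover have "s \<in> T"
          using s d'(1) eta_pos gM by (auto simp: T_def)
        moreover have "h t \<in> U" if "t \<in> T" for t
        proof -
          have t: "t \<in> D" "e s t < \<delta>'" "d (g s) (g t) < \<eta>/4"
            using that by (auto simp: T_def)
          have "e (H v s) (H v t) < \<delta>'"
            using Hd[OF uv(3,4) s(1) t(1)] t(2) by linarith
          then obtain y where y: "y \<in> M" "proj y = f (H v t)" "d (h s) y < r"
            using d'(2)[of "H v s" "H v t" "h s"] H uv s t h by blast
          have "d y (h t) \<le> d y (h s) + d (h s) (g s) + d (g s) (g t) + d (g t) (h t)"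
            using triangle[of y "h s" "h t"] triangle[of "h s" "g s" "h t"] triangle[of "g s" "g t" "h t"]
              y h gM s t by force
          also have "\<dots> < \<eta>"
            using y(3) r h(3)[OF s(1)] h(3)[OF t(1)] t(3) commute[of y "h s"] commute[of "h s" "g s"]
            by linarith
          finally have "y = h t"
            using close_eq[of y "h t"] y h t by simp
          then show ?thesis
            using y r r0 h s by (auto simp: subset_iff)
        qed
        ultimately show "\<exists>T. openin D.mtopology T \<and> s \<in> T \<and> T \<subseteq> {s \<in> topspace D.mtopology. h s \<in> U}"
          by (intro exI[of _ T]) (auto simp: T_def)
      qed
    qed
    then show ?case
      using h unfolding v_def by blast
  qed
  from this[of N] obtain g where "continuous_map D.mtopology mtopology g"
    "\<forall>s\<in>D. proj (g s) = f (H 1 s)"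
    using N by auto
  then show thesis
    using that H1 by simp
qed

text \<open>The simplex is contracted along segments to its vertex \<open>s0\<close>. This meets the
  hypotheses of \<open>lift_exists\<close>: scaling by \<open>t\<close> does not increase distances,
  and points travel at speed at most 2, because all points of the simplex have l1 norm 1.\<close>

lemma singular_simplex_lift:
  assumes "singular_simplex q quot \<sigma>"
  obtains \<tau> where "singular_simplex q mtopology \<tau>" "simplex_map q proj \<tau> = \<sigma>"
proof -
  let ?S = "standard_simplex q" and ?e = "l1_dist (Suc q)"
  have sub: "?S \<subseteq> topspace (Euclidean_space (Suc q))"
    by (auto simp: standard_simplex_def topspace_Euclidean_space)
  interpret S: Submetric "topspace (Euclidean_space (Suc q))" ?e ?S
    by unfold_locales (rule sub)
  \<comment> \<open>Singular simplices use the subspace topology of an infinite product, while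
    \<open>lift_exists\<close> asks for a metric topology on the domain.\<close>
  have top: "S.sub.mtopology = subtopology (powertop_real UNIV) ?S"
  proof -
    have "S.sub.mtopology = subtopology (Euclidean_space (Suc q)) ?S"
      by (simp add: S.mtopology_submetric mtopology_l1)
    also have "\<dots> = subtopology (powertop_real UNIV) ?S"
      using sub unfolding Euclidean_space_def subtopology_subtopology
      by (simp add: Int_absorb1)
    finally show ?thesis .
  qed
  define s0 :: "nat \<Rightarrow> real" where "s0 = (\<lambda>j. if j = 0 then 1 else 0)"
  define H where "H = (\<lambda>t x i. (1 - t) * s0 i + t * x i)"
  have s0: "s0 \<in> ?S" by (simp add: s0_def)
  have le2: "?e s0 x \<le> 2" if "x \<in> ?S" for x
  proof -
    have "?e s0 x \<le> (\<Sum>i<Suc q. \<bar>s0 i\<bar> + \<bar>x i\<bar>)"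
      unfolding l1_dist_def by (intro sum_mono) linarith
    also have "\<dots> = (\<Sum>i\<le>q. s0 i) + (\<Sum>i\<le>q. x i)"
      using s0 that by (simp add: lessThan_Suc_atMost sum.distrib standard_simplex_def)
    also have "\<dots> = 2"
      using s0 that by (simp add: standard_simplex_def)
    finally show ?thesis .
  qed
  have comp: "compact_space S.sub.mtopology"
    by (simp add: top compact_space_subtopology compactin_standard_simplex)
  have cont: "continuous_map S.sub.mtopology quot \<sigma>"
    using assms by (simp add: top singular_simplex_def)
  have HS: "H t x \<in> ?S" if "0 \<le> t" "t \<le> 1" "x \<in> ?S" for t x
    unfolding H_def using convex_standard_simplex[OF s0 that(3,1,2)] .
  have H0: "H 0 x = s0" and H1: "H 1 x = x" if "x \<in> ?S" for x
    by (simp_all add: H_def)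
  have Hd: "?e (H t x) (H t y) \<le> ?e x y" if "0 \<le> t" "t \<le> 1" "x \<in> ?S" "y \<in> ?S" for t x y
  proof -
    have "?e (H t x) (H t y) = (\<Sum>i<Suc q. t * \<bar>x i - y i\<bar>)"
      unfolding l1_dist_def H_def using that
      by (intro sum.cong refl) (auto simp: abs_mult simp flip: right_diff_distrib)
    also have "\<dots> \<le> ?e x y"
      unfolding l1_dist_def using that by (intro sum_mono) (simp add: mult_left_le_one_le)
    finally show ?thesis .
  qed
  have Hu: "?e (H t x) (H u x) \<le> 2 * \<bar>t - u\<bar>" if "0 \<le> t" "t \<le> 1" "0 \<le> u" "u \<le> 1" "x \<in> ?S" for t u x
  proof -
    have "?e (H t x) (H u x) = (\<Sum>i<Suc q. \<bar>t - u\<bar> * \<bar>s0 i - x i\<bar>)"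
      unfolding l1_dist_def H_def
      by (intro sum.cong refl, unfold abs_mult[symmetric])
        (subst abs_minus_commute, simp add: algebra_simps)
    also have "\<dots> = \<bar>t - u\<bar> * ?e s0 x"
      unfolding l1_dist_def sum_distrib_left ..
    also have "\<dots> \<le> 2 * \<bar>t - u\<bar>"
      using mult_right_mono[OF le2[OF that(5)], of "\<bar>t - u\<bar>"] by (simp only: mult.commute abs_ge_zero)
    finally show ?thesis .
  qed
  obtain g where g: "continuous_map S.sub.mtopology mtopology g"
    "\<And>s. s \<in> ?S \<Longrightarrow> proj (g s) = \<sigma> s"
    by (rule lift_exists[where H = H, OF S.sub.Metric_space_axioms comp cont HS H0 H1 s0 Hd Hu]) blast+
  show thesis
  proof
    show "singular_simplex q mtopology (restrict g ?S)"
      unfolding singular_simplex_def using g(1)[unfolded top]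
      by (auto intro: continuous_map_eq[of _ _ g])
    have "\<sigma> \<in> extensional ?S"
      using assms by (simp add: singular_simplex_def)
    then show "simplex_map q proj (restrict g ?S) = \<sigma>"
      unfolding simplex_map_def using g(2)
      by (auto simp: fun_eq_iff extensional_def)
  qed
qed

text \<open>The group element is fixed by the values over a single point \<open>s0\<close>. The set
  on which the two lifts then agree is closed by the Hausdorff property and open by the displacement
  bound, so connectedness of the simplex finishes.\<close>

lemma singular_simplex_lift_unique:
  assumes \<tau>: "singular_simplex q mtopology \<tau>" "singular_simplex q mtopology \<tau>'"
    and eq: "simplex_map q proj \<tau> = simplex_map q proj \<tau>'"
  obtains \<gamma> where "\<gamma> \<in> carrier G" "\<tau>' = simplex_map q \<gamma> \<tau>"
proof -
  let ?S = "standard_simplex q" and ?T = "subtopology (powertop_real UNIV) (standard_simplex q)"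
  have cont: "continuous_map ?T mtopology \<tau>" "continuous_map ?T mtopology \<tau>'"
    using \<tau> by (auto simp: singular_simplex_def)
  have inM: "\<tau> s \<in> M" "\<tau>' s \<in> M" if "s \<in> ?S" for s
    using cont that by (auto simp: continuous_map_def)
  have pr: "proj (\<tau> s) = proj (\<tau>' s)" if "s \<in> ?S" for s
    using fun_cong[OF eq, of s] that by (simp add: simplex_map_def)
  obtain s0 where s0: "s0 \<in> ?S"
    using nonempty_standard_simplex by blast
  obtain \<gamma> where g: "\<gamma> \<in> carrier G" "\<tau>' s0 = \<gamma> (\<tau> s0)"
    using proj_eq_iff pr inM s0 by metis
  define A where "A = {s \<in> topspace ?T. \<tau>' s = \<gamma> (\<tau> s)}"
  have close: "d (\<tau>' s) (\<gamma> (\<tau> s)) < \<eta> \<Longrightarrow> \<tau>' s = \<gamma> (\<tau> s)" if "s \<in> ?S" for s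
    using close_eq[of "\<tau>' s" "\<gamma> (\<tau> s)"] that inM g act_closed pr proj_act by metis
  have cg: "continuous_map ?T mtopology (\<gamma> \<circ> \<tau>)"
    using cont(1) continuous_map_act[OF g(1)] by (rule continuous_map_compose)
  have "closedin ?T A"
    unfolding A_def using closedin_continuous_maps_eq[OF Hausdorff_space_mtopology cont(2) cg] by simp
  moreover have "openin ?T A"
  proof (subst openin_subopen, intro ballI)
    fix s assume s: "s \<in> A"
    then have sS: "s \<in> ?S" and se: "\<tau>' s = \<gamma> (\<tau> s)" by (auto simp: A_def)
    \<comment> \<open>Here both lifts stay within \<open>\<eta>/2\<close> of their common value at
      \<open>s\<close>, hence within \<open>\<eta>\<close> of each other.\<close>
    define T where "T = {t \<in> topspace ?T. \<tau>' t \<in> mball (\<tau>' s) (\<eta>/2)} \<inter>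
                        {t \<in> topspace ?T. (\<gamma> \<circ> \<tau>) t \<in> mball (\<tau>' s) (\<eta>/2)}"
    have "openin ?T T"
      unfolding T_def
      by (intro openin_Int openin_continuous_map_preimage[OF cont(2)] openin_continuous_map_preimage[OF cg]) auto
    moreover have "s \<in> T"
      using sS inM eta_pos by (auto simp: T_def se[symmetric])
    moreover have "T \<subseteq> A"
    proof
      fix t assume t: "t \<in> T"
      then have tS: "t \<in> ?S" by (auto simp: T_def)
      have "d (\<tau>' t) (\<gamma> (\<tau> t)) \<le> d (\<tau>' s) (\<tau>' t) + d (\<tau>' s) (\<gamma> (\<tau> t))"
        using triangle''[of "\<tau>' t" "\<tau>' s" "\<gamma> (\<tau> t)"] inM tS sS g act_closed commute by metis
      also have "\<dots> < \<eta>"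
        using t by (auto simp: T_def)
      finally show "t \<in> A"
        using close tS by (auto simp: A_def)
    qed
    ultimately show "\<exists>T. openin ?T T \<and> s \<in> T \<and> T \<subseteq> A" by blast
  qed
  moreover have "connected_space ?T"
    using connectedin_standard_simplex connectedin_def by blast
  moreover have "s0 \<in> A"
    using s0 g by (auto simp: A_def)
  ultimately have "A = topspace ?T"
    unfolding connected_space_clopen_in by blast
  then have "\<And>s. s \<in> ?S \<Longrightarrow> \<tau>' s = \<gamma> (\<tau> s)"
    by (auto simp: A_def)
  moreover have "\<tau>' \<in> extensional ?S"
    using \<tau> by (simp add: singular_simplex_def)
  ultimately have "\<tau>' = simplex_map q \<gamma> \<tau>"
    by (auto simp: simplex_map_def fun_eq_iff extensional_def)
  then show thesis
    using that g by blast
qed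

end

section \<open>The characteristic cocycle of an orbit space\<close>

lemma hom_chain_add:
  "\<lbrakk>f \<in> hom (chain_group q X) Q; singular_chain q X a; singular_chain q X b\<rbrakk>
     \<Longrightarrow> f (a + b) = f a \<otimes>\<^bsub>Q\<^esub> f b"
  using hom_mult[of f "chain_group q X" Q a b] by simp

lemma hom_chain_0: "\<lbrakk>f \<in> hom (chain_group q X) Q; group Q\<rbrakk> \<Longrightarrow> f 0 = \<one>\<^bsub>Q\<^esub>"
  using hom_one[of f "chain_group q X" Q] by simp

lemma hom_chain_minus:
  assumes "f \<in> hom (chain_group q X) Q" "group Q" "singular_chain q X a"
  shows "f (- a) = inv\<^bsub>Q\<^esub> f a"
proof -
  interpret group_hom "chain_group q X" Q f
    using assms by (simp add: group_hom_def group_hom_axioms_def)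
  show ?thesis
    using hom_inv[of a] assms(3) by (simp add: singular_chain_def)
qed

lemma hom_chain_diff:
  assumes "f \<in> hom (chain_group q X) Q" "group Q" "singular_chain q X a" "singular_chain q X b"
  shows "f (a - b) = f a \<otimes>\<^bsub>Q\<^esub> inv\<^bsub>Q\<^esub> f b"
  using hom_chain_add[of f q X Q a "- b"] hom_chain_minus[OF assms(1,2,4)] assms
  by (simp add: singular_chain_minus)

lemma hom_chain_eqI:
  assumes f: "f \<in> hom (chain_group q X) Q" and g: "g \<in> hom (chain_group q X) Q" and Q: "group Q"
    and eq: "\<And>\<sigma>. singular_simplex q X \<sigma> \<Longrightarrow> f (frag_of \<sigma>) = g (frag_of \<sigma>)"
    and c: "singular_chain q X c"
  shows "f c = g c"
proof -
  have "Poly_Mapping.keys c \<subseteq> singular_simplex_set q X"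
    using c by (simp add: singular_chain_def)
  then show ?thesis
  proof (rule free_Abelian_group_induct)
    show "f 0 = g 0"
      using hom_chain_0 f g Q by metis
    show "f (x - y) = g (x - y)" if "Poly_Mapping.keys x \<subseteq> singular_simplex_set q X"
      "Poly_Mapping.keys y \<subseteq> singular_simplex_set q X" "f x = g x" "f y = g y" for x y
      using that hom_chain_diff[OF f Q] hom_chain_diff[OF g Q] by (simp add: singular_chain_def)
  qed (simp add: eq)
qed

lemma hom_chain_closed:
  "\<lbrakk>f \<in> hom (chain_group q X) Q; singular_chain q X c\<rbrakk> \<Longrightarrow> f c \<in> carrier Q"
  using hom_in_carrier[of f "chain_group q X" Q c] by simp

lemma hom_chain_comp:
  assumes "f \<in> hom (chain_group q X) Q"
    and "\<And>c. singular_chain p Z c \<Longrightarrow> singular_chain q X (t c)"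
    and "\<And>a b. t (a + b) = t a + t b"
  shows "(\<lambda>c. f (t c)) \<in> hom (chain_group p Z) Q"
  using assms hom_chain_add[OF assms(1)] hom_chain_closed[OF assms(1)] by (intro homI) auto

lemma hom_chain_exists:
  assumes "comm_group Q" "\<And>\<sigma>. singular_simplex q X \<sigma> \<Longrightarrow> f \<sigma> \<in> carrier Q"
  obtains h where "h \<in> hom (chain_group q X) Q" "\<And>\<sigma>. singular_simplex q X \<sigma> \<Longrightarrow> h (frag_of \<sigma>) = f \<sigma>"
proof -
  have "f ` singular_simplex_set q X \<subseteq> carrier Q"
    using assms(2) by auto
  from comm_group.free_Abelian_group_universal[OF assms(1) this] that show thesis
    unfolding chain_group_def by auto
qed

text \<open>The value at an element of \<open>Q\<close> is read off an arbitrary preimage; the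
  kernel condition makes it independent of the choice.\<close>

lemma hom_factor:
  assumes G: "group G" and \<phi>: "\<phi> \<in> hom G Q" "\<phi> ` carrier G = carrier Q" and Q: "group Q"
    and h: "h \<in> hom G W" and W: "group W"
    and ker: "\<And>x. \<lbrakk>x \<in> carrier G; \<phi> x = \<one>\<^bsub>Q\<^esub>\<rbrakk> \<Longrightarrow> h x = \<one>\<^bsub>W\<^esub>"
  obtains h' where "h' \<in> hom Q W" "\<And>x. x \<in> carrier G \<Longrightarrow> h' (\<phi> x) = h x"
proof -
  interpret \<phi>: group_hom G Q \<phi>
    using assms by (simp add: group_hom_def group_hom_axioms_def)
  interpret h: group_hom G W h
    using assms by (simp add: group_hom_def group_hom_axioms_def)
  define h' where "h' = (\<lambda>q. h (inv_into (carrier G) \<phi> q))"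
  have eq: "h x = h y" if "x \<in> carrier G" "y \<in> carrier G" "\<phi> x = \<phi> y" for x y
  proof -
    have "h (x \<otimes>\<^bsub>G\<^esub> inv\<^bsub>G\<^esub> y) = \<one>\<^bsub>W\<^esub>"
      using that by (intro ker) auto
    then show ?thesis
      using that h.H.inv_equality by fastforce
  qed
  have eq': "h' (\<phi> x) = h x" if "x \<in> carrier G" for x
    unfolding h'_def using that by (intro eq inv_into_into f_inv_into_f) auto
  have "h' \<in> hom Q W"
  proof (rule homI)
    fix x y assume "x \<in> carrier Q" "y \<in> carrier Q"
    then obtain a b where "a \<in> carrier G" "b \<in> carrier G" "x = \<phi> a" "y = \<phi> b"
      using \<phi>(2) by (metis imageE)
    then show "h' x \<in> carrier W" "h' (x \<otimes>\<^bsub>Q\<^esub> y) = h' x \<otimes>\<^bsub>W\<^esub> h' y"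
      using eq' eq'[of "a \<otimes>\<^bsub>G\<^esub> b"] by auto
  qed
  then show thesis using that eq' by blast
qed

lemma boundary_singular_1_simplex:
  "chain_boundary (Suc 0) (frag_of \<sigma>) = frag_of (singular_face (Suc 0) 0 \<sigma>) - frag_of (singular_face (Suc 0) (Suc 0) \<sigma>)"
  by (simp add: chain_boundary_of)

text \<open>A cocycle whose class is an isomorphism from the first homology group to
  \<open>Q\<close>. The equivalence contains both the cocycle condition, as boundaries are cycles,
  and injectivity on classes. Being defined on all chains and not only on cycles, \<open>c\<close>
  gives access to cohomology as well.\<close>

definition characteristic_cocycle ::
    "'a topology \<Rightarrow> ('q, 'm) monoid_scheme \<Rightarrow> ('a chain \<Rightarrow> 'q) \<Rightarrow> bool" where
  "characteristic_cocycle Y Q c \<longleftrightarrow>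
     c \<in> hom (chain_group 1 Y) Q \<and>
     (\<forall>z. singular_relcycle 1 Y {} z \<longrightarrow> (c z = \<one>\<^bsub>Q\<^esub> \<longleftrightarrow> singular_relboundary 1 Y {} z)) \<and>
     c ` singular_relcycle_set 1 Y {} = carrier Q"

lemma characteristic_cocycleD:
  assumes "characteristic_cocycle Y Q c"
  shows "c \<in> hom (chain_group 1 Y) Q"
    and "singular_relcycle 1 Y {} z \<Longrightarrow> c z = \<one>\<^bsub>Q\<^esub> \<longleftrightarrow> singular_relboundary 1 Y {} z"
    and "c ` singular_relcycle_set 1 Y {} = carrier Q"
  using assms unfolding characteristic_cocycle_def by blast+

section \<open>Lifted chains and the group coordinates of their vertices\<close>

context uniformly_free_action
begin

text \<open>Simplices are lifted independently of each other, so a lift of a cycle may have a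
  nonzero boundary; that boundary is what the cocycle measures.\<close>

lemma singular_chain_lift:
  assumes "singular_chain q quot c"
  obtains u where "singular_chain q mtopology u" "chain_map q proj u = c"
proof -
  have "\<exists>u. singular_chain q mtopology u \<and> chain_map q proj u = c"
    using assms unfolding singular_chain_def[of q quot]
  proof (rule free_Abelian_group_induct)
    show "\<exists>u. singular_chain q mtopology u \<and> chain_map q proj u = 0"
      by (intro exI[of _ 0]) auto
    show "\<exists>u. singular_chain q mtopology u \<and> chain_map q proj u = frag_of \<sigma>"
      if "\<sigma> \<in> singular_simplex_set q quot" for \<sigma>
      using that by (metis chain_map_of mem_Collect_eq singular_chain_of singular_simplex_lift)
  qed (metis chain_map_diff singular_chain_diff)
  then show thesis using that by blast
qed

lemma chain_map_proj_act:
  assumes "\<gamma> \<in> carrier G" "singular_chain q mtopology c"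
  shows "chain_map q proj (chain_map q \<gamma> c) = chain_map q proj c"
proof -
  have "chain_map q proj (chain_map q \<gamma> c) = chain_map q (proj \<circ> \<gamma>) c"
    by (simp add: chain_map_compose)
  also have "\<dots> = chain_map q proj c"
    using assms by (intro chain_map_eq[of q mtopology]) (auto simp: proj_act)
  finally show ?thesis .
qed

text \<open>A base point in every fibre of the projection, chosen without any continuity.\<close>

definition vertex_lift :: "((nat \<Rightarrow> real) \<Rightarrow> 'a set) \<Rightarrow> (nat \<Rightarrow> real) \<Rightarrow> 'a" where
  "vertex_lift w = (SOME v. singular_simplex 0 mtopology v \<and> simplex_map 0 proj v = w)"

lemma vertex_lift:
  assumes "singular_simplex 0 quot w"
  shows "singular_simplex 0 mtopology (vertex_lift w)" "simplex_map 0 proj (vertex_lift w) = w"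
  using someI_ex[of "\<lambda>v. singular_simplex 0 mtopology v \<and> simplex_map 0 proj v = w"]
    singular_simplex_lift[OF assms] unfolding vertex_lift_def by metis+

text \<open>The coordinate of a vertex in its fibre relative to the base point; freeness makes it
  unique.\<close>

definition deck :: "((nat \<Rightarrow> real) \<Rightarrow> 'a) \<Rightarrow> 'a \<Rightarrow> 'a" where
  "deck v = (SOME \<gamma>. \<gamma> \<in> carrier G \<and> v = simplex_map 0 \<gamma> (vertex_lift (simplex_map 0 proj v)))"

lemma deck:
  assumes "singular_simplex 0 mtopology v"
  shows "deck v \<in> carrier G" "simplex_map 0 (deck v) (vertex_lift (simplex_map 0 proj v)) = v"
proof -
  have w: "singular_simplex 0 quot (simplex_map 0 proj v)"
    using assms continuous_map_proj by (rule singular_simplex_simplex_map)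
  obtain \<gamma> where "\<gamma> \<in> carrier G" "v = simplex_map 0 \<gamma> (vertex_lift (simplex_map 0 proj v))"
    using singular_simplex_lift_unique[OF vertex_lift(1)[OF w] assms vertex_lift(2)[OF w]] .
  then have "\<exists>\<gamma>. \<gamma> \<in> carrier G \<and> v = simplex_map 0 \<gamma> (vertex_lift (simplex_map 0 proj v))"
    by blast
  from someI_ex[OF this] show "deck v \<in> carrier G"
    "simplex_map 0 (deck v) (vertex_lift (simplex_map 0 proj v)) = v"
    unfolding deck_def by auto
qed

lemma simplex_map_cancel:
  assumes "\<gamma> \<in> carrier G" "\<delta> \<in> carrier G" "singular_simplex q mtopology v"
    "simplex_map q \<gamma> v = simplex_map q \<delta> v"
  shows "\<gamma> = \<delta>"
proof -
  obtain s where s: "s \<in> standard_simplex q"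
    using nonempty_standard_simplex by blast
  have "v s \<in> M"
    using assms(3) s by (auto simp: singular_simplex_def continuous_map_def)
  moreover have "\<gamma> (v s) = \<delta> (v s)"
    using fun_cong[OF assms(4), of s] s by (simp add: simplex_map_def)
  ultimately show ?thesis
    using act_cancel assms by blast
qed

lemma simplex_map_mult:
  assumes "\<gamma> \<in> carrier G" "\<delta> \<in> carrier G" "singular_simplex q mtopology v"
  shows "simplex_map q (\<gamma> \<otimes> \<delta>) v = simplex_map q \<gamma> (simplex_map q \<delta> v)"
proof -
  have "v s \<in> M" if "s \<in> standard_simplex q" for s
    using assms(3) that by (auto simp: singular_simplex_def continuous_map_def)
  then show ?thesis
    using assms by (auto simp: simplex_map_def act_mult)
qed

lemma singular_simplex_act:
  "\<lbrakk>\<gamma> \<in> carrier G; singular_simplex q mtopology v\<rbrakk> \<Longrightarrow> singular_simplex q mtopology (simplex_map q \<gamma> v)"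
  using continuous_map_act singular_simplex_simplex_map by blast

lemma singular_simplex_proj:
  "singular_simplex q mtopology v \<Longrightarrow> singular_simplex q quot (simplex_map q proj v)"
  using continuous_map_proj singular_simplex_simplex_map by blast

lemma simplex_map_proj_act:
  assumes "\<gamma> \<in> carrier G" "singular_simplex q mtopology v"
  shows "simplex_map q proj (simplex_map q \<gamma> v) = simplex_map q proj v"
  using chain_map_proj_act[OF assms(1), of q "frag_of v"] assms(2)
  by (simp add: singular_chain_of frag_of_eq)

text \<open>Both group elements carry the base point of the fibre to the same vertex, so freeness
  identifies them.\<close>

lemma deck_act:
  assumes "\<gamma> \<in> carrier G" "singular_simplex 0 mtopology v"
  shows "deck (simplex_map 0 \<gamma> v) = \<gamma> \<otimes> deck v"
proof (rule simplex_map_cancel)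
  let ?w = "vertex_lift (simplex_map 0 proj v)"
  have v': "singular_simplex 0 mtopology (simplex_map 0 \<gamma> v)"
    using assms by (rule singular_simplex_act)
  show "deck (simplex_map 0 \<gamma> v) \<in> carrier G" "\<gamma> \<otimes> deck v \<in> carrier G"
    using deck assms v' by auto
  show w: "singular_simplex 0 mtopology ?w"
    using assms(2) by (intro vertex_lift singular_simplex_proj)
  show "simplex_map 0 (deck (simplex_map 0 \<gamma> v)) ?w = simplex_map 0 (\<gamma> \<otimes> deck v) ?w"
    using deck[OF v'] deck[OF assms(2)] assms w by (simp add: simplex_map_proj_act simplex_map_mult)
qed

text \<open>The degree of a 1-chain \<open>p\<^sub># u\<close> of the quotient is read off the endpoints of its lift \<open>u\<close>.\<close>

lemma transfer_cocycle_exists: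
  assumes Q: "comm_group Q" and \<phi>: "\<phi> \<in> hom G Q"
  obtains K c where "K \<in> hom (chain_group 0 mtopology) Q"
    "\<And>v. singular_simplex 0 mtopology v \<Longrightarrow> K (frag_of v) = \<phi> (deck v)"
    "c \<in> hom (chain_group 1 quot) Q"
    "\<And>u. singular_chain 1 mtopology u \<Longrightarrow> c (chain_map 1 proj u) = K (chain_boundary 1 u)"
proof -
  interpret Q: comm_group Q by (rule Q)
  have \<phi>c: "\<phi> \<gamma> \<in> carrier Q" if "\<gamma> \<in> carrier G" for \<gamma>
    using \<phi> that by (rule hom_in_carrier)
  obtain K where K: "K \<in> hom (chain_group 0 mtopology) Q"
    "\<And>v. singular_simplex 0 mtopology v \<Longrightarrow> K (frag_of v) = \<phi> (deck v)"
    using hom_chain_exists[OF Q, of 0 mtopology "\<lambda>v. \<phi> (deck v)"] deck \<phi>c by metis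
  define \<kappa> where "\<kappa> = (\<lambda>u. K (chain_boundary 1 u))"
  have \<kappa>: "\<kappa> \<in> hom (chain_group 1 mtopology) Q"
    unfolding \<kappa>_def using K(1)
    by (rule hom_chain_comp) (auto simp: singular_chain_boundary_alt chain_boundary_add)
  \<comment> \<open>Both endpoints gain the factor \<open>\<phi> \<gamma>\<close>; they enter with
    opposite signs, so it cancels in the abelian group \<open>Q\<close>.\<close>
  have \<kappa>1: "\<kappa> (frag_of (simplex_map 1 \<gamma> \<tau>)) = \<kappa> (frag_of \<tau>)"
    if g: "\<gamma> \<in> carrier G" and \<tau>: "singular_simplex 1 mtopology \<tau>" for \<gamma> \<tau>
  proof -
    let ?f = "\<lambda>i. singular_face (Suc 0) i \<tau>"
    have f: "singular_simplex 0 mtopology (?f 0)" "singular_simplex 0 mtopology (?f (Suc 0))"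
      using singular_simplex_singular_face[of 1 mtopology \<tau>] \<tau> by auto
    have gf: "singular_simplex 0 mtopology (simplex_map 0 \<gamma> (?f 0))"
      "singular_simplex 0 mtopology (simplex_map 0 \<gamma> (?f (Suc 0)))"
      using f g by (auto intro: singular_simplex_act)
    note dc = \<phi>c[OF deck(1)[OF f(1)]] \<phi>c[OF deck(1)[OF f(2)]] \<phi>c[OF g]
    have "chain_boundary (Suc 0) (frag_of (simplex_map (Suc 0) \<gamma> \<tau>)) =
       chain_map 0 \<gamma> (chain_boundary (Suc 0) (frag_of \<tau>))"
      using chain_boundary_chain_map[of "Suc 0" mtopology "frag_of \<tau>" \<gamma>] \<tau>
      by (simp add: singular_chain_of)
    also have "\<dots> = frag_of (simplex_map 0 \<gamma> (?f 0)) - frag_of (simplex_map 0 \<gamma> (?f (Suc 0)))"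
      by (simp add: boundary_singular_1_simplex chain_map_diff)
    finally have "\<kappa> (frag_of (simplex_map 1 \<gamma> \<tau>)) =
        (\<phi> \<gamma> \<otimes>\<^bsub>Q\<^esub> \<phi> (deck (?f 0))) \<otimes>\<^bsub>Q\<^esub> inv\<^bsub>Q\<^esub> (\<phi> \<gamma> \<otimes>\<^bsub>Q\<^esub> \<phi> (deck (?f (Suc 0))))"
      using gf f g deck(1) \<phi>
      by (simp add: \<kappa>_def hom_chain_diff[OF K(1)] singular_chain_of K(2) deck_act hom_mult[OF \<phi>])
    also have "\<dots> = \<phi> (deck (?f 0)) \<otimes>\<^bsub>Q\<^esub> inv\<^bsub>Q\<^esub> \<phi> (deck (?f (Suc 0)))"
    proof -
      have "(a \<otimes>\<^bsub>Q\<^esub> x) \<otimes>\<^bsub>Q\<^esub> inv\<^bsub>Q\<^esub> (a \<otimes>\<^bsub>Q\<^esub> y) = x \<otimes>\<^bsub>Q\<^esub> inv\<^bsub>Q\<^esub> y"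
        if "a \<in> carrier Q" "x \<in> carrier Q" "y \<in> carrier Q" for a x y
      proof -
        have "a \<otimes>\<^bsub>Q\<^esub> (inv\<^bsub>Q\<^esub> a \<otimes>\<^bsub>Q\<^esub> inv\<^bsub>Q\<^esub> y) = inv\<^bsub>Q\<^esub> y"
          using that by (simp add: Q.m_assoc[symmetric])
        moreover have "a \<otimes>\<^bsub>Q\<^esub> x = x \<otimes>\<^bsub>Q\<^esub> a"
          using that by (simp add: Q.m_comm)
        ultimately show ?thesis
          using that by (simp add: Q.inv_mult Q.m_assoc)
      qed
      then show ?thesis using dc by blast
    qed
    also have "\<dots> = \<kappa> (frag_of \<tau>)"
      using f by (simp add: \<kappa>_def boundary_singular_1_simplex hom_chain_diff[OF K(1)] singular_chain_of K(2))
    finally show ?thesis .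
  qed
  \<comment> \<open>The choice is immaterial: two lifts differ by a group element, under which
    \<open>\<kappa>\<close> is invariant.\<close>
  define lift where "lift = (\<lambda>\<sigma>. SOME \<tau>. singular_simplex 1 mtopology \<tau> \<and> simplex_map 1 proj \<tau> = \<sigma>)"
  have lift: "singular_simplex 1 mtopology (lift \<sigma>)" "simplex_map 1 proj (lift \<sigma>) = \<sigma>"
    if "singular_simplex 1 quot \<sigma>" for \<sigma>
    using someI_ex[of "\<lambda>\<tau>. singular_simplex 1 mtopology \<tau> \<and> simplex_map 1 proj \<tau> = \<sigma>"]
      singular_simplex_lift[OF that] unfolding lift_def by metis+
  have "\<kappa> (frag_of (lift \<sigma>)) \<in> carrier Q" if "singular_simplex 1 quot \<sigma>" for \<sigma>
    using lift(1)[OF that] hom_chain_closed[OF \<kappa>] by (simp add: singular_chain_of)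
  then obtain c where c: "c \<in> hom (chain_group 1 quot) Q"
    "\<And>\<sigma>. singular_simplex 1 quot \<sigma> \<Longrightarrow> c (frag_of \<sigma>) = \<kappa> (frag_of (lift \<sigma>))"
    using hom_chain_exists[OF Q, of 1 quot "\<lambda>\<sigma>. \<kappa> (frag_of (lift \<sigma>))"] by metis
  have "c (chain_map 1 proj u) = \<kappa> u" if "singular_chain 1 mtopology u" for u
  proof (rule hom_chain_eqI[OF _ \<kappa> Q.is_group _ that])
    show "(\<lambda>u. c (chain_map 1 proj u)) \<in> hom (chain_group 1 mtopology) Q"
      using c(1) by (rule hom_chain_comp)
        (auto simp: singular_chain_chain_map continuous_map_proj chain_map_add)
    fix \<tau> assume \<tau>: "singular_simplex 1 mtopology \<tau>"
    then have p: "singular_simplex 1 quot (simplex_map 1 proj \<tau>)"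
      using continuous_map_proj by (rule singular_simplex_simplex_map)
    obtain \<gamma> where "\<gamma> \<in> carrier G" "lift (simplex_map 1 proj \<tau>) = simplex_map 1 \<gamma> \<tau>"
      using singular_simplex_lift_unique[OF \<tau> lift(1)[OF p]] lift(2)[OF p] by metis
    then show "c (chain_map 1 proj (frag_of \<tau>)) = \<kappa> (frag_of \<tau>)"
      using c(2)[OF p] \<kappa>1 \<tau> by simp
  qed
  then show thesis
    using that K c unfolding \<kappa>_def by blast
qed

text \<open>Injectivity on homology is the hard half. Modulo boundaries, the projection of a chain
  \<open>u\<close> depends only on the boundary of \<open>u\<close>, since the total space is
  acyclic; this gives a map \<open>F\<close> on 0-chains. Its change under translation by the group
  is a homomorphism \<open>h\<close> into an abelian group, which by \<open>ker\<close> factors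
  through \<open>\<phi>\<close>. So the class of the projection is \<open>h'\<close> of the degree,
  combined with a term that sees only the projected boundary, and for a cycle that term is
  trivial.\<close>

theorem characteristic_cocycle_exists:
  fixes Q :: "('q, 'm) monoid_scheme"
  assumes nonempty: "M \<noteq> {}" and path: "path_connected_space mtopology"
    and H1: "\<And>z. singular_relcycle 1 mtopology {} z \<Longrightarrow> singular_relboundary 1 mtopology {} z"
    and Q: "comm_group Q" and \<phi>: "\<phi> \<in> hom G Q" "\<phi> ` carrier G = carrier Q"
    and ker: "\<And>(W :: 'a set chain set monoid) f. \<lbrakk>comm_group W; f \<in> hom G W\<rbrakk> \<Longrightarrow> kernel G Q \<phi> \<subseteq> kernel G W f"
  shows "\<exists>c. characteristic_cocycle quot Q c"
proof -
  interpret Q: comm_group Q by (rule Q)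
  obtain K c where K: "K \<in> hom (chain_group 0 mtopology) Q"
    "\<And>v. singular_simplex 0 mtopology v \<Longrightarrow> K (frag_of v) = \<phi> (deck v)"
    and c: "c \<in> hom (chain_group 1 quot) Q"
    "\<And>u. singular_chain 1 mtopology u \<Longrightarrow> c (chain_map 1 proj u) = K (chain_boundary 1 u)"
    using transfer_cocycle_exists[OF Q \<phi>(1)] by metis
  obtain m where m: "m \<in> M" using nonempty by blast
  define v0 :: "(nat \<Rightarrow> real) \<Rightarrow> 'a" where "v0 = restrict (\<lambda>_. m) (standard_simplex 0)"
  have v0: "singular_simplex 0 mtopology v0"
    using m by (auto simp: singular_simplex_def v0_def intro: continuous_map_eq[of _ _ "\<lambda>_. m"])
  have act0: "singular_simplex 0 mtopology (simplex_map 0 \<gamma> v)"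
    if "\<gamma> \<in> carrier G" "singular_simplex 0 mtopology v" for \<gamma> v
    using that by (rule singular_simplex_act)
  have "\<exists>u. singular_chain 1 mtopology u \<and> chain_boundary 1 u = frag_of v - frag_of v0"
    if "singular_simplex 0 mtopology v" for v
    using iso_integer_zeroth_homology_group_aux[OF path that v0]
    unfolding homologous_rel_def singular_boundary by simp
  then obtain \<Lambda>0 where \<Lambda>0: "\<And>v. singular_simplex 0 mtopology v \<Longrightarrow> singular_chain 1 mtopology (\<Lambda>0 v)"
    "\<And>v. singular_simplex 0 mtopology v \<Longrightarrow> chain_boundary 1 (\<Lambda>0 v) = frag_of v - frag_of v0"
    by metis
  define B where "B = singular_relboundary_set 1 quot {}"
  \<comment> \<open>All 1-chains modulo boundaries, not only the cycles: the projected paths that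
    occur below need not be closed.\<close>
  define W where "W = chain_group 1 quot Mod B"
  define \<pi> where "\<pi> = (\<lambda>z. B #>\<^bsub>chain_group 1 quot\<^esub> z)"
  have Bsub: "subgroup B (chain_group 1 quot)"
    unfolding B_def by (rule subgroup_singular_relboundary)
  interpret B: normal B "chain_group 1 quot"
    using Bsub by (simp add: comm_group.normal_iff_subgroup[OF abelian_chain_group])
  have W: "comm_group W"
    unfolding W_def by (rule comm_group.abelian_FactGroup[OF abelian_chain_group Bsub])
  interpret W: comm_group W by (rule W)
  have \<pi>: "\<pi> \<in> hom (chain_group 1 quot) W"
    unfolding \<pi>_def W_def by (rule B.r_coset_hom_Mod)
  have \<pi>1: "\<pi> z = \<one>\<^bsub>W\<^esub> \<longleftrightarrow> singular_relboundary 1 quot {} z" if "singular_chain 1 quot z" for z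
  proof -
    have "\<pi> z = B \<longleftrightarrow> z \<in> B"
      unfolding \<pi>_def using that B.coset_join1[OF _ _ Bsub, of z] B.coset_join2[OF _ Bsub, of z]
      by auto
    then show ?thesis by (simp add: W_def B_def)
  qed
  define \<psi> where "\<psi> = (\<lambda>u. \<pi> (chain_map 1 proj u))"
  have \<psi>: "\<psi> \<in> hom (chain_group 1 mtopology) W"
    unfolding \<psi>_def using \<pi> by (rule hom_chain_comp)
      (auto simp: singular_chain_chain_map continuous_map_proj chain_map_add)
  have \<psi>cyc: "\<psi> u = \<one>\<^bsub>W\<^esub>" if "singular_chain 1 mtopology u" "chain_boundary 1 u = 0" for u
  proof -
    have "singular_relboundary 1 mtopology {} u"
      using H1 that by (simp add: singular_cycle)
    then have "singular_relboundary 1 quot {} (chain_map 1 proj u)"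
      using continuous_map_proj by (rule singular_relboundary_chain_map) auto
    then show ?thesis
      using \<pi>1 singular_chain_chain_map[OF that(1) continuous_map_proj] by (simp add: \<psi>_def)
  qed
  have \<psi>eq: "\<psi> u = \<psi> u'" if "singular_chain 1 mtopology u" "singular_chain 1 mtopology u'"
    "chain_boundary 1 u = chain_boundary 1 u'" for u u'
  proof -
    have "\<psi> u \<otimes>\<^bsub>W\<^esub> inv\<^bsub>W\<^esub> \<psi> u' = \<one>\<^bsub>W\<^esub>"
      using \<psi>cyc[of "u - u'"] hom_chain_diff[OF \<psi> W.is_group that(1,2)] that
      by (simp add: singular_chain_diff chain_boundary_diff)
    then show ?thesis
      using hom_chain_closed[OF \<psi>] that by (metis W.inv_equality W.inv_inv W.inv_closed)
  qed
  \<comment> \<open>On a vertex, \<open>F\<close> is the class of the projected path from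
    \<open>v0\<close> to it.\<close>
  define F where "F = (\<lambda>w. \<psi> (frag_extend \<Lambda>0 w))"
  have F: "F \<in> hom (chain_group 0 mtopology) W"
    unfolding F_def using \<psi>
  proof (rule hom_chain_comp)
    show "singular_chain 1 mtopology (frag_extend \<Lambda>0 w)" if "singular_chain 0 mtopology w" for w
      using that by (intro singular_chain_extend \<Lambda>0(1)) (auto simp: singular_chain_def)
  qed (rule frag_extend_add)
  have F1: "F (frag_of v) = \<psi> (\<Lambda>0 v)" for v
    by (simp add: F_def)
  have \<psi>F: "\<psi> u = F (chain_boundary 1 u)" if "singular_chain 1 mtopology u" for u
  proof (rule hom_chain_eqI[OF \<psi> _ W.is_group _ that])
    show "(\<lambda>u. F (chain_boundary 1 u)) \<in> hom (chain_group 1 mtopology) W"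
      using F by (rule hom_chain_comp) (auto simp: singular_chain_boundary_alt chain_boundary_add)
    fix \<tau> assume \<tau>: "singular_simplex 1 mtopology \<tau>"
    let ?f = "\<lambda>i. singular_face (Suc 0) i \<tau>"
    have f: "singular_simplex 0 mtopology (?f 0)" "singular_simplex 0 mtopology (?f (Suc 0))"
      using singular_simplex_singular_face[of 1 mtopology \<tau>] \<tau> by auto
    have "\<psi> (frag_of \<tau>) = \<psi> (\<Lambda>0 (?f 0) - \<Lambda>0 (?f (Suc 0)))"
      using f \<tau> \<Lambda>0 by (intro \<psi>eq)
        (auto simp: singular_chain_of singular_chain_diff chain_boundary_diff boundary_singular_1_simplex)
    also have "\<dots> = F (chain_boundary 1 (frag_of \<tau>))"
      using f \<Lambda>0 by (simp add: boundary_singular_1_simplex hom_chain_diff[OF F] hom_chain_diff[OF \<psi>]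
          singular_chain_of F1)
    finally show "\<psi> (frag_of \<tau>) = F (chain_boundary 1 (frag_of \<tau>))" .
  qed
  define h where "h = (\<lambda>\<gamma>. F (frag_of (simplex_map 0 \<gamma> v0)))"
  \<comment> \<open>The path to the translate of \<open>v\<close> may be replaced by the path to the
    translate of \<open>v0\<close> followed by the translated path to \<open>v\<close>; projection
    does not see the translation of the latter.\<close>
  have hact: "F (frag_of (simplex_map 0 \<gamma> v)) = h \<gamma> \<otimes>\<^bsub>W\<^esub> F (frag_of v)"
    if g: "\<gamma> \<in> carrier G" and v: "singular_simplex 0 mtopology v" for \<gamma> v
  proof -
    note s = act0[OF g v] act0[OF g v0]
    have cm: "singular_chain 1 mtopology (chain_map 1 \<gamma> (\<Lambda>0 v))"
      using \<Lambda>0(1)[OF v] continuous_map_act[OF g] by (rule singular_chain_chain_map)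
    have "chain_boundary 1 (chain_map 1 \<gamma> (\<Lambda>0 v)) =
          frag_of (simplex_map 0 \<gamma> v) - frag_of (simplex_map 0 \<gamma> v0)"
      using chain_boundary_chain_map[OF \<Lambda>0(1)[OF v], of \<gamma>] \<Lambda>0(2)[OF v] by (simp add: chain_map_diff)
    then have "\<psi> (\<Lambda>0 (simplex_map 0 \<gamma> v)) = \<psi> (\<Lambda>0 (simplex_map 0 \<gamma> v0) + chain_map 1 \<gamma> (\<Lambda>0 v))"
      using s cm \<Lambda>0 by (intro \<psi>eq) (auto simp: singular_chain_add chain_boundary_add)
    also have "\<dots> = \<psi> (\<Lambda>0 (simplex_map 0 \<gamma> v0)) \<otimes>\<^bsub>W\<^esub> \<psi> (chain_map 1 \<gamma> (\<Lambda>0 v))"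
      using s cm \<Lambda>0(1) by (intro hom_chain_add[OF \<psi>]) auto
    also have "\<psi> (chain_map 1 \<gamma> (\<Lambda>0 v)) = \<psi> (\<Lambda>0 v)"
      using chain_map_proj_act[OF g \<Lambda>0(1)[OF v]] by (simp add: \<psi>_def)
    finally show ?thesis
      by (simp add: h_def F1)
  qed
  have hc: "h \<gamma> \<in> carrier W" if "\<gamma> \<in> carrier G" for \<gamma>
    unfolding h_def using hom_chain_closed[OF F] act0[OF that v0] by (simp add: singular_chain_of)
  have h: "h \<in> hom G W"
  proof (rule homI)
    show "h (\<gamma> \<otimes> \<delta>) = h \<gamma> \<otimes>\<^bsub>W\<^esub> h \<delta>" if "\<gamma> \<in> carrier G" "\<delta> \<in> carrier G" for \<gamma> \<delta>
      using hact[OF that(1) act0[OF that(2) v0]] that v0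
      by (simp add: h_def simplex_map_mult)
  qed (rule hc)
  have hker: "h \<gamma> = \<one>\<^bsub>W\<^esub>" if "\<gamma> \<in> carrier G" "\<phi> \<gamma> = \<one>\<^bsub>Q\<^esub>" for \<gamma>
    using subsetD[OF ker[OF W h], of \<gamma>] that by (simp add: kernel_def)
  obtain h' where h': "h' \<in> hom Q W" "\<And>\<gamma>. \<gamma> \<in> carrier G \<Longrightarrow> h' (\<phi> \<gamma>) = h \<gamma>"
    using hom_factor[OF is_group \<phi> Q.is_group h W.is_group hker] by metis
  \<comment> \<open>Every vertex is moved to the base point of its fibre. The result depends on the
    projection of \<open>w\<close> alone, hence is 0 when \<open>w\<close> is the boundary of a
    lifted cycle.\<close>
  define S where "S = (\<lambda>w. frag_extend (frag_of \<circ> vertex_lift) (chain_map 0 proj w))"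
  have Sc: "singular_chain 0 mtopology (S w)" if "singular_chain 0 mtopology w" for w
    unfolding S_def using singular_chain_chain_map[OF that continuous_map_proj]
    by (intro singular_chain_extend) (auto simp: singular_chain_of singular_chain_def intro!: vertex_lift(1))
  have S: "(\<lambda>w. F (S w)) \<in> hom (chain_group 0 mtopology) W"
    using F Sc by (rule hom_chain_comp) (auto simp: S_def chain_map_add frag_extend_add)
  have h'K: "(\<lambda>w. h' (K w)) \<in> hom (chain_group 0 mtopology) W"
    using hom_chain_closed[OF K(1)] hom_in_carrier[OF h'(1)] hom_mult[OF h'(1)] hom_chain_add[OF K(1)]
    by (intro homI) auto
  \<comment> \<open>A vertex is \<open>deck v\<close> applied to the base point of its fibre, so
    \<open>hact\<close> separates the two contributions.\<close>
  have decomp: "F w = h' (K w) \<otimes>\<^bsub>W\<^esub> F (S w)" if "singular_chain 0 mtopology w" for w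
  proof (rule hom_chain_eqI[OF F _ W.is_group _ that])
    show "(\<lambda>w. h' (K w) \<otimes>\<^bsub>W\<^esub> F (S w)) \<in> hom (chain_group 0 mtopology) W"
      using hom_chain_closed[OF S] hom_chain_closed[OF h'K] hom_chain_add[OF S] hom_chain_add[OF h'K]
      by (intro homI) (auto simp: W.m_ac)
    fix v assume v: "singular_simplex 0 mtopology v"
    let ?w = "vertex_lift (simplex_map 0 proj v)"
    have w: "singular_simplex 0 mtopology ?w"
      using v by (intro vertex_lift singular_simplex_proj)
    show "F (frag_of v) = h' (K (frag_of v)) \<otimes>\<^bsub>W\<^esub> F (S (frag_of v))"
      using hact[OF deck(1)[OF v] w] deck[OF v] by (simp add: S_def K(2)[OF v] h'(2))
  qed
  have "characteristic_cocycle quot Q c"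
    unfolding characteristic_cocycle_def
  proof (intro conjI allI impI)
    show "c \<in> hom (chain_group 1 quot) Q"
      by (rule c(1))
    show "c z = \<one>\<^bsub>Q\<^esub> \<longleftrightarrow> singular_relboundary 1 quot {} z" if z: "singular_relcycle 1 quot {} z" for z
    proof
      assume cz: "c z = \<one>\<^bsub>Q\<^esub>"
      have zc: "singular_chain 1 quot z" "chain_boundary 1 z = 0"
        using z by (auto simp: singular_cycle)
      obtain u where u: "singular_chain 1 mtopology u" "chain_map 1 proj u = z"
        using singular_chain_lift[OF zc(1)] .
      have b: "singular_chain 0 mtopology (chain_boundary 1 u)"
        using singular_chain_boundary[OF u(1)] by simp
      have "chain_map 0 proj (chain_boundary 1 u) = 0"
        using chain_boundary_chain_map[OF u(1), of proj] u zc by simp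
      then have "S (chain_boundary 1 u) = 0"
        by (simp add: S_def)
      then have "\<pi> z = h' (c z) \<otimes>\<^bsub>W\<^esub> F 0"
        using \<psi>F[OF u(1)] decomp[OF b] c(2)[OF u(1)] u(2) by (simp add: \<psi>_def)
      also have "\<dots> = \<one>\<^bsub>W\<^esub>"
        using cz hom_chain_0[OF F W.is_group] hom_one[OF h'(1) Q.is_group W.is_group] by simp
      finally show "singular_relboundary 1 quot {} z"
        using \<pi>1 zc by blast
    next
      assume "singular_relboundary 1 quot {} z"
      then obtain t where t: "singular_chain 2 quot t" "chain_boundary 2 t = z"
        by (auto simp: singular_boundary numeral_2_eq_2)
      obtain T where T: "singular_chain 2 mtopology T" "chain_map 2 proj T = t"
        using singular_chain_lift[OF t(1)] .
      have "z = chain_map 1 proj (chain_boundary 2 T)"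
        using chain_boundary_chain_map[OF T(1), of proj] T t by simp
      then have "c z = K (chain_boundary 1 (chain_boundary 2 T))"
        using c(2) singular_chain_boundary[OF T(1)] by simp
      also have "chain_boundary 1 (chain_boundary 2 T) = 0"
        using chain_boundary_boundary[OF T(1)] by simp
      finally show "c z = \<one>\<^bsub>Q\<^esub>"
        using hom_chain_0[OF K(1) Q.is_group] by simp
    qed
    show "c ` singular_relcycle_set 1 quot {} = carrier Q"
    proof
      show "c ` singular_relcycle_set 1 quot {} \<subseteq> carrier Q"
        using hom_chain_closed[OF c(1)] by (auto simp: singular_cycle)
      show "carrier Q \<subseteq> c ` singular_relcycle_set 1 quot {}"
      proof
        fix x assume "x \<in> carrier Q"
        then obtain \<gamma> where g: "\<gamma> \<in> carrier G" "x = \<phi> \<gamma>"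
          using \<phi>(2) by blast
        note gv0 = act0[OF g(1) v0]
        \<comment> \<open>A path from \<open>v0\<close> to its translate by \<open>\<gamma>\<close>
          becomes a loop in the quotient. Its degree is a difference of two coordinates, as
          \<open>v0\<close> need not be the base point of its fibre.\<close>
        define u where "u = \<Lambda>0 (simplex_map 0 \<gamma> v0) - \<Lambda>0 v0"
        have u: "singular_chain 1 mtopology u"
          "chain_boundary 1 u = frag_of (simplex_map 0 \<gamma> v0) - frag_of v0"
          using \<Lambda>0 gv0 v0 by (auto simp: u_def singular_chain_diff chain_boundary_diff)
        have "chain_boundary 1 (chain_map 1 proj u) = 0"
          using chain_boundary_chain_map[OF u(1), of proj] u(2) g v0
          by (simp add: chain_map_diff simplex_map_proj_act)
        then have cyc: "singular_relcycle 1 quot {} (chain_map 1 proj u)"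
          using singular_chain_chain_map[OF u(1) continuous_map_proj] by (simp add: singular_cycle)
        have "c (chain_map 1 proj u) = \<phi> (\<gamma> \<otimes> deck v0) \<otimes>\<^bsub>Q\<^esub> inv\<^bsub>Q\<^esub> \<phi> (deck v0)"
          using c(2)[OF u(1)] u(2) gv0 v0 g
          by (simp add: hom_chain_diff[OF K(1)] singular_chain_of K(2) deck_act)
        also have "\<dots> = x"
          using g deck(1)[OF v0] hom_mult[OF \<phi>(1) g(1) deck(1)[OF v0]]
            hom_in_carrier[OF \<phi>(1)] by (simp add: Q.m_assoc)
        finally show "x \<in> c ` singular_relcycle_set 1 quot {}"
          using cyc by blast
      qed
    qed
  qed
  then show ?thesis by blast
qed

end

section \<open>First homology and cohomology from a characteristic cocycle\<close>

lemma homology_group_1_iso: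
  assumes Q: "group Q" and char: "characteristic_cocycle Y Q c"
  shows "homology_group 1 Y \<cong> Q"
proof -
  note c = characteristic_cocycleD(1)[OF char] and ker = characteristic_cocycleD(2)[OF char]
    and onto = characteristic_cocycleD(3)[OF char]
  have "c \<in> hom (relcycle_group 1 Y {}) Q"
    using onto hom_chain_add[OF c] by (intro homI) (auto simp: singular_cycle)
  then interpret group_hom "relcycle_group 1 Y {}" Q c
    using Q by (simp add: group_hom_def group_hom_axioms_def)
  have "kernel (relcycle_group 1 Y {}) Q c = singular_relboundary_set 1 Y {}"
    unfolding kernel_def carrier_relcycle_group using ker singular_relboundary_imp_relcycle by blast
  then show ?thesis
    using FactGroup_iso onto nontrivial_relative_homology_group[of 1 Y "{}"] by simp
qed

text \<open>The reason for the shape of \<open>hom_group\<close>: facts about homomorphisms between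
  abstract groups apply to cochains and to the dual of \<open>Q\<close> alike.\<close>

lemma cochain_group_eq: "cochain_group p X A = hom_group (chain_group p X) A"
  by (simp add: cochain_group_def hom_group_def)

section \<open>First cohomology by evaluation on cycles\<close>

lemma comm_group_cochain_group: "comm_group A \<Longrightarrow> comm_group (cochain_group p X A)"
  by (simp add: cochain_group_eq comm_group_hom_group)

lemma coboundary_map_hom:
  assumes A: "comm_group A"
  shows "coboundary_map p X \<in> hom (cochain_group p X A) (cochain_group (Suc p) X A)"
proof (rule homI)
  fix f assume f: "f \<in> carrier (cochain_group p X A)"
  have "f \<in> hom (chain_group p X) A"
    using f by (simp add: cochain_group_eq)
  then have "(\<lambda>c. f (chain_boundary (Suc p) c)) \<in> hom (chain_group (Suc p) X) A"
    by (rule hom_chain_comp) (auto simp: singular_chain_boundary_alt chain_boundary_add)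
  then show "coboundary_map p X f \<in> carrier (cochain_group (Suc p) X A)"
    unfolding cochain_group_eq coboundary_map_def
    using restrict_hom[OF group_chain_group] by fastforce
next
  fix f g
  show "coboundary_map p X (f \<otimes>\<^bsub>cochain_group p X A\<^esub> g) =
        coboundary_map p X f \<otimes>\<^bsub>cochain_group (Suc p) X A\<^esub> coboundary_map p X g"
    unfolding cochain_group_eq coboundary_map_def
    by (auto simp: singular_chain_boundary_alt intro!: restrict_ext)
qed

lemma cocycle_group:
  assumes A: "comm_group A"
  shows "group (cocycle_group p X A)"
    and "carrier (cocycle_group p X A) =
          {f \<in> carrier (cochain_group p X A).
             \<forall>d. singular_chain (Suc p) X d \<longrightarrow> f (chain_boundary (Suc p) d) = \<one>\<^bsub>A\<^esub>}"
    and "f \<otimes>\<^bsub>cocycle_group p X A\<^esub> g = f \<otimes>\<^bsub>cochain_group p X A\<^esub> g"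
proof -
  let ?C = "cochain_group p X A" and ?D = "cochain_group (Suc p) X A"
  interpret group_hom ?C ?D "coboundary_map p X"
    using coboundary_map_hom[OF A, of p X] comm_group.axioms(2)[OF comm_group_cochain_group[OF A, of p X]]
      comm_group.axioms(2)[OF comm_group_cochain_group[OF A, of "Suc p" X]]
    by (simp add: group_hom_def group_hom_axioms_def)
  show "group (cocycle_group p X A)"
    unfolding cocycle_group_def by (rule G.group_subgroup_generated)
  have "carrier (cocycle_group p X A) = kernel ?C ?D (coboundary_map p X)"
    unfolding cocycle_group_def by (rule subgroup.carrier_subgroup_generated_subgroup[OF subgroup_kernel])
  also have "\<dots> = {f \<in> carrier ?C. \<forall>d. singular_chain (Suc p) X d \<longrightarrow> f (chain_boundary (Suc p) d) = \<one>\<^bsub>A\<^esub>}"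
    by (auto simp: kernel_def cochain_group_eq coboundary_map_def fun_eq_iff)
  finally show "carrier (cocycle_group p X A) = \<dots>" .
  show "f \<otimes>\<^bsub>cocycle_group p X A\<^esub> g = f \<otimes>\<^bsub>cochain_group p X A\<^esub> g"
    by (simp add: cocycle_group_def)
qed

text \<open>A primitive may be prescribed on vertices: its value at \<open>w\<close> is
  \<open>f\<close> of a chosen path from \<open>w0\<close> to \<open>w\<close>, and the choice is
  immaterial because \<open>f\<close> kills cycles. This takes the place of the vanishing Ext term
  in the universal coefficient theorem.\<close>

lemma vanishing_on_cycles_imp_coboundary:
  fixes Y :: "'a topology" and A :: "'b monoid"
  assumes A: "comm_group A" and path: "path_connected_space Y" and ne: "topspace Y \<noteq> {}"
    and f: "f \<in> carrier (cochain_group 1 Y A)"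
    and van: "\<And>z. singular_relcycle 1 Y {} z \<Longrightarrow> f z = \<one>\<^bsub>A\<^esub>"
  shows "f \<in> coboundary_set 1 Y A"
proof -
  interpret A: comm_group A by (rule A)
  have fh: "f \<in> hom (chain_group 1 Y) A" and fe: "f \<in> extensional (carrier (chain_group 1 Y))"
    using f by (auto simp: cochain_group_eq)
  obtain y where y: "y \<in> topspace Y" using ne by blast
  define w0 :: "(nat \<Rightarrow> real) \<Rightarrow> 'a" where "w0 = restrict (\<lambda>_. y) (standard_simplex 0)"
  have w0: "singular_simplex 0 Y w0"
    using y by (auto simp: singular_simplex_def w0_def intro: continuous_map_eq[of _ _ "\<lambda>_. y"])
  have "\<exists>u. singular_chain 1 Y u \<and> chain_boundary 1 u = frag_of w - frag_of w0"
    if "singular_simplex 0 Y w" for w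
    using iso_integer_zeroth_homology_group_aux[OF path that w0]
    unfolding homologous_rel_def singular_boundary by simp
  then obtain \<mu> where \<mu>: "\<And>w. singular_simplex 0 Y w \<Longrightarrow> singular_chain 1 Y (\<mu> w)"
    "\<And>w. singular_simplex 0 Y w \<Longrightarrow> chain_boundary 1 (\<mu> w) = frag_of w - frag_of w0"
    by metis
  have \<mu>c: "singular_chain 1 Y (frag_extend \<mu> b)" if "singular_chain 0 Y b" for b
    using that by (intro singular_chain_extend \<mu>(1)) (auto simp: singular_chain_def)
  define g where "g = (\<lambda>b. f (frag_extend \<mu> b))"
  have g: "g \<in> hom (chain_group 0 Y) A"
    unfolding g_def using fh \<mu>c by (rule hom_chain_comp) (auto simp: frag_extend_add)
  have fg: "f u = g (chain_boundary 1 u)" if "singular_chain 1 Y u" for u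
  proof (rule hom_chain_eqI[OF fh _ A.is_group _ that])
    show "(\<lambda>u. g (chain_boundary 1 u)) \<in> hom (chain_group 1 Y) A"
      using g by (rule hom_chain_comp) (auto simp: singular_chain_boundary_alt chain_boundary_add)
    fix \<tau> assume \<tau>: "singular_simplex 1 Y \<tau>"
    let ?f = "\<lambda>i. singular_face (Suc 0) i \<tau>" and ?m = "\<mu> (singular_face (Suc 0) 0 \<tau>) - \<mu> (singular_face (Suc 0) (Suc 0) \<tau>)"
    have faces: "singular_simplex 0 Y (?f 0)" "singular_simplex 0 Y (?f (Suc 0))"
      using singular_simplex_singular_face[of 1 Y \<tau>] \<tau> by auto
    have m: "singular_chain 1 Y ?m" "singular_chain 1 Y (frag_of \<tau>)"
      using faces \<mu>(1) \<tau> by (auto simp: singular_chain_diff singular_chain_of)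
    \<comment> \<open>The simplex minus the detour through \<open>w0\<close> between its endpoints
      is a cycle.\<close>
    have "f (frag_of \<tau> - ?m) = \<one>\<^bsub>A\<^esub>"
      using m faces \<mu>(2) by (intro van)
        (auto simp: singular_cycle singular_chain_diff chain_boundary_diff boundary_singular_1_simplex)
    then have "f (frag_of \<tau>) = f ?m"
      using hom_chain_diff[OF fh A.is_group m(2,1)] hom_chain_closed[OF fh] m
      by (metis A.inv_equality A.inv_inv A.inv_closed)
    then show "f (frag_of \<tau>) = g (chain_boundary 1 (frag_of \<tau>))"
      by (simp add: g_def boundary_singular_1_simplex frag_extend_diff)
  qed
  define g' where "g' = restrict g (carrier (chain_group 0 Y))"
  have "g' \<in> carrier (cochain_group 0 Y A)"
    using restrict_hom[OF group_chain_group g] by (simp add: g'_def cochain_group_eq)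
  moreover have "f = coboundary_map 0 Y g'"
  proof (rule extensionalityI[OF fe])
    fix u assume "u \<in> carrier (chain_group 1 Y)"
    then show "f u = coboundary_map 0 Y g' u"
      using fg by (simp add: coboundary_map_def g'_def singular_chain_boundary_alt)
  qed (simp add: coboundary_map_def)
  ultimately show ?thesis
    by (auto simp: coboundary_set_def)
qed

text \<open>A cocycle evaluated on cycles gives a homomorphism on homology, that is, on
  \<open>Q\<close>. Surjectivity is where a cochain defined on all chains pays off:
  \<open>\<psi>\<close> composed with \<open>c\<close> is already a cocycle, so nothing has to be
  extended from cycles to chains.\<close>

theorem cohomology_group_1_iso:
  fixes Y :: "'a topology" and A :: "'b monoid" and Q :: "('q, 'm) monoid_scheme"
  assumes A: "comm_group A" and path: "path_connected_space Y" and ne: "topspace Y \<noteq> {}"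
    and Q: "comm_group Q" and char: "characteristic_cocycle Y Q c"
  shows "cohomology_group 1 Y A \<cong> hom_group Q A"
proof -
  note c = characteristic_cocycleD(1)[OF char] and ker = characteristic_cocycleD(2)[OF char]
    and onto = characteristic_cocycleD(3)[OF char]
  interpret A: comm_group A by (rule A)
  interpret Q: comm_group Q by (rule Q)
  let ?Z = "cocycle_group 1 Y A"
  \<comment> \<open>A representing cycle for each element of \<open>Q\<close>; by \<open>feq\<close>
    below, cocycles do not notice which one is chosen.\<close>
  define cyc where "cyc = (\<lambda>q. SOME z. singular_relcycle 1 Y {} z \<and> c z = q)"
  have cyc: "singular_relcycle 1 Y {} (cyc q)" "c (cyc q) = q" if "q \<in> carrier Q" for q
  proof -
    have "\<exists>z. singular_relcycle 1 Y {} z \<and> c z = q"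
      using that onto by (metis imageE mem_Collect_eq)
    from someI_ex[OF this] show "singular_relcycle 1 Y {} (cyc q)" "c (cyc q) = q"
      unfolding cyc_def by auto
  qed
  note Z = cocycle_group(2)[OF A, of 1 Y, unfolded cochain_group_eq]
  have fh: "f \<in> hom (chain_group 1 Y) A" if "f \<in> carrier ?Z" for f
    using that unfolding Z by simp
  have fb: "f z = \<one>\<^bsub>A\<^esub>" if "f \<in> carrier ?Z" "singular_relboundary 1 Y {} z" for f z
    using that unfolding Z singular_boundary by auto
  have feq: "f z = f z'" if f: "f \<in> carrier ?Z"
    and z: "singular_relcycle 1 Y {} z" "singular_relcycle 1 Y {} z'" "c z = c z'" for f z z'
  proof -
    have zc: "singular_chain 1 Y z" "singular_chain 1 Y z'"
      using z by (auto simp: singular_cycle)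
    have "c (z - z') = \<one>\<^bsub>Q\<^esub>"
      using hom_chain_diff[OF c Q.is_group zc] z(3) hom_chain_closed[OF c] zc by simp
    then have "f (z - z') = \<one>\<^bsub>A\<^esub>"
      using ker[OF singular_relcycle_diff[OF z(1,2)]] fb[OF f] by blast
    then show ?thesis
      using hom_chain_diff[OF fh[OF f] A.is_group zc] hom_chain_closed[OF fh[OF f]] zc
      by (metis A.inv_equality A.inv_inv A.inv_closed)
  qed
  define R :: "('a chain \<Rightarrow> 'b) \<Rightarrow> 'q \<Rightarrow> 'b" where "R = (\<lambda>f. \<lambda>q\<in>carrier Q. f (cyc q))"
  have Rf: "R f (c z) = f z" if "f \<in> carrier ?Z" "singular_relcycle 1 Y {} z" for f z
  proof -
    have "c z \<in> carrier Q"
      using onto that by auto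
    then show ?thesis
      using feq[OF that(1) cyc(1) that(2)] cyc(2) by (simp add: R_def)
  qed
  have Rc: "R f \<in> carrier (hom_group Q A)" if f: "f \<in> carrier ?Z" for f
  proof -
    have "R f \<in> hom Q A"
    proof (rule homI)
      fix x y assume xy: "x \<in> carrier Q" "y \<in> carrier Q"
      then have cc: "singular_chain 1 Y (cyc x)" "singular_chain 1 Y (cyc y)"
        using cyc(1) by (auto simp: singular_cycle)
      show "R f x \<in> carrier A"
        using hom_chain_closed[OF fh[OF f] cc(1)] xy by (simp add: R_def)
      have "c (cyc x + cyc y) = x \<otimes>\<^bsub>Q\<^esub> y"
        using hom_chain_add[OF c cc] cyc xy by simp
      then have "R f (x \<otimes>\<^bsub>Q\<^esub> y) = f (cyc x + cyc y)"
        using Rf[OF f singular_relcycle_add[OF cyc(1)[OF xy(1)] cyc(1)[OF xy(2)]]] by simp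
      then show "R f (x \<otimes>\<^bsub>Q\<^esub> y) = R f x \<otimes>\<^bsub>A\<^esub> R f y"
        using hom_chain_add[OF fh[OF f] cc] xy by (simp add: R_def)
    qed
    then show ?thesis by (simp add: R_def)
  qed
  have R: "R \<in> hom ?Z (hom_group Q A)"
  proof (rule homI)
    fix f g assume "f \<in> carrier ?Z" "g \<in> carrier ?Z"
    have "cyc q \<in> carrier (chain_group 1 Y)" if "q \<in> carrier Q" for q
      using cyc(1)[OF that] by (simp add: singular_cycle)
    then show "R (f \<otimes>\<^bsub>?Z\<^esub> g) = R f \<otimes>\<^bsub>hom_group Q A\<^esub> R g"
      unfolding cocycle_group(3)[OF A] cochain_group_eq
      by (auto simp: R_def intro!: restrict_ext)
  qed (rule Rc)
  interpret R: group_hom ?Z "hom_group Q A" R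
    using R cocycle_group(1)[OF A] comm_group.axioms(2)[OF comm_group_hom_group[OF Q.is_group A]]
    by (simp add: group_hom_def group_hom_axioms_def)
  have ker_eq: "kernel ?Z (hom_group Q A) R = coboundary_set 1 Y A"
  proof (intro subset_antisym subsetI)
    fix f assume "f \<in> kernel ?Z (hom_group Q A) R"
    then have f: "f \<in> carrier ?Z" "R f = (\<lambda>x\<in>carrier Q. \<one>\<^bsub>A\<^esub>)"
      by (auto simp: kernel_def)
    show "f \<in> coboundary_set 1 Y A"
    proof (rule vanishing_on_cycles_imp_coboundary[OF A path ne])
      show "f \<in> carrier (cochain_group 1 Y A)"
        using f(1) cocycle_group(2)[OF A] by blast
      show "f z = \<one>\<^bsub>A\<^esub>" if z: "singular_relcycle 1 Y {} z" for z
      proof -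
        have "c z \<in> carrier Q" using z onto by auto
        then show ?thesis
          using Rf[OF f(1) z] by (simp add: f(2))
      qed
    qed
  next
    fix f assume "f \<in> coboundary_set 1 Y A"
    then obtain g where g: "g \<in> carrier (cochain_group 0 Y A)" "f = coboundary_map 0 Y g"
      by (auto simp: coboundary_set_def)
    have gh: "g \<in> hom (chain_group 0 Y) A"
      using g(1) by (simp add: cochain_group_eq)
    have fv: "f z = \<one>\<^bsub>A\<^esub>" if "singular_relcycle 1 Y {} z" for z
      using that hom_chain_0[OF gh A.is_group] by (simp add: g(2) coboundary_map_def singular_cycle)
    have "f \<in> carrier (cochain_group 1 Y A)"
      using hom_in_carrier[OF coboundary_map_hom[OF A] g(1)] g(2) by simp
    then have f: "f \<in> carrier ?Z"
      unfolding cocycle_group(2)[OF A]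
      using fv singular_relboundary_imp_relcycle[of 1 Y "{}"] by (auto simp: singular_boundary)
    have "R f = (\<lambda>x\<in>carrier Q. \<one>\<^bsub>A\<^esub>)"
      unfolding R_def using cyc fv by (auto intro!: restrict_ext)
    then show "f \<in> kernel ?Z (hom_group Q A) R"
      using f by (simp add: kernel_def)
  qed
  have "R ` carrier ?Z = carrier (hom_group Q A)"
  proof (intro subset_antisym subsetI)
    fix \<psi> assume \<psi>: "\<psi> \<in> carrier (hom_group Q A)"
    \<comment> \<open>A preimage of \<open>\<psi>\<close>; it kills boundaries because
      \<open>c\<close> does.\<close>
    define f where "f = restrict (\<lambda>u. \<psi> (c u)) (carrier (chain_group 1 Y))"
    have "(\<lambda>u. \<psi> (c u)) \<in> hom (chain_group 1 Y) A"
      using \<psi> hom_chain_closed[OF c] hom_chain_add[OF c] by (intro homI) (auto simp: hom_def Pi_iff)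
    then have "f \<in> carrier (cochain_group 1 Y A)"
      using restrict_hom[OF group_chain_group] by (simp add: cochain_group_eq f_def)
    moreover have "f (chain_boundary 2 d) = \<one>\<^bsub>A\<^esub>" if "singular_chain 2 Y d" for d
    proof -
      have b: "singular_relboundary 1 Y {} (chain_boundary 2 d)"
        using that by (auto simp: singular_boundary numeral_2_eq_2)
      then have "c (chain_boundary 2 d) = \<one>\<^bsub>Q\<^esub>"
        using ker singular_relboundary_imp_relcycle by blast
      then show ?thesis
        using \<psi> hom_one[of \<psi> Q A] singular_relboundary_imp_chain[OF b] by (simp add: f_def)
    qed
    ultimately have f: "f \<in> carrier ?Z"
      unfolding cocycle_group(2)[OF A] by (simp add: numeral_2_eq_2)
    have "R f = \<psi>"
    proof (rule extensionalityI[of _ "carrier Q"])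
      show "R f \<in> extensional (carrier Q)" "\<psi> \<in> extensional (carrier Q)"
        using \<psi> by (auto simp: R_def)
      fix q assume q: "q \<in> carrier Q"
      then show "R f q = \<psi> q"
        using cyc[OF q] by (simp add: R_def f_def singular_cycle)
    qed
    then show "\<psi> \<in> R ` carrier ?Z" using f by blast
  qed (use Rc in auto)
  from R.FactGroup_iso[OF this] show ?thesis
    unfolding ker_eq cohomology_group_def .
qed

section \<open>The blocks as signed permutations\<close>

text \<open>A signed permutation with rows \<open>a \<mapsto> s a \<cdot> e\<^bsub>\<tau> a\<^esub>\<close> acts as a permutation of the
  signed basis vectors.\<close>

definition signed_step :: "(nat \<Rightarrow> int) \<Rightarrow> (nat \<Rightarrow> nat) \<Rightarrow> int \<times> nat \<Rightarrow> int \<times> nat" where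
  "signed_step s \<tau> = (\<lambda>(\<epsilon>, a). (\<epsilon> * s a, \<tau> a))"

lemma signed_step_simp [simp]: "signed_step s \<tau> (\<epsilon>, a) = (\<epsilon> * s a, \<tau> a)"
  by (simp add: signed_step_def)

definition signed_perm_mat :: "int mat \<Rightarrow> nat \<Rightarrow> (nat \<Rightarrow> int) \<Rightarrow> (nat \<Rightarrow> nat) \<Rightarrow> bool" where
  "signed_perm_mat A n s \<tau> \<longleftrightarrow> A \<in> carrier_mat n n \<and>
     (\<forall>a<n. \<tau> a < n \<and> s a \<in> {1, -1} \<and> (\<forall>b<n. A $$ (a, b) = (if b = \<tau> a then s a else 0)))"

lemma signed_perm_matD:
  assumes "signed_perm_mat A n s \<tau>"
  shows "A \<in> carrier_mat n n" "a < n \<Longrightarrow> \<tau> a < n" "a < n \<Longrightarrow> s a \<in> {1, -1}"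
    "\<lbrakk>a < n; b < n\<rbrakk> \<Longrightarrow> A $$ (a, b) = (if b = \<tau> a then s a else 0)"
  using assms unfolding signed_perm_mat_def by blast+

text \<open>Transitivity on the signed basis vectors, stated through invariant predicates: it says that
  the cokernel of \<open>A - 1\<close> is generated by one class \<open>x\<close> with \<open>x = -x\<close>.\<close>

definition signed_cycle :: "int mat \<Rightarrow> nat \<Rightarrow> nat \<Rightarrow> (nat \<Rightarrow> int) \<Rightarrow> (nat \<Rightarrow> nat) \<Rightarrow> bool" where
  "signed_cycle A n e s \<tau> \<longleftrightarrow> n > 0 \<and> signed_perm_mat A n s \<tau> \<and>
     (\<forall>\<epsilon> a. a < n \<longrightarrow> (signed_step s \<tau> ^^ e) (\<epsilon>, a) = (\<epsilon>, a)) \<and>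
     (\<forall>P. (\<forall>\<epsilon>\<in>{1, -1}. \<forall>a<n. P \<epsilon> a \<longleftrightarrow> P (\<epsilon> * s a) (\<tau> a)) \<longrightarrow>
          (\<forall>\<epsilon>\<in>{1, -1}. \<forall>\<delta>\<in>{1, -1}. \<forall>a<n. \<forall>b<n. P \<epsilon> a \<longrightarrow> P \<delta> b))"

lemma signed_cycleI:
  assumes "n > 0" "signed_perm_mat A n s \<tau>"
    "\<And>\<epsilon> a. a < n \<Longrightarrow> (signed_step s \<tau> ^^ e) (\<epsilon>, a) = (\<epsilon>, a)"
    "\<And>P \<epsilon> \<delta> a b. \<lbrakk>\<And>\<epsilon> a. \<lbrakk>\<epsilon> \<in> {1, -1}; a < n\<rbrakk> \<Longrightarrow> P \<epsilon> a \<longleftrightarrow> P (\<epsilon> * s a) (\<tau> a);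
       \<epsilon> \<in> {1, -1}; \<delta> \<in> {1, -1}; a < n; b < n; P \<epsilon> a\<rbrakk> \<Longrightarrow> P \<delta> b"
  shows "signed_cycle A n e s \<tau>"
  unfolding signed_cycle_def
proof (intro conjI allI impI ballI)
  fix P :: "int \<Rightarrow> nat \<Rightarrow> bool" and \<epsilon> \<delta> :: int and a b
  assume "\<forall>\<epsilon>\<in>{1, -1}. \<forall>a<n. P \<epsilon> a \<longleftrightarrow> P (\<epsilon> * s a) (\<tau> a)"
    and "\<epsilon> \<in> {1, -1}" "\<delta> \<in> {1, -1}" "a < n" "b < n" "P \<epsilon> a"
  then show "P \<delta> b"
    by (intro assms(4)[where P = P and \<epsilon> = \<epsilon> and \<delta> = \<delta> and a = a and b = b]) blast+
qed (use assms(1-3) in auto)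

lemma signed_cycleD:
  assumes "signed_cycle A n e s \<tau>"
  shows "n > 0" "signed_perm_mat A n s \<tau>"
    "a < n \<Longrightarrow> (signed_step s \<tau> ^^ e) (\<epsilon>, a) = (\<epsilon>, a)"
  using assms unfolding signed_cycle_def by blast+

lemma signed_cycle_transitive:
  assumes "signed_cycle A n e s \<tau>"
    and "\<And>\<epsilon> a. \<lbrakk>\<epsilon> \<in> {1, -1}; a < n\<rbrakk> \<Longrightarrow> P \<epsilon> a \<longleftrightarrow> P (\<epsilon> * s a) (\<tau> a)"
    and "\<epsilon> \<in> {1, -1}" "\<delta> \<in> {1, -1}" "a < n" "b < n" "P \<epsilon> a"
  shows "P \<delta> b"
proof -
  have "\<forall>P. (\<forall>\<epsilon>\<in>{1, -1}. \<forall>a<n. P \<epsilon> a \<longleftrightarrow> P (\<epsilon> * s a) (\<tau> a)) \<longrightarrow>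
          (\<forall>\<epsilon>\<in>{1, -1}. \<forall>\<delta>\<in>{1, -1}. \<forall>a<n. \<forall>b<n. P \<epsilon> a \<longrightarrow> P \<delta> b)"
    using assms(1) unfolding signed_cycle_def by (elim conjE)
  from spec[OF this, of P] show ?thesis
    using assms(2-) by blast
qed

text \<open>A semiconjugacy on an invariant set. It transfers the powers of a block's step to the
  larger matrix, with \<open>h\<close> the identity or a shift of indices.\<close>

lemma funpow_conj:
  assumes "\<And>x. x \<in> X \<Longrightarrow> g x \<in> X \<and> f (h x) = h (g x)" "x \<in> X"
  shows "(f ^^ m) (h x) = h ((g ^^ m) x) \<and> (g ^^ m) x \<in> X"
  by (induction m) (use assms in auto)

lemma funpow_fixed_mult: "(f ^^ m) x = x \<Longrightarrow> (f ^^ (k * m)) x = x"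
  by (induction k) (auto simp: funpow_add)

text \<open>Row \<open>a > 0\<close> has its entry in column \<open>a - 1\<close>, and row 0 has -1
  in the last column. So the step walks down the indices and reverses the sign once per turn: the
  power \<open>2 ^ i\<close> is minus the identity, whence the order
  \<open>2 ^ Suc i\<close>.\<close>

lemma signed_cycle_C_mat:
  "\<exists>s \<tau>. signed_cycle (C_mat i) (2 ^ i) (2 ^ Suc i) s \<tau>"
proof -
  let ?L = "2 ^ i :: nat"
  define \<tau> where "\<tau> = (\<lambda>a. if a = 0 then ?L - 1 else a - 1)"
  define s where "s = (\<lambda>a :: nat. if a = 0 then -1 else 1 :: int)"
  have L: "?L > 0" by simp
  have down: "(signed_step s \<tau> ^^ m) (\<epsilon>, a) = (\<epsilon>, a - m)" if "m \<le> a" for m a \<epsilon>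
    using that by (induction m) (auto simp: s_def \<tau>_def)
  have half: "(signed_step s \<tau> ^^ ?L) (\<epsilon>, a) = (- \<epsilon>, a)" if "a < ?L" for \<epsilon> a
  proof -
    \<comment> \<open>A full turn is cut after the sign change: \<open>Suc a\<close> steps lead to
      the last index, the remaining ones down to \<open>a\<close>.\<close>
    have "?L = (?L - 1 - a) + Suc a" using that by simp
    then have "(signed_step s \<tau> ^^ ?L) (\<epsilon>, a) =
        (signed_step s \<tau> ^^ (?L - 1 - a)) ((signed_step s \<tau> ^^ Suc a) (\<epsilon>, a))"
      by (metis comp_apply funpow_add)
    also have "(signed_step s \<tau> ^^ Suc a) (\<epsilon>, a) = (- \<epsilon>, ?L - 1)"
      using down[of a a \<epsilon>] by (simp add: s_def \<tau>_def)
    also have "(signed_step s \<tau> ^^ (?L - 1 - a)) (- \<epsilon>, ?L - 1) = (- \<epsilon>, a)"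
      using down[of "?L - 1 - a" "?L - 1"] that by simp
    finally show ?thesis .
  qed
  have "signed_cycle (C_mat i) ?L (2 ^ Suc i) s \<tau>"
  proof (rule signed_cycleI)
    show "signed_perm_mat (C_mat i) ?L s \<tau>"
      unfolding signed_perm_mat_def C_mat_def by (auto simp: s_def \<tau>_def)
    show "(signed_step s \<tau> ^^ 2 ^ Suc i) (\<epsilon>, a) = (\<epsilon>, a)" if "a < ?L" for \<epsilon> a
    proof -
      have "(2::nat) ^ Suc i = ?L + ?L" by simp
      then show ?thesis
        using half that by (simp only: funpow_add comp_apply minus_minus)
    qed
    fix P :: "int \<Rightarrow> nat \<Rightarrow> bool" and \<epsilon> \<delta> :: int and a b :: nat
    assume P: "\<And>\<epsilon> a. \<lbrakk>\<epsilon> \<in> {1, -1}; a < ?L\<rbrakk> \<Longrightarrow> P \<epsilon> a \<longleftrightarrow> P (\<epsilon> * s a) (\<tau> a)"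
      and ab: "\<epsilon> \<in> {1, -1}" "\<delta> \<in> {1, -1}" "a < ?L" "b < ?L" "P \<epsilon> a"
    have z: "P \<epsilon> a \<longleftrightarrow> P \<epsilon> 0" if "\<epsilon> \<in> {1, -1}" "a < ?L" for \<epsilon> a
      using that(2)
    proof (induction a)
      case (Suc a)
      then show ?case
        using P[OF that(1) Suc.prems] by (simp add: s_def \<tau>_def)
    qed simp
    \<comment> \<open>The step from index 0 to the last index is the only one that changes the sign,
      so it links the two signs.\<close>
    have neg: "P \<epsilon> 0 \<longleftrightarrow> P (- \<epsilon>) 0" if "\<epsilon> \<in> {1, -1}" for \<epsilon>
      using P[OF that L] z[of "- \<epsilon>" "?L - 1"] that by (auto simp: s_def \<tau>_def)
    show "P \<delta> b"
      using z neg ab by (metis insertE insert_absorb insert_not_empty minus_minus)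
  qed simp
  then show ?thesis by blast
qed

text \<open>The square of the matrix at \<open>Suc i\<close> is block-diagonal with two copies of
  \<open>J_mat i\<close>. This doubles the order, and an invariant predicate restricted to the first
  half is invariant for \<open>J_mat i\<close>.\<close>

lemma signed_cycle_J_mat:
  "\<exists>s \<tau>. signed_cycle (J_mat i) (2 ^ i) (2 ^ Suc i) s \<tau>"
proof (induction i)
  case 0
  have "signed_cycle (J_mat 0) 1 2 (\<lambda>_. -1) (\<lambda>_. 0)"
  proof (rule signed_cycleI)
    fix P :: "int \<Rightarrow> nat \<Rightarrow> bool" and \<epsilon> \<delta> :: int and a b :: nat
    assume P: "\<And>\<epsilon> a. \<lbrakk>\<epsilon> \<in> {1, -1}; a < 1\<rbrakk> \<Longrightarrow> P \<epsilon> a \<longleftrightarrow> P (\<epsilon> * (-1)) 0"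
      and ab: "\<epsilon> \<in> {1, -1}" "\<delta> \<in> {1, -1}" "a < 1" "b < 1" "P \<epsilon> a"
    show "P \<delta> b"
      using P[of 1 0] P[of "-1" 0] ab by auto
  qed (auto simp: signed_perm_mat_def numeral_2_eq_2)
  then show ?case by (auto simp: numeral_2_eq_2)
next
  case (Suc i)
  let ?h = "2 ^ i :: nat"
  obtain s \<tau> where IH: "signed_cycle (J_mat i) ?h (2 ^ Suc i) s \<tau>"
    using Suc by blast
  note c = signed_cycleD[OF IH] and p = signed_perm_matD[OF signed_cycleD(2)[OF IH]]
  define \<tau>' where "\<tau>' = (\<lambda>a. if a < ?h then ?h + \<tau> a else a - ?h)"
  define s' where "s' = (\<lambda>a. if a < ?h then s a else 1)"
  let ?st = "signed_step s \<tau>" and ?st' = "signed_step s' \<tau>'"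
  have lo: "(?st' ^^ 2) (\<epsilon>, a) = ?st (\<epsilon>, a)" if "a < ?h" for \<epsilon> a
    using that p(2)[OF that] by (simp add: numeral_2_eq_2 s'_def \<tau>'_def)
  have hi: "(?st' ^^ 2) (\<epsilon>, ?h + a) = (\<epsilon> * s a, ?h + \<tau> a)" if "a < ?h" for \<epsilon> a
    using that p(2)[OF that] by (simp add: numeral_2_eq_2 s'_def \<tau>'_def)
  have lo': "((?st' ^^ 2) ^^ m) (\<epsilon>, a) = (?st ^^ m) (\<epsilon>, a)" if "a < ?h" for m \<epsilon> a
    using funpow_conj[of "UNIV \<times> {..<?h}" ?st "?st' ^^ 2" "\<lambda>x. x" "(\<epsilon>, a)" m] that lo p(2)
    by auto
  have hi': "((?st' ^^ 2) ^^ m) (\<epsilon>, ?h + a) = apsnd ((+) ?h) ((?st ^^ m) (\<epsilon>, a))" if "a < ?h" for m \<epsilon> a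
    using funpow_conj[of "UNIV \<times> {..<?h}" ?st "?st' ^^ 2" "apsnd ((+) ?h)" "(\<epsilon>, a)" m] that hi p(2)
    by auto
  have "signed_cycle (J_mat (Suc i)) (2 ^ Suc i) (2 ^ Suc (Suc i)) s' \<tau>'"
  proof (rule signed_cycleI)
    show "signed_perm_mat (J_mat (Suc i)) (2 ^ Suc i) s' \<tau>'"
      unfolding signed_perm_mat_def
    proof (intro conjI allI impI)
      show "J_mat (Suc i) \<in> carrier_mat (2 ^ Suc i) (2 ^ Suc i)"
        by (rule J_mat_carrier)
      fix a :: nat assume a: "a < 2 ^ Suc i"
      then have a': "a < ?h + ?h" by simp
      show "\<tau>' a < 2 ^ Suc i" "s' a \<in> {1, -1}"
        using a p(2)[of a] p(3)[of a] by (auto simp: \<tau>'_def s'_def)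
      fix b :: nat assume b: "b < 2 ^ Suc i"
      have "J_mat (Suc i) $$ (a, b) =
          (if a < ?h then if b < ?h then 0 else J_mat i $$ (a, b - ?h)
           else if b < ?h then (if a - ?h = b then 1 else 0) else 0)"
        using a b p(1) by (auto simp: index_mat_four_block)
      also have "\<dots> = (if b = \<tau>' a then s' a else 0)"
        using a b p(2)[of a] p(4)[of a "b - ?h"] by (auto simp: \<tau>'_def s'_def)
      finally show "J_mat (Suc i) $$ (a, b) = (if b = \<tau>' a then s' a else 0)" .
    qed
    show "(?st' ^^ 2 ^ Suc (Suc i)) (\<epsilon>, a) = (\<epsilon>, a)" if a: "a < 2 ^ Suc i" for \<epsilon> a
    proof -
      have e: "?st' ^^ 2 ^ Suc (Suc i) = (?st' ^^ 2) ^^ (2 ^ Suc i)"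
        by (simp add: funpow_mult mult.commute)
      show ?thesis
      proof (cases "a < ?h")
        case True
        then show ?thesis
          unfolding e using lo' c(3) by simp
      next
        case False
        then have "a = ?h + (a - ?h)" "a - ?h < ?h" using a by auto
        then show ?thesis
          unfolding e using hi'[of "a - ?h" "2 ^ Suc i" \<epsilon>] c(3)[of "a - ?h" \<epsilon>] by simp
      qed
    qed
    fix P :: "int \<Rightarrow> nat \<Rightarrow> bool" and \<epsilon> \<delta> :: int and a b :: nat
    assume P: "\<And>\<epsilon> a. \<lbrakk>\<epsilon> \<in> {1, -1}; a < 2 ^ Suc i\<rbrakk> \<Longrightarrow> P \<epsilon> a \<longleftrightarrow> P (\<epsilon> * s' a) (\<tau>' a)"
      and ab: "\<epsilon> \<in> {1, -1}" "\<delta> \<in> {1, -1}" "a < 2 ^ Suc i" "b < 2 ^ Suc i" "P \<epsilon> a"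
    have up: "P \<epsilon> (?h + a) \<longleftrightarrow> P \<epsilon> a" if "\<epsilon> \<in> {1, -1}" "a < ?h" for \<epsilon> a
      using P[of \<epsilon> "?h + a"] that by (simp add: s'_def \<tau>'_def)
    have inv: "P \<epsilon> a \<longleftrightarrow> P (\<epsilon> * s a) (\<tau> a)" if "\<epsilon> \<in> {1, -1}" "a < ?h" for \<epsilon> a
      using P[of \<epsilon> a] up[of "\<epsilon> * s a" "\<tau> a"] that p(2,3)[OF that(2)] by (auto simp: s'_def \<tau>'_def)
    \<comment> \<open>The identity block ties each index of the second half to the corresponding one
      of the first, so transitivity is only an issue there.\<close>
    have red: "P \<epsilon> a \<longleftrightarrow> P \<epsilon> (a mod ?h)" if "\<epsilon> \<in> {1, -1}" "a < 2 ^ Suc i" for \<epsilon> a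
    proof (cases "a < ?h")
      case False
      then have "a = ?h + (a - ?h)" "a - ?h < ?h" using that by auto
      then have "a mod ?h = a - ?h"
        by (metis mod_add_self1 mod_less)
      then show ?thesis
        using up[of \<epsilon> "a - ?h"] that False by simp
    qed simp
    have "P \<epsilon> (a mod ?h)" using red[OF ab(1,3)] ab(5) by blast
    then have "P \<delta> (b mod ?h)"
      by (intro signed_cycle_transitive[OF IH, where P = P and \<epsilon> = \<epsilon> and \<delta> = \<delta> and a = "a mod ?h" and b = "b mod ?h"])
        (use inv ab in auto)
    then show "P \<delta> b" using red[OF ab(2,4)] by blast
  qed simp
  then show ?case by blast
qed

text \<open>The last index \<open>N\<close> of the \<open>N + 1\<close> coordinates is fixed by \<open>\<tau>\<close> and belongs to no block; \<open>\<beta>\<close> labels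
  the \<open>S\<close> blocks on the indices below \<open>N\<close>, and \<open>e\<close> is any multiple of the order.\<close>

locale signed_blocks =
  fixes N S e :: nat and s :: "nat \<Rightarrow> int" and \<tau> :: "nat \<Rightarrow> nat" and \<beta> :: "nat \<Rightarrow> nat"
  assumes e_pos: "e > 0"
    and tau_less: "a < N \<Longrightarrow> \<tau> a < N" and tau_id: "a \<ge> N \<Longrightarrow> \<tau> a = a"
    and sign: "s a \<in> {1, -1}" and sign_id: "a \<ge> N \<Longrightarrow> s a = 1"
    and order: "(signed_step s \<tau> ^^ e) (\<epsilon>, a) = (\<epsilon>, a)"
    and block_less: "a < N \<Longrightarrow> \<beta> a < S" and block_tau: "a < N \<Longrightarrow> \<beta> (\<tau> a) = \<beta> a"
    and block_onto: "j < S \<Longrightarrow> \<exists>a<N. \<beta> a = j"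
    and block_transitive:
      "\<lbrakk>\<And>\<epsilon> a. \<lbrakk>\<epsilon> \<in> {1, -1}; a < N\<rbrakk> \<Longrightarrow> P \<epsilon> a \<longleftrightarrow> P (\<epsilon> * s a) (\<tau> a);
        \<epsilon> \<in> {1, -1}; \<delta> \<in> {1, -1}; a < N; b < N; \<beta> a = \<beta> b; P \<epsilon> a\<rbrakk> \<Longrightarrow> P \<delta> b"

text \<open>Blocks are prepended: the new one takes the indices below \<open>L\<close> and the label
  0, while older indices move up by \<open>L\<close> and older labels by 1. This keeps the final
  entry 1 at the last index. The orders of the blocks differ, hence the common multiple
  \<open>e\<close>.\<close>

lemma signed_blocks_diag_block_mat:
  assumes "e > 0" "\<And>A. A \<in> set As \<Longrightarrow> \<exists>n e' s \<tau>. signed_cycle A n e' s \<tau> \<and> e' dvd e"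
  shows "\<exists>N s \<tau> \<beta>. signed_blocks N (length As) e s \<tau> \<beta> \<and>
           signed_perm_mat (diag_block_mat (As @ [1\<^sub>m 1])) (Suc N) s \<tau>"
  using assms(2)
proof (induction As)
  case Nil
  have "signed_blocks 0 0 e (\<lambda>_. 1) (\<lambda>a. a) (\<lambda>_. 0)"
  proof
    have "signed_step (\<lambda>_. 1) (\<lambda>a. a) = (\<lambda>x. x)"
      by (auto simp: signed_step_def)
    moreover have "((\<lambda>x. x) ^^ e) (\<epsilon>, a) = (\<epsilon>, a)" for \<epsilon> :: int and a :: nat
      by (induction e) auto
    ultimately show "(signed_step (\<lambda>_. 1) (\<lambda>a. a) ^^ e) (\<epsilon>, a) = (\<epsilon>, a)" for \<epsilon> a
      by simp
  qed (use assms(1) in auto)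
  moreover have "signed_perm_mat (diag_block_mat ([] @ [1\<^sub>m 1])) (Suc 0) (\<lambda>_. 1) (\<lambda>a. a)"
    by (auto simp: signed_perm_mat_def)
  ultimately show ?case by force
next
  case (Cons A As)
  obtain N s \<tau> \<beta> where b: "signed_blocks N (length As) e s \<tau> \<beta>"
    and p: "signed_perm_mat (diag_block_mat (As @ [1\<^sub>m 1])) (Suc N) s \<tau>"
    using Cons.IH Cons.prems by auto
  have "\<exists>n e' s \<tau>. signed_cycle A n e' s \<tau> \<and> e' dvd e"
    by (rule Cons.prems) simp
  then obtain L e' t \<sigma> where cyc: "signed_cycle A L e' t \<sigma>" and e': "e' dvd e"
    by blast
  interpret b: signed_blocks N "length As" e s \<tau> \<beta> by (rule b)
  note c = signed_cycleD[OF cyc] and q = signed_perm_matD[OF signed_cycleD(2)[OF cyc]]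
  note p = signed_perm_matD[OF p]
  define \<tau>' where "\<tau>' = (\<lambda>a. if a < L then \<sigma> a else L + \<tau> (a - L))"
  define s' where "s' = (\<lambda>a. if a < L then t a else s (a - L))"
  define \<beta>' where "\<beta>' = (\<lambda>a. if a < L then 0 else Suc (\<beta> (a - L)))"
  let ?st' = "signed_step s' \<tau>'"
  have lo: "(?st' ^^ m) (\<epsilon>, a) = (signed_step t \<sigma> ^^ m) (\<epsilon>, a)" if "a < L" for m \<epsilon> a
    using funpow_conj[of "UNIV \<times> {..<L}" "signed_step t \<sigma>" ?st' "\<lambda>x. x" "(\<epsilon>, a)" m] that q(2)
    by (auto simp: \<tau>'_def s'_def)
  have hi: "(?st' ^^ m) (\<epsilon>, L + a) = apsnd ((+) L) ((signed_step s \<tau> ^^ m) (\<epsilon>, a))" for m \<epsilon> a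
    using funpow_conj[of UNIV "signed_step s \<tau>" ?st' "apsnd ((+) L)" "(\<epsilon>, a)" m]
    by (auto simp: \<tau>'_def s'_def)
  have \<sigma>: "\<sigma> a < L + N" if "a < L" for a
    using q(2)[OF that] by simp
  have "signed_blocks (L + N) (length (A # As)) e s' \<tau>' \<beta>'"
  proof
    show "(?st' ^^ e) (\<epsilon>, a) = (\<epsilon>, a)" for \<epsilon> a
    proof (cases "a < L")
      case True
      obtain k where "e = k * e'" using e' by (metis dvd_def mult.commute)
      then have "(signed_step t \<sigma> ^^ e) (\<epsilon>, a) = (\<epsilon>, a)"
        using funpow_fixed_mult c(3)[OF True] by metis
      then show ?thesis using lo[OF True] by simp
    next
      case False
      then show ?thesis
        using hi[of e \<epsilon> "a - L"] b.order by simp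
    qed
    show "\<exists>a<L + N. \<beta>' a = j" if "j < length (A # As)" for j
    proof (cases j)
      case 0
      then show ?thesis using c(1) by (intro exI[of _ 0]) (simp add: \<beta>'_def)
    next
      case (Suc i)
      then obtain a where "a < N" "\<beta> a = i" using b.block_onto[of i] \<open>j < _\<close> by auto
      then show ?thesis using Suc by (intro exI[of _ "L + a"]) (simp add: \<beta>'_def)
    qed
    fix P :: "int \<Rightarrow> nat \<Rightarrow> bool" and \<epsilon> \<delta> :: int and x y :: nat
    assume P: "\<And>\<epsilon> a. \<lbrakk>\<epsilon> \<in> {1, -1}; a < L + N\<rbrakk> \<Longrightarrow> P \<epsilon> a \<longleftrightarrow> P (\<epsilon> * s' a) (\<tau>' a)"
      and xy: "\<epsilon> \<in> {1, -1}" "\<delta> \<in> {1, -1}" "x < L + N" "y < L + N" "\<beta>' x = \<beta>' y" "P \<epsilon> x"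
    show "P \<delta> y"
    proof (cases "x < L")
      case True
      then have "y < L" using xy by (auto simp: \<beta>'_def split: if_splits)
      have "P \<epsilon> a \<longleftrightarrow> P (\<epsilon> * t a) (\<sigma> a)" if "\<epsilon> \<in> {1, -1}" "a < L" for \<epsilon> a
        using P[of \<epsilon> a] that by (simp add: s'_def \<tau>'_def)
      from signed_cycle_transitive[OF cyc, of P, OF this xy(1,2) True \<open>y < L\<close> xy(6)] show ?thesis by blast
    next
      case False
      then have y: "\<not> y < L" using xy by (auto simp: \<beta>'_def split: if_splits)
      have "P \<epsilon> (L + a) \<longleftrightarrow> P (\<epsilon> * s a) (L + \<tau> a)" if "\<epsilon> \<in> {1, -1}" "a < N" for \<epsilon> a
        using P[of \<epsilon> "L + a"] that by (simp add: s'_def \<tau>'_def)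
      from b.block_transitive[of "\<lambda>\<epsilon> a. P \<epsilon> (L + a)", OF this xy(1,2), of "x - L" "y - L"]
      show ?thesis using xy y False by (simp add: \<beta>'_def)
    qed
  qed (use b.e_pos b.tau_less b.tau_id b.sign b.sign_id b.block_less b.block_tau q(2,3) \<sigma>
       in \<open>auto simp: \<tau>'_def s'_def \<beta>'_def\<close>)
  moreover have "signed_perm_mat (diag_block_mat ((A # As) @ [1\<^sub>m 1])) (Suc (L + N)) s' \<tau>'"
    unfolding signed_perm_mat_def
  proof (intro conjI allI impI)
    let ?D = "diag_block_mat (As @ [1\<^sub>m 1])"
    have D: "diag_block_mat ((A # As) @ [1\<^sub>m 1]) = four_block_mat A (0\<^sub>m L (Suc N)) (0\<^sub>m (Suc N) L) ?D"
      using q(1) p(1) by (simp add: Let_def)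
    show "diag_block_mat ((A # As) @ [1\<^sub>m 1]) \<in> carrier_mat (Suc (L + N)) (Suc (L + N))"
      using four_block_carrier_mat[OF q(1) p(1)] unfolding D by simp
    fix a :: nat assume a: "a < Suc (L + N)"
    show "\<tau>' a < Suc (L + N)" "s' a \<in> {1, -1}"
      using a q(2,3)[of a] p(2,3)[of "a - L"] by (auto simp: \<tau>'_def s'_def)
    fix b :: nat assume bb: "b < Suc (L + N)"
    have "diag_block_mat ((A # As) @ [1\<^sub>m 1]) $$ (a, b) =
       (if a < L then if b < L then A $$ (a, b) else 0 else if b < L then 0 else ?D $$ (a - L, b - L))"
      unfolding D using a bb q(1) p(1) by (auto simp: index_mat_four_block)
    also have "\<dots> = (if b = \<tau>' a then s' a else 0)"
      using a bb q(2)[of a] q(4)[of a b] p(4)[of "a - L" "b - L"] by (auto simp: \<tau>'_def s'_def)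
    finally show "diag_block_mat ((A # As) @ [1\<^sub>m 1]) $$ (a, b) = (if b = \<tau>' a then s' a else 0)" .
  qed
  ultimately show ?case by blast
qed

section \<open>The lattice group\<close>

context signed_blocks
begin

text \<open>Forgetting signs, the order condition says that \<open>\<tau> ^^ e\<close> is the
  identity, so \<open>\<tau> ^^ (e - 1)\<close> is a left inverse.\<close>

lemma tau_inj: "inj \<tau>"
proof (rule injI)
  fix a b assume eq: "\<tau> a = \<tau> b"
  have snd_step: "snd ((signed_step s \<tau> ^^ m) (\<epsilon>, a)) = (\<tau> ^^ m) a" for m \<epsilon> a
    by (induction m) (auto simp: signed_step_def split_beta)
  have tau_e: "(\<tau> ^^ e) a = a" for a
    using snd_step[of e 1 a] order by simp
  have "(\<tau> ^^ e) c = (\<tau> ^^ (e - 1)) (\<tau> c)" for c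
    using e_pos by (metis Suc_diff_1 comp_apply funpow_Suc_right)
  then show "a = b"
    using eq tau_e by metis
qed

lemma tau_bij_n: "bij_betw \<tau> {..<Suc N} {..<Suc N}"
proof -
  have "\<tau> a < Suc N" if "a < Suc N" for a
    using that tau_less[of a] tau_id[of a] by (cases "a < N") auto
  then have "\<tau> ` {..<Suc N} = {..<Suc N}"
    using tau_inj by (intro endo_inj_surj) (auto intro: inj_on_subset)
  then show ?thesis
    using tau_inj by (auto simp: bij_betw_def intro: inj_on_subset)
qed

lemma tau_bij_block: "bij_betw \<tau> {i. i < N \<and> \<beta> i = j} {i. i < N \<and> \<beta> i = j}"
proof -
  have "\<tau> ` {i. i < N \<and> \<beta> i = j} = {i. i < N \<and> \<beta> i = j}"
    using tau_inj tau_less block_tau by (intro endo_inj_surj) (auto intro: inj_on_subset)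
  then show ?thesis
    using tau_inj by (auto simp: bij_betw_def intro: inj_on_subset)
qed

lemma sign_sq: "s a * s a = 1"
  using sign[of a] by auto

text \<open>The induction removes a pair of signed unit vectors supported in one block.\<close>

lemma invariant_hom_trivial:
  fixes W :: "('w, 'm) monoid_scheme"
  assumes W: "comm_group W" and gc: "\<And>z. g z \<in> carrier W"
    and add: "\<And>z z'. g (\<lambda>i. z i + z' i) = g z \<otimes>\<^bsub>W\<^esub> g z'"
    and inv: "\<And>z. g (\<lambda>i. s i * z (\<tau> i)) = g z"
    and supp: "\<And>i. i \<ge> N \<Longrightarrow> z i = 0"
    and even: "\<And>j. j < S \<Longrightarrow> even (\<Sum>i | i < N \<and> \<beta> i = j. z i)"
  shows "g z = \<one>\<^bsub>W\<^esub>"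
proof -
  interpret W: comm_group W by (rule W)
  define u :: "int \<Rightarrow> nat \<Rightarrow> nat \<Rightarrow> int" where "u = (\<lambda>\<epsilon> a i. if i = a then \<epsilon> else 0)"
  have g0: "g (\<lambda>_. 0) = \<one>\<^bsub>W\<^esub>"
  proof -
    have "g (\<lambda>_. 0) \<otimes>\<^bsub>W\<^esub> g (\<lambda>_. 0) = g (\<lambda>_. 0)"
      using add[of "\<lambda>_. 0" "\<lambda>_. 0"] by simp
    then show ?thesis
      using gc W.r_cancel_one by blast
  qed
  \<comment> \<open>Unit vectors behave like signed basis vectors under the matrix; injectivity of
    \<open>\<tau>\<close> leaves only the entry \<open>a\<close>, and the sign squares to 1.\<close>
  have step: "g (u \<epsilon> a) = g (u (\<epsilon> * s a) (\<tau> a))" for \<epsilon> a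
  proof -
    have "(\<lambda>i. s i * u (\<epsilon> * s a) (\<tau> a) (\<tau> i)) = u \<epsilon> a"
      using tau_inj sign_sq[of a] by (auto simp: u_def fun_eq_iff inj_eq)
    then show ?thesis
      using inv[of "u (\<epsilon> * s a) (\<tau> a)"] by simp
  qed
  have same: "g (u \<delta> b) = g (u \<epsilon> a)"
    if "\<epsilon> \<in> {1, -1}" "\<delta> \<in> {1, -1}" "a < N" "b < N" "\<beta> a = \<beta> b" for \<epsilon> \<delta> a b
    using block_transitive[of "\<lambda>\<delta> b. g (u \<delta> b) = g (u \<epsilon> a)" \<epsilon> \<delta> a b] that step by simp
  \<comment> \<open>By transitivity the second vector may be replaced by minus the first: the common
    class of a block equals its own inverse.\<close>
  have pair: "g (u \<epsilon> a) \<otimes>\<^bsub>W\<^esub> g (u \<delta> b) = \<one>\<^bsub>W\<^esub>"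
    if "\<epsilon> \<in> {1, -1}" "\<delta> \<in> {1, -1}" "a < N" "b < N" "\<beta> a = \<beta> b" for \<epsilon> \<delta> a b
  proof -
    have "- \<epsilon> \<in> {1, -1}" using that by auto
    then have "g (u \<delta> b) = g (u (- \<epsilon>) a)"
      using same[of \<delta> "- \<epsilon>" b a] that by simp
    then have "g (u \<epsilon> a) \<otimes>\<^bsub>W\<^esub> g (u \<delta> b) = g (\<lambda>i. u \<epsilon> a i + u (- \<epsilon>) a i)"
      by (simp add: add)
    also have "(\<lambda>i. u \<epsilon> a i + u (- \<epsilon>) a i) = (\<lambda>_. 0)"
      by (auto simp: u_def)
    finally show ?thesis using g0 by simp
  qed
  have "g z = \<one>\<^bsub>W\<^esub>" if "(\<Sum>i<N. nat \<bar>z i\<bar>) = k" "\<And>i. i \<ge> N \<Longrightarrow> z i = 0"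
    "\<And>j. j < S \<Longrightarrow> even (\<Sum>i | i < N \<and> \<beta> i = j. z i)" for z k
    using that
  proof (induction k arbitrary: z rule: less_induct)
    case (less k)
    show ?case
    proof (cases "\<forall>i<N. z i = 0")
      case True
      then have "z = (\<lambda>_. 0)"
        using less.prems(2) by (auto simp: fun_eq_iff) (metis linorder_not_le)
      then show ?thesis using g0 by simp
    next
      case False
      then obtain a where a: "a < N" "z a \<noteq> 0" by blast
      have u_sum: "(\<Sum>i | i < N \<and> \<beta> i = j. u \<epsilon> b i) = (if \<beta> b = j then \<epsilon> else 0)" if "b < N" for \<epsilon> b j
        using that by (simp add: u_def)
      have dec: "(\<Sum>i<N. nat \<bar>x i - u (sgn (x b)) b i\<bar>) < (\<Sum>i<N. nat \<bar>x i\<bar>)"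
        if "b < N" "x b \<noteq> 0" for x b
        using that by (intro sum_strict_mono_ex1) (auto simp: u_def sgn_if)
      have sg: "sgn c \<in> {1, -1}" if "c \<noteq> 0" for c :: int
        using that by (auto simp: sgn_if)
      \<comment> \<open>Removing one unit makes the block sum odd, so a nonzero entry
        \<open>b\<close> remains in the same block, possibly at \<open>a\<close> itself. Removing a
        unit there restores the parity, and the signs ensure that the l1 norm drops.\<close>
      define y where "y = (\<lambda>i. z i - u (sgn (z a)) a i)"
      have "odd (\<Sum>i | i < N \<and> \<beta> i = \<beta> a. y i)"
        using less.prems(3)[OF block_less[OF a(1)]] sg[OF a(2)] u_sum[OF a(1)]
        by (auto simp: y_def sum_subtractf)
      then obtain b where b: "b < N" "\<beta> b = \<beta> a" "y b \<noteq> 0"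
        by (metis (mono_tags, lifting) even_zero mem_Collect_eq sum.neutral)
      define x where "x = (\<lambda>i. y i - u (sgn (y b)) b i)"
      have "(\<Sum>i<N. nat \<bar>x i\<bar>) < k"
        using dec[of b y, OF b(1,3)] dec[of a z, OF a] less.prems(1) by (simp add: x_def y_def)
      moreover have "x i = 0" if "i \<ge> N" for i
        using that less.prems(2) a(1) b(1) by (auto simp: x_def y_def u_def)
      moreover have "even (\<Sum>i | i < N \<and> \<beta> i = j. x i)" if "j < S" for j
        using less.prems(3)[OF that] sg[OF a(2)] sg[OF b(3)] b(2) u_sum[OF a(1)] u_sum[OF b(1)]
        by (auto simp: x_def y_def sum_subtractf)
      ultimately have gx: "g x = \<one>\<^bsub>W\<^esub>"
        by (intro less.IH[OF _ refl])
      have "z = (\<lambda>i. x i + (u (sgn (z a)) a i + u (sgn (y b)) b i))"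
        by (auto simp: x_def y_def)
      then have "g z = g x \<otimes>\<^bsub>W\<^esub> (g (u (sgn (z a)) a) \<otimes>\<^bsub>W\<^esub> g (u (sgn (y b)) b))"
        by (metis add)
      then show ?thesis
        using gx pair[OF sg[OF a(2)] sg[OF b(3)] a(1) b(1)] b(2) by simp
    qed
  qed
  then show ?thesis using supp even by blast
qed

text \<open>The linear map of the matrix whose row \<open>a\<close> is \<open>s a\<close> in column
  \<open>\<tau> a\<close>. It acts on all sequences and is the identity from index \<open>N\<close>
  on, so its powers preserve Euclidean space.\<close>

definition lin :: "(nat \<Rightarrow> real) \<Rightarrow> nat \<Rightarrow> real" where
  "lin x = (\<lambda>i. of_int (s i) * x (\<tau> i))"

abbreviation E :: "(nat \<Rightarrow> real) set" where
  "E \<equiv> topspace (Euclidean_space (Suc N))"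

text \<open>Row \<open>a\<close> of a matrix power is read off the iterated signed step; the factor
  \<open>\<epsilon>\<close> is carried along for the induction.\<close>

lemma lin_pow_step:
  "of_int \<epsilon> * (lin ^^ m) x a =
     of_int (fst ((signed_step s \<tau> ^^ m) (\<epsilon>, a))) * x (snd ((signed_step s \<tau> ^^ m) (\<epsilon>, a)))"
proof (induction m arbitrary: \<epsilon> a)
  case (Suc m)
  have "of_int \<epsilon> * (lin ^^ Suc m) x a = of_int (\<epsilon> * s a) * (lin ^^ m) x (\<tau> a)"
    by (simp add: lin_def)
  also have "\<dots> = of_int (fst ((signed_step s \<tau> ^^ m) (\<epsilon> * s a, \<tau> a))) *
      x (snd ((signed_step s \<tau> ^^ m) (\<epsilon> * s a, \<tau> a)))"
    by (rule Suc.IH)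
  also have "(signed_step s \<tau> ^^ m) (\<epsilon> * s a, \<tau> a) = (signed_step s \<tau> ^^ Suc m) (\<epsilon>, a)"
    by (simp add: funpow_swap1)
  finally show ?case .
qed simp

lemma lin_pow_order: "(lin ^^ e) x = x"
proof
  fix a
  show "(lin ^^ e) x a = x a"
    using lin_pow_step[of 1 e x a] order[of 1 a] by simp
qed

lemma lin_pow_dvd: "e dvd m \<Longrightarrow> (lin ^^ m) x = x"
  using funpow_fixed_mult[OF lin_pow_order] by (metis dvd_def mult.commute)

lemma lin_add: "(lin ^^ m) (\<lambda>i. x i + y i) = (\<lambda>i. (lin ^^ m) x i + (lin ^^ m) y i)"
  by (induction m) (auto simp: lin_def algebra_simps)

lemma lin_neg: "(lin ^^ m) (\<lambda>i. - x i) = (\<lambda>i. - (lin ^^ m) x i)"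
  by (induction m) (auto simp: lin_def algebra_simps)

lemma lin_zero: "(lin ^^ m) (\<lambda>_. 0) = (\<lambda>_. 0)"
  by (induction m) (auto simp: lin_def)

lemma lin_ge: "a \<ge> N \<Longrightarrow> (lin ^^ m) x a = x a"
  by (induction m) (auto simp: lin_def tau_id sign_id)

lemma lin_int: "(\<And>i. i < N \<Longrightarrow> x i \<in> \<int>) \<Longrightarrow> i < N \<Longrightarrow> (lin ^^ m) x i \<in> \<int>"
  by (induction m arbitrary: i) (auto simp: lin_def tau_less)

lemma lin_closed: "x \<in> E \<Longrightarrow> (lin ^^ m) x \<in> E"
  by (auto simp: topspace_Euclidean_space lin_ge)

lemma lin_isometric: "l1_dist (Suc N) ((lin ^^ m) x) ((lin ^^ m) y) = l1_dist (Suc N) x y"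
proof (induction m)
  case (Suc m)
  have "l1_dist (Suc N) (lin x) (lin y) = l1_dist (Suc N) x y" for x y
  proof -
    have "\<bar>of_int (s i) * x (\<tau> i) - of_int (s i) * y (\<tau> i)\<bar> = \<bar>x (\<tau> i) - y (\<tau> i)\<bar>" for i
      using sign[of i] by auto
    then have "l1_dist (Suc N) (lin x) (lin y) = (\<Sum>i<Suc N. \<bar>x (\<tau> i) - y (\<tau> i)\<bar>)"
      unfolding l1_dist_def lin_def by (intro sum.cong refl)
    also have "\<dots> = l1_dist (Suc N) x y"
      unfolding l1_dist_def by (rule sum.reindex_bij_betw[OF tau_bij_n])
    finally show ?thesis .
  qed
  then show ?case using Suc by simp
qed simp

definition aff :: "nat \<Rightarrow> (nat \<Rightarrow> real) \<Rightarrow> (nat \<Rightarrow> real) \<Rightarrow> nat \<Rightarrow> real" where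
  "aff m v = (\<lambda>x\<in>E. \<lambda>i. (lin ^^ m) x i + v i)"

text \<open>The group consists of maps \<open>aff m v\<close> in which the last entry of \<open>v\<close> determines \<open>m\<close> modulo \<open>e\<close>;
  this is why small displacement forces a pure translation.\<close>

definition adm :: "nat \<Rightarrow> (nat \<Rightarrow> real) \<Rightarrow> bool" where
  "adm m v \<longleftrightarrow> v \<in> E \<and> (\<forall>i<N. v i \<in> \<int>) \<and> v N - real m / real e \<in> \<int>"

section \<open>The group of admissible affine maps\<close>

lemma aff_closed: "\<lbrakk>v \<in> E; x \<in> E\<rbrakk> \<Longrightarrow> aff m v x \<in> E"
  using lin_closed[of x m] by (auto simp: aff_def topspace_Euclidean_space)

lemma aff_comp: "\<lbrakk>v' \<in> E; x \<in> E\<rbrakk> \<Longrightarrow>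
    aff m v (aff m' v' x) = aff (m + m') (\<lambda>i. (lin ^^ m) v' i + v i) x"
  using aff_closed[of v' x m'] lin_closed[of x m']
  by (auto simp: aff_def lin_add funpow_add)

lemma aff_id: "e dvd m \<Longrightarrow> aff m (\<lambda>_. 0) = (\<lambda>x\<in>E. x)"
  by (auto simp: aff_def lin_pow_dvd)

lemma adm_add:
  assumes "adm m v" "adm m' v'"
  shows "adm (m + m') (\<lambda>i. (lin ^^ m) v' i + v i)"
proof -
  have "(\<lambda>i. (lin ^^ m) v' i + v i) \<in> E"
    using assms lin_closed[of v' m] by (auto simp: adm_def topspace_Euclidean_space)
  moreover have "(lin ^^ m) v' i + v i \<in> \<int>" if "i < N" for i
    using assms lin_int[of v' i m] that by (auto simp: adm_def)
  moreover have eq: "(lin ^^ m) v' N + v N - real (m + m') / real e = (v N - real m / real e) + (v' N - real m' / real e)"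
    by (simp add: lin_ge add_divide_distrib)
  have "(lin ^^ m) v' N + v N - real (m + m') / real e \<in> \<int>"
    unfolding eq using assms by (intro Ints_add) (auto simp: adm_def)
  ultimately show ?thesis by (simp add: adm_def)
qed

lemma aff_inverse:
  assumes "adm m v"
  obtains m' v' where "adm m' v'" "\<And>x. x \<in> E \<Longrightarrow> aff m' v' (aff m v x) = x"
    "\<And>x. x \<in> E \<Longrightarrow> aff m v (aff m' v' x) = x"
proof -
  \<comment> \<open>Exponents are natural numbers, so \<open>m * (e - 1)\<close> stands for
    \<open>- m\<close> modulo \<open>e\<close>.\<close>
  define m' where "m' = m * (e - 1)"
  define v' where "v' = (\<lambda>i. - (lin ^^ m') v i)"
  have mm: "m + m' = m * e" "m' + m = m * e"
    using e_pos by (simp_all add: m'_def algebra_simps)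
  have vE: "v \<in> E" using assms by (simp add: adm_def)
  have v'E: "v' \<in> E"
    using lin_closed[OF vE, of m'] by (auto simp: v'_def topspace_Euclidean_space)
  have cancel: "(lin ^^ m) ((lin ^^ m') v) = v"
  proof -
    have "(lin ^^ m) ((lin ^^ m') v) = (lin ^^ (m + m')) v"
      by (simp add: funpow_add)
    then show ?thesis
      using lin_pow_dvd[of "m + m'" v] by (simp add: mm(1))
  qed
  show thesis
  proof
    have eq: "v' N - real m' / real e = - (v N - real m / real e) - real m"
      using e_pos by (simp add: v'_def lin_ge m'_def field_simps of_nat_diff)
    have "v N - real m / real e \<in> \<int>"
      using assms by (simp add: adm_def)
    then have "v' N - real m' / real e \<in> \<int>"
      unfolding eq by (rule Ints_diff[OF Ints_minus Ints_of_nat])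
    then show "adm m' v'"
      using v'E lin_int[of v _ m'] assms by (auto simp: adm_def v'_def)
    fix x assume x: "x \<in> E"
    have "(\<lambda>i. (lin ^^ m') v i + v' i) = (\<lambda>_. 0)" "(\<lambda>i. (lin ^^ m) v' i + v i) = (\<lambda>_. 0)"
      using cancel by (auto simp: v'_def lin_neg)
    then show "aff m' v' (aff m v x) = x" "aff m v (aff m' v' x) = x"
      using x by (simp_all add: aff_comp vE v'E mm aff_id)
  qed
qed

lemma aff_Bij: "adm m v \<Longrightarrow> aff m v \<in> Bij E"
proof -
  assume a: "adm m v"
  from aff_inverse[OF a] obtain m' v' where i: "adm m' v'" "\<And>x. x \<in> E \<Longrightarrow> aff m' v' (aff m v x) = x"
    "\<And>x. x \<in> E \<Longrightarrow> aff m v (aff m' v' x) = x" by metis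
  have "bij_betw (aff m v) E E"
    using a i aff_closed by (intro bij_betw_byWitness[of _ "aff m' v'"]) (auto simp: adm_def)
  then show ?thesis
    by (simp add: Bij_def aff_def)
qed

lemma aff_mult:
  assumes "adm m v" "adm m' v'"
  shows "aff m v \<otimes>\<^bsub>BijGroup E\<^esub> aff m' v' = aff (m + m') (\<lambda>i. (lin ^^ m) v' i + v i)"
proof -
  have "compose E (aff m v) (aff m' v') = aff (m + m') (\<lambda>i. (lin ^^ m) v' i + v i)"
  proof
    fix x
    show "compose E (aff m v) (aff m' v') x = aff (m + m') (\<lambda>i. (lin ^^ m) v' i + v i) x"
    proof (cases "x \<in> E")
      case True
      then show ?thesis
        using aff_comp[of v' x m v m'] assms(2) by (simp add: compose_eq adm_def)
    qed (simp add: compose_def aff_def)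
  qed
  then show ?thesis
    using assms aff_Bij by (simp add: BijGroup_def)
qed

text \<open>The generated group is given by generators only; containing it in a group with explicit
  elements provides a normal form.\<close>

definition affs :: "((nat \<Rightarrow> real) \<Rightarrow> nat \<Rightarrow> real) set" where
  "affs = {aff m v | m v. adm m v}"

lemma subgroup_affs: "subgroup affs (BijGroup E)"
proof -
  interpret group "BijGroup E" by (rule group_BijGroup)
  show ?thesis
  proof
    show "affs \<subseteq> carrier (BijGroup E)"
      using aff_Bij by (auto simp: affs_def BijGroup_def)
    show "x \<otimes>\<^bsub>BijGroup E\<^esub> y \<in> affs" if xy: "x \<in> affs" "y \<in> affs" for x y
    proof -
      obtain m v m' v' where "adm m v" "adm m' v'" "x = aff m v" "y = aff m' v'"
        using xy by (auto simp: affs_def)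
      then have "x \<otimes>\<^bsub>BijGroup E\<^esub> y = aff (m + m') (\<lambda>i. (lin ^^ m) v' i + v i)"
        "adm (m + m') (\<lambda>i. (lin ^^ m) v' i + v i)"
        using aff_mult adm_add by simp_all
      then show ?thesis
        unfolding affs_def by blast
    qed
    have "adm 0 (\<lambda>_. 0)"
      by (simp add: adm_def topspace_Euclidean_space)
    then show "\<one>\<^bsub>BijGroup E\<^esub> \<in> affs"
      using aff_id[of 0] by (auto simp: affs_def BijGroup_def intro!: exI[of _ 0] exI[of _ "\<lambda>_. 0"])
    show "inv\<^bsub>BijGroup E\<^esub> x \<in> affs" if xa: "x \<in> affs" for x
    proof -
      obtain m v where x: "adm m v" "x = aff m v"
        using xa by (auto simp: affs_def)
      from aff_inverse[OF x(1)] obtain m' v' where i: "adm m' v'"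
        "\<And>x. x \<in> E \<Longrightarrow> aff m' v' (aff m v x) = x" by metis
      have "compose E (aff m' v') (aff m v) = (\<lambda>x\<in>E. x)"
        using i(2) by (auto simp: compose_def)
      then have "aff m' v' \<otimes>\<^bsub>BijGroup E\<^esub> x = \<one>\<^bsub>BijGroup E\<^esub>"
        using aff_Bij[OF i(1)] aff_Bij[OF x(1)] by (simp add: BijGroup_def x(2))
      then have "inv\<^bsub>BijGroup E\<^esub> x = aff m' v'"
        using aff_Bij[OF i(1)] aff_Bij[OF x(1)] x(2) by (intro inv_equality) (simp_all add: BijGroup_def)
      then show ?thesis using i(1) by (auto simp: affs_def)
    qed
  qed
qed

text \<open>The generator translates before it applies the matrix; as the matrix fixes the last
  basis vector, the translation part is the same afterwards.\<close>

definition rot :: "(nat \<Rightarrow> real) \<Rightarrow> nat \<Rightarrow> real" where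
  "rot = aff 1 (\<lambda>i. if i = N then 1 / real e else 0)"

definition trans_vec :: "(nat \<Rightarrow> int) \<Rightarrow> nat \<Rightarrow> real" where
  "trans_vec z = (\<lambda>i. if i < Suc N then of_int (z i) else 0)"

definition transl :: "(nat \<Rightarrow> int) \<Rightarrow> (nat \<Rightarrow> real) \<Rightarrow> nat \<Rightarrow> real" where
  "transl z = aff 0 (trans_vec z)"

definition \<Gamma> :: "((nat \<Rightarrow> real) \<Rightarrow> nat \<Rightarrow> real) monoid" where
  "\<Gamma> = subgroup_generated (BijGroup E) (insert rot (range transl))"

section \<open>The generated group and its displacement bound\<close>

lemma adm_rot: "adm 1 (\<lambda>i. if i = N then 1 / real e else 0)"
  by (auto simp: adm_def topspace_Euclidean_space)

lemma adm_trans_vec: "adm 0 (trans_vec z)"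
  by (auto simp: adm_def topspace_Euclidean_space trans_vec_def)

lemma gens: "insert rot (range transl) \<subseteq> affs"
  unfolding affs_def rot_def transl_def using adm_rot adm_trans_vec by blast

lemma carrier_\<Gamma>: "carrier \<Gamma> \<subseteq> affs"
proof -
  interpret group "BijGroup E" by (rule group_BijGroup)
  have "generate (BijGroup E) (carrier (BijGroup E) \<inter> insert rot (range transl)) \<subseteq> affs"
    using gens by (intro generate_subgroup_incl subgroup_affs) auto
  then show ?thesis
    by (simp add: \<Gamma>_def carrier_subgroup_generated)
qed

lemma in_\<Gamma>: "rot \<in> carrier \<Gamma>" "transl z \<in> carrier \<Gamma>"
proof -
  have "insert rot (range transl) \<subseteq> carrier (BijGroup E)"
    using gens subgroup.subset[OF subgroup_affs] by blast
  then have "insert rot (range transl) \<subseteq> carrier \<Gamma>"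
    unfolding \<Gamma>_def carrier_subgroup_generated by (auto intro: generate.incl)
  then show "rot \<in> carrier \<Gamma>" "transl z \<in> carrier \<Gamma>" by auto
qed

lemma \<Gamma>_cases:
  assumes "\<gamma> \<in> carrier \<Gamma>"
  obtains m v where "adm m v" "\<gamma> = aff m v"
  using assms carrier_\<Gamma> by (auto simp: affs_def)

lemma mult_\<Gamma>: "\<gamma> \<otimes>\<^bsub>\<Gamma>\<^esub> \<delta> = \<gamma> \<otimes>\<^bsub>BijGroup E\<^esub> \<delta>"
  by (simp add: \<Gamma>_def)

lemma one_\<Gamma>: "\<one>\<^bsub>\<Gamma>\<^esub> = (\<lambda>x\<in>E. x)"
  by (simp add: \<Gamma>_def BijGroup_def)

lemma group_\<Gamma>: "group \<Gamma>"
  unfolding \<Gamma>_def by (rule group.group_subgroup_generated[OF group_BijGroup])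

lemma Ints_abs_less_1: "\<lbrakk>x \<in> \<int>; \<bar>x\<bar> < 1\<rbrakk> \<Longrightarrow> x = (0::real)"
  by (auto elim!: Ints_cases)

lemma adm_last:
  assumes "adm m v"
  obtains k :: int where "real e * v N = of_int (int m + int e * k)"
proof -
  obtain k :: int where "v N - real m / real e = of_int k"
    using assms by (auto simp: adm_def elim: Ints_cases)
  then have "real e * v N = of_int (int m + int e * k)"
    using e_pos by (simp add: field_simps)
  then show thesis by (rule that)
qed

lemma adm_last_zero: "\<lbrakk>adm m v; v N = 0\<rbrakk> \<Longrightarrow> e dvd m"
proof -
  assume "adm m v" "v N = 0"
  then obtain k :: int where "int m + int e * k = 0"
    by (metis adm_last mult_zero_right of_int_eq_0_iff)
  then have "int m = int e * (- k)" by simp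
  then have "int e dvd int m" by (rule dvdI)
  then show "e dvd m" by simp
qed

lemma aff_pure: "e dvd m \<Longrightarrow> aff m v = aff 0 v"
  by (auto simp: aff_def lin_pow_dvd)

lemma uniformly_free: "uniformly_free_action E (l1_dist (Suc N)) \<Gamma> (1 / real e)"
proof -
  interpret group \<Gamma> by (rule group_\<Gamma>)
  show ?thesis
  proof (intro uniformly_free_action.intro uniformly_free_action_axioms.intro)
    show "Metric_space E (l1_dist (Suc N))"
      by (rule l1.Metric_space_axioms)
    have "id \<in> hom \<Gamma> (BijGroup E)"
      unfolding \<Gamma>_def by (rule group.hom_from_subgroup_generated[OF group_BijGroup]) (auto simp: hom_def)
    then have "(\<lambda>\<gamma>. \<gamma>) \<in> hom \<Gamma> (BijGroup E)"
      by (simp add: id_def)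
    then show "group_action \<Gamma> E (\<lambda>\<gamma>. \<gamma>)"
      by (simp add: group_action_def group_hom_def group_hom_axioms_def group_BijGroup is_group)
    show "0 < 1 / real e"
      using e_pos by simp
  next
    fix \<gamma> x y assume g: "\<gamma> \<in> carrier \<Gamma>" and xy: "x \<in> E" "y \<in> E"
    obtain m v where "adm m v" "\<gamma> = aff m v"
      using g by (rule \<Gamma>_cases)
    then show "l1_dist (Suc N) (\<gamma> x) (\<gamma> y) = l1_dist (Suc N) x y"
      using xy lin_isometric[of m x y] by (simp add: aff_def l1_dist_def)
  next
    fix \<gamma> x assume g: "\<gamma> \<in> carrier \<Gamma>" and x: "x \<in> E" and d: "l1_dist (Suc N) x (\<gamma> x) < 1 / real e"
    obtain m v where v: "adm m v" "\<gamma> = aff m v"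
      using g by (rule \<Gamma>_cases)
    have "\<bar>v N\<bar> < 1 / real e"
      using coordinate_le_l1_dist[of N "Suc N" x "\<gamma> x"] d x by (simp add: v(2) aff_def lin_ge)
    then have "\<bar>real e * v N\<bar> < 1"
      using e_pos by (simp add: abs_mult field_simps)
    moreover have "real e * v N \<in> \<int>"
      by (rule adm_last[OF v(1)]) simp
    ultimately have vN: "v N = 0"
      using Ints_abs_less_1 e_pos by fastforce
    \<comment> \<open>With the last coordinate unmoved, the exponent is a multiple of the order. The
      linear part is then trivial, and the other entries of \<open>v\<close> are integers of
      absolute value below 1.\<close>
    then have e: "e dvd m"
      using adm_last_zero v(1) by blast
    have "v i = 0" for i
    proof -
      consider "i < N" | "i = N" | "i > N" by linarith
      then show ?thesis
      proof cases
        case 1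
        have "\<bar>v i\<bar> < 1 / real e"
          using coordinate_le_l1_dist[of i "Suc N" x "\<gamma> x"] d x 1 by (simp add: v(2) aff_def lin_pow_dvd[OF e])
        also have "\<dots> \<le> 1"
          using e_pos by (simp add: field_simps)
        finally show ?thesis
          using v(1) 1 by (intro Ints_abs_less_1) (auto simp: adm_def)
      qed (use vN v(1) in \<open>auto simp: adm_def topspace_Euclidean_space\<close>)
    qed
    then have "v = (\<lambda>_. 0)" by auto
    then show "\<gamma> = \<one>\<^bsub>\<Gamma>\<^esub>"
      using aff_id[OF e] by (simp add: v(2) one_\<Gamma>)
  qed
qed

text \<open>The abelianisation map sees a group element only through the image of the origin.\<close>

definition vec_class :: "(nat \<Rightarrow> real) \<Rightarrow> int \<times> (nat \<Rightarrow> int)" where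
  "vec_class v = (\<lfloor>real e * v N\<rfloor>, \<lambda>j\<in>{..<S}. (\<Sum>i | i < N \<and> \<beta> i = j. \<lfloor>v i\<rfloor>) mod 2)"

text \<open>Modulo 2 the signs disappear, and \<open>\<tau>\<close> permutes the indices of each
  block.\<close>

lemma block_sum_lin:
  assumes "\<And>i. i < N \<Longrightarrow> v i \<in> \<int>"
  shows "(\<Sum>i | i < N \<and> \<beta> i = j. \<lfloor>(lin ^^ m) v i\<rfloor>) mod 2 = (\<Sum>i | i < N \<and> \<beta> i = j. \<lfloor>v i\<rfloor>) mod 2"
proof (induction m)
  case (Suc m)
  let ?B = "{i. i < N \<and> \<beta> i = j}" and ?w = "(lin ^^ m) v"
  have "\<lfloor>lin ?w i\<rfloor> mod 2 = \<lfloor>?w (\<tau> i)\<rfloor> mod 2" if "i \<in> ?B" for i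
  proof -
    have "?w (\<tau> i) \<in> \<int>"
      using assms that tau_less by (intro lin_int) auto
    then obtain k where k: "?w (\<tau> i) = of_int k"
      by (rule Ints_cases)
    have "lin ?w i = of_int (s i * k)"
      by (simp add: lin_def k)
    then have "\<lfloor>lin ?w i\<rfloor> = s i * k"
      by (simp only: floor_of_int)
    moreover have "(s i * k) mod 2 = k mod 2"
      using sign[of i] by auto presburger
    ultimately show ?thesis
      by (simp add: k)
  qed
  then have eq: "(\<Sum>i\<in>?B. \<lfloor>lin ?w i\<rfloor> mod 2) = (\<Sum>i\<in>?B. \<lfloor>?w (\<tau> i)\<rfloor> mod 2)"
    by (rule sum.cong[OF refl])
  have "(\<Sum>i\<in>?B. \<lfloor>lin ?w i\<rfloor>) mod 2 = (\<Sum>i\<in>?B. \<lfloor>lin ?w i\<rfloor> mod 2) mod 2"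
    by (rule mod_sum_eq[symmetric])
  also have "\<dots> = (\<Sum>i\<in>?B. \<lfloor>?w (\<tau> i)\<rfloor>) mod 2"
    unfolding eq by (rule mod_sum_eq)
  also have "(\<Sum>i\<in>?B. \<lfloor>?w (\<tau> i)\<rfloor>) = (\<Sum>i\<in>?B. \<lfloor>?w i\<rfloor>)"
    by (rule sum.reindex_bij_betw[OF tau_bij_block])
  finally show ?case
    using Suc by simp
qed simp

lemma vec_class_add:
  assumes "adm m v" "adm m' v'"
  shows "vec_class (\<lambda>i. (lin ^^ m) v' i + v i) = vec_class v \<otimes>\<^bsub>Z_Z2_pow S\<^esub> vec_class v'"
proof -
  \<comment> \<open>Admissibility makes both numbers integers, so the floor is additive
    here.\<close>
  obtain k k' :: int where "real e * v N = of_int k" "real e * v' N = of_int k'"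
    using adm_last assms by metis
  then have 1: "\<lfloor>real e * ((lin ^^ m) v' N + v N)\<rfloor> = \<lfloor>real e * v N\<rfloor> + \<lfloor>real e * v' N\<rfloor>"
    by (simp add: lin_ge distrib_left flip: of_int_add)
  have 2: "(\<Sum>i | i < N \<and> \<beta> i = j. \<lfloor>(lin ^^ m) v' i + v i\<rfloor>) mod 2 =
     ((\<Sum>i | i < N \<and> \<beta> i = j. \<lfloor>v i\<rfloor>) mod 2 + (\<Sum>i | i < N \<and> \<beta> i = j. \<lfloor>v' i\<rfloor>) mod 2) mod 2" for j
  proof -
    have eq: "(\<Sum>i | i < N \<and> \<beta> i = j. \<lfloor>(lin ^^ m) v' i + v i\<rfloor>) =
        (\<Sum>i | i < N \<and> \<beta> i = j. \<lfloor>v i\<rfloor>) + (\<Sum>i | i < N \<and> \<beta> i = j. \<lfloor>(lin ^^ m) v' i\<rfloor>)"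
      unfolding sum.distrib[symmetric]
      using assms by (intro sum.cong refl) (auto simp: adm_def floor_add2)
    have "(\<Sum>i | i < N \<and> \<beta> i = j. \<lfloor>(lin ^^ m) v' i + v i\<rfloor>) mod 2 =
        ((\<Sum>i | i < N \<and> \<beta> i = j. \<lfloor>v i\<rfloor>) + (\<Sum>i | i < N \<and> \<beta> i = j. \<lfloor>v' i\<rfloor>)) mod 2"
      unfolding eq using assms by (intro mod_add_cong refl block_sum_lin) (auto simp: adm_def)
    then show ?thesis
      unfolding mod_add_eq .
  qed
  have "(\<lambda>j\<in>{..<S}. (\<Sum>i | i < N \<and> \<beta> i = j. \<lfloor>(lin ^^ m) v' i + v i\<rfloor>) mod 2) = (\<lambda>j\<in>{..<S}.
     ((\<Sum>i | i < N \<and> \<beta> i = j. \<lfloor>v i\<rfloor>) mod 2 + (\<Sum>i | i < N \<and> \<beta> i = j. \<lfloor>v' i\<rfloor>) mod 2) mod 2)"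
    by (rule restrict_ext) (rule 2)
  then show ?thesis
    by (simp add: vec_class_def 1 cong: restrict_cong)
qed

section \<open>The map onto the abelianisation and its kernel\<close>

definition \<phi> :: "((nat \<Rightarrow> real) \<Rightarrow> nat \<Rightarrow> real) \<Rightarrow> int \<times> (nat \<Rightarrow> int)" where
  "\<phi> \<gamma> = vec_class (\<gamma> (\<lambda>_. 0))"

lemma \<phi>_aff: "\<phi> (aff m v) = vec_class v"
  by (simp add: \<phi>_def aff_def lin_zero topspace_Euclidean_space)

lemma \<phi>_hom: "\<phi> \<in> hom \<Gamma> (Z_Z2_pow S)"
proof (rule homI)
  fix \<gamma> assume "\<gamma> \<in> carrier \<Gamma>"
  show "\<phi> \<gamma> \<in> carrier (Z_Z2_pow S)"
    by (auto simp: \<phi>_def vec_class_def carrier_integer_mod_group)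
next
  fix \<gamma> \<delta> assume g: "\<gamma> \<in> carrier \<Gamma>" "\<delta> \<in> carrier \<Gamma>"
  obtain m v where v: "adm m v" "\<gamma> = aff m v"
    using g(1) by (rule \<Gamma>_cases)
  obtain m' v' where v': "adm m' v'" "\<delta> = aff m' v'"
    using g(2) by (rule \<Gamma>_cases)
  show "\<phi> (\<gamma> \<otimes>\<^bsub>\<Gamma>\<^esub> \<delta>) = \<phi> \<gamma> \<otimes>\<^bsub>Z_Z2_pow S\<^esub> \<phi> \<delta>"
    unfolding mult_\<Gamma> v(2) v'(2) aff_mult[OF v(1) v'(1)] \<phi>_aff vec_class_add[OF v(1) v'(1)] ..
qed

text \<open>\<open>rot\<close> maps to the infinite generator, and translations supported on one
  representative per block reach every tuple of parities.\<close>

lemma \<phi>_onto: "\<phi> ` carrier \<Gamma> = carrier (Z_Z2_pow S)"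
proof
  show "\<phi> ` carrier \<Gamma> \<subseteq> carrier (Z_Z2_pow S)"
    using hom_in_carrier[OF \<phi>_hom] by blast
  interpret G: group \<Gamma> by (rule group_\<Gamma>)
  interpret Q: comm_group "Z_Z2_pow S" by (rule comm_group_Z_Z2_pow)
  interpret \<phi>: group_hom \<Gamma> "Z_Z2_pow S" \<phi>
    using \<phi>_hom by (simp add: group_hom_def group_hom_axioms_def G.is_group Q.is_group)
  define z0 :: "nat \<Rightarrow> int" where "z0 = (\<lambda>j\<in>{..<S}. 0)"
  have z0_car: "(n, z0) \<in> carrier (Z_Z2_pow S)" for n
    by (auto simp: z0_def Z2_carrier)
  have z0_add: "(n, z0) \<otimes>\<^bsub>Z_Z2_pow S\<^esub> (n', z0) = (n + n', z0)" for n n'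
    by (auto simp: z0_def)
  have z0_one: "\<one>\<^bsub>Z_Z2_pow S\<^esub> = (0, z0)"
    by (simp add: z0_def)
  have rot: "\<phi> rot = (1, z0)"
    using e_pos by (auto simp: rot_def \<phi>_aff vec_class_def z0_def intro!: sum.neutral restrict_ext)
  have sub: "subgroup (\<phi> ` carrier \<Gamma>) (Z_Z2_pow S)"
    by (rule \<phi>.img_is_subgroup)
  have rot_in: "(1, z0) \<in> \<phi> ` carrier \<Gamma>"
    using in_\<Gamma>(1) unfolding rot[symmetric] by (rule imageI)
  have n: "(n, z0) \<in> \<phi> ` carrier \<Gamma>" for n
  proof (induction n rule: int_induct[where k = 0])
    case base
    show ?case using subgroup.one_closed[OF sub] by (simp only: z0_one)
  next
    case (step1 i)
    show ?case using subgroup.m_closed[OF sub step1(2) rot_in] by (simp only: z0_add)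
  next
    case (step2 i)
    have "inv\<^bsub>Z_Z2_pow S\<^esub> (1, z0) = (-1, z0)"
      by (rule Q.inv_equality[OF _ z0_car z0_car]) (simp only: z0_add z0_one, simp)
    then have "(-1, z0) \<in> \<phi> ` carrier \<Gamma>"
      using subgroup.m_inv_closed[OF sub rot_in] by (simp only:)
    from subgroup.m_closed[OF sub step2(2) this] show ?case
      by (simp only: z0_add) simp
  qed
  obtain \<rho> where \<rho>: "\<And>j. j < S \<Longrightarrow> \<rho> j < N" "\<And>j. j < S \<Longrightarrow> \<beta> (\<rho> j) = j"
    using block_onto by metis
  show "carrier (Z_Z2_pow S) \<subseteq> \<phi> ` carrier \<Gamma>"
  proof
    fix q assume "q \<in> carrier (Z_Z2_pow S)"
    then obtain n b where q: "q = (n, b)" "b \<in> (\<Pi>\<^sub>E i\<in>{..<S}. {0, 1})"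
      by (cases q) (auto simp: Z2_carrier)
    have bm: "b j mod 2 = b j" if "j < S" for j
      using PiE_mem[OF q(2), of j] that by auto
    define z where "z = (\<lambda>i. if i < N \<and> i = \<rho> (\<beta> i) then b (\<beta> i) else 0)"
    have "(\<Sum>i | i < N \<and> \<beta> i = j. \<lfloor>trans_vec z i\<rfloor>) = b j" if "j < S" for j
    proof -
      have "(\<Sum>i | i < N \<and> \<beta> i = j. \<lfloor>trans_vec z i\<rfloor>) = (\<Sum>i | i < N \<and> \<beta> i = j. if i = \<rho> j then b j else 0)"
        by (intro sum.cong refl) (auto simp: trans_vec_def z_def)
      also have "\<dots> = b j"
        using \<rho>[OF that] by (simp add: sum.delta)
      finally show ?thesis .
    qed
    then have "vec_class (trans_vec z) = (0, b)"
      using q(2) bm by (auto simp: vec_class_def fun_eq_iff PiE_iff extensional_def trans_vec_def z_def)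
    then have "\<phi> (transl z) = (0, b)"
      by (simp only: transl_def \<phi>_aff)
    then have "(0, b) \<in> \<phi> ` carrier \<Gamma>"
      using imageI[OF in_\<Gamma>(2)[of z], of \<phi>] by (simp only:)
    from subgroup.m_closed[OF sub n this]
    have "(n, z0) \<otimes>\<^bsub>Z_Z2_pow S\<^esub> (0, b) \<in> \<phi> ` carrier \<Gamma>" .
    moreover have "(n, z0) \<otimes>\<^bsub>Z_Z2_pow S\<^esub> (0, b) = q"
      using q bm by (auto simp: z0_def fun_eq_iff PiE_iff extensional_def)
    ultimately show "q \<in> \<phi> ` carrier \<Gamma>" by (simp only:)
  qed
qed

text \<open>A zero last entry forces a pure translation, and the parities then say that its vector
  has even block sums. It remains to see that \<open>f\<close> on translations is invariant under
  the matrix, which holds because conjugation by \<open>rot\<close> is invisible in an abelian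
  group.\<close>

lemma \<phi>_kernel:
  fixes W :: "('w, 'm) monoid_scheme"
  assumes W: "comm_group W" and f: "f \<in> hom \<Gamma> W" and g: "\<gamma> \<in> carrier \<Gamma>" and ker: "\<phi> \<gamma> = \<one>\<^bsub>Z_Z2_pow S\<^esub>"
  shows "f \<gamma> = \<one>\<^bsub>W\<^esub>"
proof -
  interpret W: comm_group W by (rule W)
  obtain m v where v: "adm m v" "\<gamma> = aff m v"
    using g by (rule \<Gamma>_cases)
  have fl: "\<lfloor>real e * v N\<rfloor> = 0" and ev: "\<And>j. j < S \<Longrightarrow> (\<Sum>i | i < N \<and> \<beta> i = j. \<lfloor>v i\<rfloor>) mod 2 = 0"
    using ker unfolding v(2) \<phi>_aff vec_class_def by (auto simp: fun_eq_iff split: if_splits)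
  have "real e * v N = 0"
  proof -
    obtain k :: int where "real e * v N = of_int k"
      using adm_last[OF v(1)] by metis
    then show ?thesis using fl by simp
  qed
  then have vN: "v N = 0" using e_pos by simp
  define z where "z = (\<lambda>i. if i < N then \<lfloor>v i\<rfloor> else 0)"
  have "v i = trans_vec z i" for i
  proof -
    consider "i < N" | "i = N" | "i > N" by linarith
    then show ?thesis
    proof cases
      case 1
      then have "v i \<in> \<int>" using v(1) by (simp add: adm_def)
      then show ?thesis using 1 by (auto simp: trans_vec_def z_def elim: Ints_cases)
    qed (use vN v(1) in \<open>auto simp: adm_def topspace_Euclidean_space trans_vec_def z_def\<close>)
  qed
  then have "v = trans_vec z" by auto
  then have \<gamma>: "\<gamma> = transl z"
    using aff_pure[OF adm_last_zero[OF v(1) vN]] by (simp add: v(2) transl_def)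
  have fc: "f \<delta> \<in> carrier W" if "\<delta> \<in> carrier \<Gamma>" for \<delta>
    using f that by (rule hom_in_carrier)
  have "f (transl z) = \<one>\<^bsub>W\<^esub>"
  proof (rule invariant_hom_trivial[OF W, of "\<lambda>z. f (transl z)"])
    show "f (transl z) \<in> carrier W" for z
      using in_\<Gamma> fc by blast
    show "f (transl (\<lambda>i. z i + z' i)) = f (transl z) \<otimes>\<^bsub>W\<^esub> f (transl z')" for z z'
    proof -
      have "transl z \<otimes>\<^bsub>\<Gamma>\<^esub> transl z' = aff (0 + 0) (\<lambda>i. (lin ^^ 0) (trans_vec z') i + trans_vec z i)"
        unfolding mult_\<Gamma> transl_def by (rule aff_mult[OF adm_trans_vec adm_trans_vec])
      also have "(\<lambda>i. (lin ^^ 0) (trans_vec z') i + trans_vec z i) = trans_vec (\<lambda>i. z i + z' i)"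
        by (auto simp: trans_vec_def)
      also have "aff (0 + 0) \<dots> = transl (\<lambda>i. z i + z' i)"
        by (simp add: transl_def)
      finally show ?thesis
        using hom_mult[OF f in_\<Gamma>(2)[of z] in_\<Gamma>(2)[of z']] by (simp only:)
    qed
    show "f (transl (\<lambda>i. s i * z (\<tau> i))) = f (transl z)" for z
    proof -
      \<comment> \<open>The vector \<open>?z\<close> is the matrix applied to \<open>z\<close>, and
        \<open>rot\<close> followed after \<open>transl z\<close> equals \<open>transl ?z\<close>
        after \<open>rot\<close>.\<close>
      let ?b = "\<lambda>i. if i = N then 1 / real e else 0 :: real" and ?z = "\<lambda>i. s i * z (\<tau> i)"
      have tl: "\<tau> i < Suc N \<longleftrightarrow> i < Suc N" for i
        using tau_less[of i] tau_id[of i] by (cases "i < N") auto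
      have "rot \<otimes>\<^bsub>\<Gamma>\<^esub> transl z = aff (1 + 0) (\<lambda>i. (lin ^^ 1) (trans_vec z) i + ?b i)"
        unfolding mult_\<Gamma> transl_def rot_def by (rule aff_mult[OF adm_rot adm_trans_vec])
      also have "(\<lambda>i. (lin ^^ 1) (trans_vec z) i + ?b i) = (\<lambda>i. (lin ^^ 0) ?b i + trans_vec ?z i)"
      proof
        fix i
        show "(lin ^^ 1) (trans_vec z) i + ?b i = (lin ^^ 0) ?b i + trans_vec ?z i"
          using tl[of i] by (cases "i < Suc N") (simp_all add: lin_def trans_vec_def del: less_Suc_eq)
      qed
      also have "aff (1 + 0) \<dots> = aff (0 + 1) (\<lambda>i. (lin ^^ 0) ?b i + trans_vec ?z i)"
        by simp
      also have "\<dots> = transl ?z \<otimes>\<^bsub>\<Gamma>\<^esub> rot"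
        unfolding mult_\<Gamma> transl_def rot_def by (rule aff_mult[OF adm_trans_vec adm_rot, symmetric])
      finally have "f (rot \<otimes>\<^bsub>\<Gamma>\<^esub> transl z) = f (transl ?z \<otimes>\<^bsub>\<Gamma>\<^esub> rot)" by simp
      then have "f rot \<otimes>\<^bsub>W\<^esub> f (transl z) = f (transl ?z) \<otimes>\<^bsub>W\<^esub> f rot"
        using hom_mult[OF f in_\<Gamma>(1) in_\<Gamma>(2)] hom_mult[OF f in_\<Gamma>(2) in_\<Gamma>(1)] by simp
      then have "f (transl z) \<otimes>\<^bsub>W\<^esub> f rot = f (transl ?z) \<otimes>\<^bsub>W\<^esub> f rot"
        using W.m_comm[OF fc[OF in_\<Gamma>(1)] fc[OF in_\<Gamma>(2)]] by simp
      then show ?thesis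
        using W.right_cancel fc in_\<Gamma> by metis
    qed
    show "z i = 0" if "i \<ge> N" for i
      using that by (simp add: z_def)
    show "even (\<Sum>i | i < N \<and> \<beta> i = j. z i)" if "j < S" for j
    proof -
      have "(\<Sum>i | i < N \<and> \<beta> i = j. z i) = (\<Sum>i | i < N \<and> \<beta> i = j. \<lfloor>v i\<rfloor>)"
        by (intro sum.cong) (auto simp: z_def)
      then show ?thesis
        using ev[OF that] by (simp add: even_iff_mod_2_eq_zero)
    qed
  qed
  then show ?thesis by (simp add: \<gamma>)
qed

lemma \<phi>_kernel_subset:
  assumes W: "comm_group W" and f: "f \<in> hom \<Gamma> W"
  shows "kernel \<Gamma> (Z_Z2_pow S) \<phi> \<subseteq> kernel \<Gamma> W f"
proof
  fix \<gamma> assume "\<gamma> \<in> kernel \<Gamma> (Z_Z2_pow S) \<phi>"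
  then have g: "\<gamma> \<in> carrier \<Gamma>" "\<phi> \<gamma> = \<one>\<^bsub>Z_Z2_pow S\<^esub>"
    unfolding kernel_def by blast+
  from g(1) \<phi>_kernel[OF W f g] show "\<gamma> \<in> kernel \<Gamma> W f"
    unfolding kernel_def by blast
qed

theorem quotient_homology:
  defines "Y \<equiv> orbit_space \<Gamma> (Euclidean_space (Suc N))"
  shows "homology_group 1 Y \<cong> Z_Z2_pow S"
    and "cohomology_group 1 Y integer_group \<cong> integer_group"
    and "cohomology_group 1 Y (integer_mod_group 2) \<cong> product_group {..<S + 1} (\<lambda>_. integer_mod_group 2)"
proof -
  let ?X = "l1.mtopology (Suc N)" and ?Y = "orbit_space \<Gamma> (l1.mtopology (Suc N))"
  interpret A: uniformly_free_action E "l1_dist (Suc N)" \<Gamma> "1 / real e"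
    by (rule uniformly_free)
  interpret Q: comm_group "Z_Z2_pow S" by (rule comm_group_Z_Z2_pow)
  have top: "?X = Euclidean_space (Suc N)"
    by (rule mtopology_l1)
  have ne: "E \<noteq> {}"
    using nontrivial_Euclidean_space by simp
  have path: "path_connected_space ?X"
    unfolding top by (rule path_connected_Euclidean_space)
  \<comment> \<open>Euclidean space is contractible, and in degree 1 reduced and ordinary homology
    agree.\<close>
  have acyclic: "singular_relboundary 1 ?X {} z" if z: "singular_relcycle 1 ?X {} z" for z
  proof -
    have "trivial_group (reduced_homology_group 1 ?X)"
      unfolding top by (rule trivial_reduced_homology_group_contractible_space[OF contractible_Euclidean_space])
    then have "trivial_group (homology_group 1 ?X)"
      by (simp add: un_reduced_homology_group)
    moreover have "homologous_rel_set 1 ?X {} z \<in> carrier (homology_group 1 ?X)"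
      using z carrier_relative_homology_group[of 1 ?X "{}"] by simp
    ultimately have "homologous_rel_set 1 ?X {} z = \<one>\<^bsub>homology_group 1 ?X\<^esub>"
      by (simp only: trivial_group_def singleton_iff)
    then show ?thesis
      using one_relative_homology_group[of 1 ?X "{}"]
      by (simp add: homologous_rel_set_eq_relboundary)
  qed
  have "\<exists>c. characteristic_cocycle ?Y (Z_Z2_pow S) c"
    by (rule A.characteristic_cocycle_exists[OF ne path acyclic comm_group_Z_Z2_pow \<phi>_hom \<phi>_onto \<phi>_kernel_subset])
  then obtain c where c: "characteristic_cocycle ?Y (Z_Z2_pow S) c"
    by (rule exE)
  \<comment> \<open>The lifting results concern the metric topology, the statement the product
    topology.\<close>
  have Y: "Y = ?Y"
    unfolding Y_def top ..
  have pathY: "path_connected_space Y" and neY: "topspace Y \<noteq> {}"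
    unfolding Y using path_connected_space_quotient_map_image[of ?X ?Y "orbit \<Gamma> (\<lambda>\<gamma>. \<gamma>)"] path ne
    by (auto simp: A.topspace_quot orbit_space_def quotient_map_quotient_topology)
  show "homology_group 1 Y \<cong> Z_Z2_pow S"
    unfolding Y by (rule homology_group_1_iso[OF Q.is_group c])
  have H: "cohomology_group 1 Y A \<cong> hom_group (Z_Z2_pow S) A" if "comm_group A" for A :: "int monoid"
    by (rule cohomology_group_1_iso[OF that pathY neY comm_group_Z_Z2_pow c[folded Y]])
  show "cohomology_group 1 Y integer_group \<cong> integer_group"
    by (rule iso_trans[OF H[OF abelian_integer_group] hom_group_Z_Z2_pow_Z])
  show "cohomology_group 1 Y (integer_mod_group 2) \<cong> product_group {..<S + 1} (\<lambda>_. integer_mod_group 2)"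
    by (rule iso_trans[OF H[OF abelian_integer_mod_group] hom_group_Z_Z2_pow_Z2])
qed

end

section \<open>The manifolds\<close>

text \<open>A block of size \<open>2 ^ i\<close> has order dividing \<open>2 ^ Suc i\<close>, and
  \<open>i < r\<close>, so \<open>2 ^ r\<close> is a common multiple; the number of blocks is the
  sum of the multiplicities.\<close>

lemma B_mat_signed_blocks:
  assumes "r \<ge> 2"
  obtains N s \<tau> \<beta> where "signed_blocks N (\<Sum>i = 1..r - 1. k i + k' i) (2 ^ r) s \<tau> \<beta>"
    "signed_perm_mat (B_mat r k k') (Suc N) s \<tau>"
proof -
  define Bs where "Bs = (\<lambda>i. replicate (k i) (C_mat i) @ replicate (k' i) (J_mat i))"
  define As where "As = concat (map Bs (rev [1..<r]))"
  have "\<exists>n e' s \<tau>. signed_cycle A n e' s \<tau> \<and> e' dvd 2 ^ r" if A: "A \<in> set As" for A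
  proof -
    obtain i where i: "i < r" "A = C_mat i \<or> A = J_mat i"
      using A by (auto simp: As_def Bs_def)
    then have "(2::nat) ^ Suc i dvd 2 ^ r"
      by (intro le_imp_power_dvd) simp
    moreover have "\<exists>s \<tau>. signed_cycle A (2 ^ i) (2 ^ Suc i) s \<tau>"
      using i(2) signed_cycle_C_mat[of i] signed_cycle_J_mat[of i] by blast
    ultimately show ?thesis by blast
  qed
  then obtain N s \<tau> \<beta> where *: "signed_blocks N (length As) (2 ^ r) s \<tau> \<beta>"
    "signed_perm_mat (diag_block_mat (As @ [1\<^sub>m 1])) (Suc N) s \<tau>"
    using signed_blocks_diag_block_mat[of "2 ^ r" As] by auto
  have "length (concat (map Bs (rev is))) = (\<Sum>i\<leftarrow>is. k i + k' i)" for "is"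
    by (induction "is") (simp_all add: Bs_def)
  then have "length As = (\<Sum>i = 1..<r. k i + k' i)"
    by (simp add: As_def interv_sum_list_conv_sum_set_nat)
  also have "{1..<r} = {1..r - 1}"
    using assms by auto
  finally have "length As = (\<Sum>i = 1..r - 1. k i + k' i)" .
  then show thesis
    using that * by (simp add: B_mat_def As_def Bs_def)
qed

theorem proposition5p3:
  fixes r :: nat and k k' :: "nat \<Rightarrow> nat"
  assumes "r \<ge> 2"
    and "k' 1 = 0"
    and "k (r - 1) + k' (r - 1) > 0"
    and "odd (k 1 + k' 1)"
  shows "homology_group 1 (M_space r k k') \<cong>
           integer_group \<times>\<times>
             product_group {..<(\<Sum>i = 1..r - 1. k i + k' i)} (\<lambda>_. integer_mod_group 2)
         \<and> cohomology_group 1 (M_space r k k') integer_group \<cong> integer_group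
         \<and> cohomology_group 1 (M_space r k k') (integer_mod_group 2) \<cong>
           product_group {..<(\<Sum>i = 1..r - 1. k i + k' i) + 1} (\<lambda>_. integer_mod_group 2)"
proof -
  obtain N s \<tau> \<beta> where B: "signed_blocks N (\<Sum>i = 1..r - 1. k i + k' i) (2 ^ r) s \<tau> \<beta>"
    "signed_perm_mat (B_mat r k k') (Suc N) s \<tau>"
    using B_mat_signed_blocks[OF assms(1)] .
  interpret signed_blocks N "\<Sum>i = 1..r - 1. k i + k' i" "2 ^ r" s \<tau> \<beta>
    by (rule B(1))
  note p = signed_perm_matD[OF B(2)]
  \<comment> \<open>\<open>N\<close> comes from an existence statement, so it is tied to
    \<open>B_dim\<close> by comparing the two sizes of the matrix.\<close>
  have dim: "B_dim r k k' = Suc N"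
    using p(1) B_mat_carrier[of r k k'] by (metis carrier_matD(1))
  have "affine_gen r k k' = rot"
  proof (rule extensionalityI[of _ E])
    show "affine_gen r k k' \<in> extensional E" "rot \<in> extensional E"
      by (simp_all add: affine_gen_def rot_def aff_def dim Let_def)
    fix x assume x: "x \<in> E"
    show "affine_gen r k k' x = rot x"
    proof
      fix i
      let ?u = "Matrix.vec (Suc N) x + (1 / 2 ^ r) \<cdot>\<^sub>v unit_vec (Suc N) N :: real vec"
      show "affine_gen r k k' x i = rot x i"
      proof (cases "i < Suc N")
        case True
        have "(map_mat real_of_int (B_mat r k k') *\<^sub>v ?u) $ i =
            (\<Sum>j<Suc N. real_of_int (B_mat r k k' $$ (i, j)) * ?u $ j)"
          using p(1) True by (simp add: scalar_prod_def lessThan_atLeast0)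
        also have "\<dots> = (\<Sum>j<Suc N. if j = \<tau> i then real_of_int (s i) * ?u $ j else 0)"
          using p(4)[OF True] by (intro sum.cong) auto
        also have "\<dots> = real_of_int (s i) * ?u $ \<tau> i"
          using p(2)[OF True] by (simp add: sum.delta)
        also have "\<dots> = real_of_int (s i) * x (\<tau> i) + (if i = N then 1 / 2 ^ r else 0)"
        proof -
          \<comment> \<open>The shift sits in column \<open>N\<close>, which only row
            \<open>N\<close> meets; its sign there is 1.\<close>
          have "\<tau> i = N \<longleftrightarrow> i = N"
            using True tau_less[of i] tau_id[of i] by (cases "i < N") auto
          then show ?thesis
            using p(2)[OF True] sign_id[of N] by (auto simp: algebra_simps)
        qed
        finally show ?thesis
          using x True by (simp add: affine_gen_def dim Let_def rot_def aff_def lin_def)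
      next
        case False
        then show ?thesis
          using x tau_id[of i] sign_id[of i]
          by (simp add: affine_gen_def dim Let_def rot_def aff_def lin_def topspace_Euclidean_space)
      qed
    qed
  qed
  moreover have "translation (B_dim r k k') = transl"
  proof
    fix z
    show "translation (B_dim r k k') z = transl z"
      unfolding translation_def transl_def aff_def trans_vec_def dim
      by (rule restrict_ext) (auto simp: topspace_Euclidean_space fun_eq_iff)
  qed
  ultimately have "Gamma r k k' = \<Gamma>"
    by (simp add: Gamma_def \<Gamma>_def dim)
  then have "M_space r k k' = orbit_space \<Gamma> (Euclidean_space (Suc N))"
    by (simp add: M_space_def dim)
  then show ?thesis
    using quotient_homology by simp
qed

end
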